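(* Let $r\ge 4$ and let $a_1,\ldots,a_{s+1},b_1,\ldots,b_s\in\mathbb{R}$ satisfy $a_{s+2-i}=a_i$ and $b_{s+1-i}=b_i$, and suppose that the symmetric splitting method $$\psi_\tau=\varphi^{[a]}_{a_{s+1}\tau}\circ\varphi^{[b]}_{b_s\tau}\circ\varphi^{[a]}_{a_s\tau}\circ\cdots\circ\varphi^{[b]}_{b_1\tau}\circ\varphi^{[a]}_{a_1\tau}$$ is of generalized order $(r,4)$. Let $\widetilde\varphi^{[b]}_\tau$ be one step of size $\tau$ of a second-order symmetric integrator applied to $x'=\varepsilon f^{[b]}(x)$, and consider the method $$\widetilde\psi_\tau=\varphi^{[a]}_{a_{s+1}\tau}\circ\widetilde\varphi^{[b]}_{b_s\tau}\circ\varphi^{[a]}_{a_s\tau}\circ\cdots\circ\widetilde\varphi^{[b]}_{b_1\tau}\circ\varphi^{[a]}_{a_1\tau}.$$ Then $\widetilde\psi_\tau$ is of generalized order $(r,4,2)$. If in addition $$\sum_{i=1}^{s}b_i^3=0,$$ then $\widetilde\psi_\tau$ is of generalized order $(r,4)$.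
   Context: Setting: $f^{[a]},f^{[b]}:\mathbb{R}^D\to\mathbb{R}^D$ are smooth vector fields and $\varepsilon$ is a small real parameter. For small $\tau$, $\varphi_\tau$, $\varphi^{[a]}_\tau$ and $\varphi^{[b]}_\tau$ denote the exact $\tau$-flows of $x'=f^{[a]}(x)+\varepsilon f^{[b]}(x)$, of $x'=f^{[a]}(x)$, and of $x'=\varepsilon f^{[b]}(x)$, respectively. Generalized order: for integers $r_1\ge r_2\ge\cdots\ge r_m$, a one-step method $\chi_\tau$ for $x'=f^{[a]}(x)+\varepsilon f^{[b]}(x)$ is of generalized order $(r_1,\ldots,r_m)$ if its local error satisfies $$\chi_\tau(x)-\varphi_\tau(x)=\mathcal{O}(\varepsilon\tau^{r_1+1}+\varepsilon^2\tau^{r_2+1}+\cdots+\varepsilon^m\tau^{r_m+1})\quad\text{as }(\tau,\varepsilon)\to(0,0),$$ for arbitrary smooth $f^{[a]},f^{[b]}$ and every $x$. Thus order $(r,4)$ means local error $\mathcal{O}(\varepsilon\tau^{r+1}+\varepsilon^2\tau^5)$, and order $(r,4,2)$ means local error $\mathcal{O}(\varepsilon\tau^{r+1}+\varepsilon^2\tau^5+\varepsilon^3\tau^3)$. Generalized orders of symmetric methods have even entries, so $r$ is even. The approximate flow: $\widetilde\varphi^{[b]}_\tau$ is symmetric, i.e. $\widetilde\varphi^{[b]}_{-\tau}=(\widetilde\varphi^{[b]}_\tau)^{-1}$, and depends on $\tau$ and $\varepsilon$ only through the product $\tau\varepsilon$; second order means $\widetilde\varphi^{[b]}_\tau(x)-\varphi^{[b]}_\tau(x)=\mathcal{O}((\tau\varepsilon)^3)$.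 Equivalently, for smooth $g:\mathbb{R}^D\to\mathbb{R}$, $g(\widetilde\varphi^{[b]}_\tau(x))$ has the formal expansion $\exp\big(\tau\varepsilon B+(\tau\varepsilon)^3D_3+(\tau\varepsilon)^5D_5+\cdots\big)g(x)$, where $B\,g=f^{[b]}\cdot\nabla g$ and $D_3,D_5,\ldots$ are first-order differential operators (vector fields) determined by the integrator and $f^{[b]}$. *)

theory Defs
  imports "HOL-Analysis.Analysis" "HOL-Library.Landau_Symbols"
begin

text \<open>
  A map on an open subset of a Euclidean space is of class \<open>C\<^sup>k\<close> iff all its iterated
  directional derivatives up to order \<open>k\<close> exist and are continuous.
\<close>

fun Ck_on :: "nat \<Rightarrow> 'a::euclidean_space set \<Rightarrow> ('a \<Rightarrow> 'b::real_normed_vector) \<Rightarrow> bool" where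
  "Ck_on 0 S f \<longleftrightarrow> continuous_on S f"
| "Ck_on (Suc k) S f \<longleftrightarrow>
     (\<forall>x\<in>S. f differentiable (at x)) \<and> (\<forall>v. Ck_on k S (\<lambda>x. frechet_derivative f (at x) v))"

definition smooth_on :: "'a::euclidean_space set \<Rightarrow> ('a \<Rightarrow> 'b::real_normed_vector) \<Rightarrow> bool" where
  "smooth_on S f \<longleftrightarrow> open S \<and> (\<forall>k. Ck_on k S f)"

text \<open>
  Vector fields need not be complete, so flows and integrators are only local objects.
  \<open>flow f t x\<close> is the value at time \<open>t\<close> (of either sign) of the solution of \<open>x' = f(x)\<close>
  starting at \<open>x\<close>.  For smooth \<open>f\<close> that value is unique if the solution exists up to time \<open>t\<close>,
  as it does for small \<open>t\<close>; otherwise \<open>flow f t x\<close> is unspecified.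
\<close>

definition flow :: "('v::euclidean_space \<Rightarrow> 'v) \<Rightarrow> real \<Rightarrow> 'v \<Rightarrow> 'v" where
  "flow f t x = (THE y. \<exists>u. u 0 = x \<and> u t = y \<and>
     (\<forall>s\<in>closed_segment 0 t. (u has_vector_derivative f (u s)) (at s within closed_segment 0 t)))"

type_synonym 'v one_step_method = "('v \<Rightarrow> 'v) \<Rightarrow> ('v \<Rightarrow> 'v) \<Rightarrow> real \<Rightarrow> real \<Rightarrow> 'v \<Rightarrow> 'v"

text \<open>
  A one-step method \<open>M\<close> for \<open>x' = fa(x) + \<epsilon> fb(x)\<close> is used as \<open>M fa fb \<epsilon> \<tau> x\<close>.  As \<open>\<tau>\<close> and \<open>\<epsilon>\<close> may have
  either sign, absolute values keep the terms of the error bound from cancelling.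
\<close>

definition generalized_order :: "'v::euclidean_space one_step_method \<Rightarrow> nat list \<Rightarrow> bool" where
  "generalized_order M rs \<longleftrightarrow>
     sorted_wrt (\<ge>) rs \<and>
     (\<forall>fa fb. smooth_on UNIV fa \<longrightarrow> smooth_on UNIV fb \<longrightarrow>
       (\<forall>x. (\<lambda>(\<tau>, \<epsilon>). norm (M fa fb \<epsilon> \<tau> x - flow (\<lambda>y. fa y + \<epsilon> *\<^sub>R fb y) \<tau> x))
              \<in> O[at (0, 0)](\<lambda>(\<tau>, \<epsilon>). \<Sum>i<length rs. \<bar>\<epsilon>\<bar> ^ (i + 1) * \<bar>\<tau>\<bar> ^ (rs ! i + 1))))"

text \<open>
  The composition
  \<open>P\<^bsub>a(s+1)\<tau>\<^esub> \<circ> Q\<^bsub>b(s)\<tau>\<^esub> \<circ> P\<^bsub>a(s)\<tau>\<^esub> \<circ> \<dots> \<circ> Q\<^bsub>b(1)\<tau>\<^esub> \<circ> P\<^bsub>a(1)\<tau>\<^esub>\<close>; the coefficients are indexed from 1.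
\<close>

fun splitting ::
  "(real \<Rightarrow> 'v \<Rightarrow> 'v) \<Rightarrow> (real \<Rightarrow> 'v \<Rightarrow> 'v) \<Rightarrow> (nat \<Rightarrow> real) \<Rightarrow> (nat \<Rightarrow> real) \<Rightarrow> nat \<Rightarrow> real \<Rightarrow> 'v \<Rightarrow> 'v"
where
  "splitting P Q a b 0 \<tau> = P (a 1 * \<tau>)"
| "splitting P Q a b (Suc s) \<tau> =
     P (a (s + 2) * \<tau>) \<circ> Q (b (s + 1) * \<tau>) \<circ> splitting P Q a b s \<tau>"

definition splitting_method ::
  "(nat \<Rightarrow> real) \<Rightarrow> (nat \<Rightarrow> real) \<Rightarrow> nat \<Rightarrow> 'v::euclidean_space one_step_method" where
  "splitting_method a b s fa fb \<epsilon> = splitting (flow fa) (flow (\<lambda>y. \<epsilon> *\<^sub>R fb y)) a b s"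

type_synonym 'v integrator = "('v \<Rightarrow> 'v) \<Rightarrow> real \<Rightarrow> 'v \<Rightarrow> 'v"

text \<open>
  \<open>\<Phi> g h x\<close> is one step of size \<open>h\<close> of the integrator \<open>\<Phi>\<close> applied to \<open>x' = g(x)\<close>.
\<close>

definition approx_splitting_method ::
  "'v::euclidean_space integrator \<Rightarrow> (nat \<Rightarrow> real) \<Rightarrow> (nat \<Rightarrow> real) \<Rightarrow> nat \<Rightarrow> 'v one_step_method" where
  "approx_splitting_method \<Phi> a b s fa fb \<epsilon> = splitting (flow fa) (\<Phi> (\<lambda>y. \<epsilon> *\<^sub>R fb y)) a b s"

definition smooth_integrator :: "'v::euclidean_space integrator \<Rightarrow> bool" where
  "smooth_integrator \<Phi> \<longleftrightarrow>
     (\<forall>g x. smooth_on UNIV g \<longrightarrow> (\<exists>U. (0, x) \<in> U \<and> smooth_on U (\<lambda>(h, y). \<Phi> g h y)))"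

text \<open>
  A step for the field \<open>\<epsilon> g\<close> depends on \<open>\<tau>\<close> and \<open>\<epsilon>\<close> only through the product \<open>\<tau> \<epsilon>\<close>.
\<close>

definition scaling_integrator :: "'v::euclidean_space integrator \<Rightarrow> bool" where
  "scaling_integrator \<Phi> \<longleftrightarrow>
     (\<forall>g x. smooth_on UNIV g \<longrightarrow>
       (\<forall>\<^sub>F (\<tau>, \<epsilon>, y) in nhds (0, 0, x). \<Phi> (\<lambda>z. \<epsilon> *\<^sub>R g z) \<tau> y = \<Phi> g (\<tau> * \<epsilon>) y))"

definition symmetric_integrator :: "'v::euclidean_space integrator \<Rightarrow> bool" where
  "symmetric_integrator \<Phi> \<longleftrightarrow>
     (\<forall>g x. smooth_on UNIV g \<longrightarrow> (\<forall>\<^sub>F (h, y) in nhds (0, x). \<Phi> g (- h) (\<Phi> g h y) = y))"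

text \<open>
  For a scaling integrator and the field \<open>\<epsilon> g\<close>, the bound below is \<open>O((\<tau> \<epsilon>)\<^sup>3)\<close>, with \<open>h = \<tau> \<epsilon>\<close>.
\<close>

definition second_order_integrator :: "'v::euclidean_space integrator \<Rightarrow> bool" where
  "second_order_integrator \<Phi> \<longleftrightarrow>
     (\<forall>g x. smooth_on UNIV g \<longrightarrow>
       (\<lambda>h. norm (\<Phi> g h x - flow g h x)) \<in> O[at 0](\<lambda>h. \<bar>h\<bar> ^ 3))"

end

theory Submission
  imports Defs
begin

text \<open>
  Write \<open>S\<close> for the splitting with the approximate flow and \<open>R\<close> for the one with the exact flow.
  By the triangle inequality only \<open>S - R\<close> has to be estimated.  Taylor expansion in \<open>h\<close> gives
  \<open>\<Phi>\<^sub>h - \<phi>\<^sub>h = h\<^sup>3 d + h\<^sup>4 e + O(h\<^sup>5)\<close> locally uniformly, and pushing this through the composition yields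
  \<open>S - R = (\<tau> \<epsilon>)\<^sup>3 ((\<Sum>b\<^sub>i\<^sup>3) d + \<tau> H(\<epsilon>, \<cdot>)) + O(\<epsilon>\<^sup>3 \<tau>\<^sup>5)\<close>
  with a coefficient \<open>H\<close> that is continuous in \<open>(\<epsilon>, y)\<close>.  This is \<open>O(\<epsilon>\<^sup>3 \<tau>\<^sup>3)\<close> in general.
  If \<open>\<Sum>b\<^sub>i\<^sup>3 = 0\<close>, comparing \<open>S\<^bsub>-\<tau>\<^esub> \<circ> S\<^bsub>\<tau>\<^esub> = id = R\<^bsub>-\<tau>\<^esub> \<circ> R\<^bsub>\<tau>\<^esub>\<close> for fixed \<open>\<epsilon>\<close> forces \<open>2 H(\<epsilon>, x) = 0\<close>,
  which leaves \<open>O(\<epsilon>\<^sup>3 \<tau>\<^sup>5)\<close>, a quantity bounded by \<open>\<epsilon>\<^sup>2 \<bar>\<tau>\<bar>\<^sup>5\<close>.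

  Differentiability of a flow with respect to its initial value is never needed: Lipschitz estimates for
  \<open>\<phi>\<^sub>t(y) - y - t f(y)\<close> with constant \<open>O(t\<^sup>2)\<close> suffice.
\<close>

section \<open>Calculus of smooth maps\<close>

text \<open>The obstacle is the term of size \<open>\<epsilon>^3 \<tau>^4\<close>: when \<tau> is
  small compared with \<open>\<epsilon>^2\<close> it is not controlled by
  \<open>\<bar>\<epsilon>\<bar> \<bar>\<tau>\<bar>^(r+1) + \<epsilon>^2
  \<bar>\<tau>\<bar>^5\<close>, so its coefficient must vanish exactly for every small nonzero
  \<epsilon>. No cancellation is visible in the explicit sum for \<open>H\<close>, and symmetry of
  the integrator does not remove \<open>e\<close>: in the expansion of a difference of maps, as
  opposed to that of an exponent, the products \<open>B D_3\<close> and \<open>D_3 B\<close>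
  contribute at order 4. Reversal of time succeeds because the power \<open>\<tau>^4\<close> is
  even, so that the step forward and the step back contribute with equal signs. The odd power
  \<open>\<tau>^3\<close> contributes with opposite signs; reversal leaves its coefficient
  undetermined, which is where the condition on the cubes comes in. Remainders retain the factor
  \<open>\<epsilon>^3\<close> throughout, because the bound to be reached is itself small in
  \<epsilon>.\<close>

lemma has_derivative_cong_open:
  assumes "open S" "x \<in> S" "\<And>y. y \<in> S \<Longrightarrow> f y = g y"
  shows "(f has_derivative D) (at x) \<longleftrightarrow> (g has_derivative D) (at x)"
  using has_derivative_transform_within_open[OF _ assms(1,2), of f D UNIV g]
    has_derivative_transform_within_open[OF _ assms(1,2), of g D UNIV f] assms(3) by auto

lemma frechet_derivative_cong_open:
  assumes "open S" "x \<in> S" "\<And>y. y \<in> S \<Longrightarrow> f y = g y"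
  shows "frechet_derivative f (at x) = frechet_derivative g (at x)"
  unfolding frechet_derivative_def by (simp add: has_derivative_cong_open[OF assms(1,2), of f g, OF assms(3)])

text \<open>The rules below identify \<open>frechet_derivative\<close> only at points of
  \<open>S\<close>; elsewhere its value may be an arbitrary choice. Openness makes agreement on
  \<open>S\<close> enough, and this lemma carries an explicit formula for a derivative over to
  \<open>frechet_derivative\<close> of the compound map.\<close>

lemma Ck_on_cong:
  assumes "open S" "\<And>y. y \<in> S \<Longrightarrow> f y = g y" "Ck_on k S f"
  shows "Ck_on k S g"
  using assms(2,3)
proof (induction k arbitrary: f g)
  case 0
  then show ?case using continuous_on_cong[OF refl, of S f g] by simp
next
  case (Suc k)
  have "g differentiable (at x)" if "x \<in> S" for x
  proof -
    have "f differentiable (at x)" using that Suc.prems(2) by simp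
    then obtain D where "(f has_derivative D) (at x)" by (auto simp: differentiable_def)
    then have "(g has_derivative D) (at x)"
      using has_derivative_cong_open[OF assms(1) that, of f g, OF Suc.prems(1)] by simp
    then show ?thesis by (rule differentiableI)
  qed
  moreover have "Ck_on k S (\<lambda>x. frechet_derivative g (at x) v)" for v
  proof (rule Suc.IH)
    show "Ck_on k S (\<lambda>x. frechet_derivative f (at x) v)" using Suc.prems(2) by simp
    show "frechet_derivative f (at y) v = frechet_derivative g (at y) v" if "y \<in> S" for y
      using frechet_derivative_cong_open[OF assms(1) that, of f g] Suc.prems(1) by simp
  qed
  ultimately show ?case by simp
qed

lemma Ck_on_Suc_imp: "Ck_on (Suc k) S f \<Longrightarrow> Ck_on k S f"
proof (induction k arbitrary: f)
  case 0
  then show ?case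
    by (auto intro!: continuous_at_imp_continuous_on differentiable_imp_continuous_within)
next
  case (Suc k)
  then show ?case by simp
qed

lemma Ck_on_subset: "Ck_on k S f \<Longrightarrow> T \<subseteq> S \<Longrightarrow> Ck_on k T f"
  by (induction k arbitrary: f) (auto intro: continuous_on_subset)

lemma Ck_on_const: "Ck_on k S (\<lambda>x. c)"
  by (induction k arbitrary: c) (auto simp: frechet_derivative_const)

lemma Ck_on_bounded_linear:
  assumes "open S" "bounded_linear L" "Ck_on k S f"
  shows "Ck_on k S (\<lambda>x. L (f x))"
  using assms(3)
proof (induction k arbitrary: f)
  case 0
  then show ?case using bounded_linear.continuous_on[OF assms(2)] by auto
next
  case (Suc k)
  have D: "((\<lambda>x. L (f x)) has_derivative (\<lambda>v. L (frechet_derivative f (at x) v))) (at x)" if "x \<in> S" for x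
    using that Suc.prems by (intro bounded_linear.has_derivative[OF assms(2)] iffD1[OF frechet_derivative_works]) simp
  have "Ck_on k S (\<lambda>x. frechet_derivative (\<lambda>x. L (f x)) (at x) v)" for v
  proof (rule Ck_on_cong[OF assms(1) _ Suc.IH])
    show "Ck_on k S (\<lambda>x. frechet_derivative f (at x) v)" using Suc.prems by simp
    show "L (frechet_derivative f (at y) v) = frechet_derivative (\<lambda>x. L (f x)) (at y) v" if "y \<in> S" for y
      by (rule fun_cong[OF frechet_derivative_at[OF D[OF that]]])
  qed
  moreover have "\<forall>x\<in>S. (\<lambda>x. L (f x)) differentiable (at x)"
    by (intro ballI differentiableI[OF D]) auto
  ultimately show ?case by simp
qed

lemma Ck_on_add:
  assumes "open S" "Ck_on k S f" "Ck_on k S g"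
  shows "Ck_on k S (\<lambda>x. f x + g x)"
  using assms(2,3)
proof (induction k arbitrary: f g)
  case 0
  then show ?case by (simp add: continuous_on_add)
next
  case (Suc k)
  have D: "((\<lambda>x. f x + g x) has_derivative (\<lambda>v. frechet_derivative f (at x) v + frechet_derivative g (at x) v)) (at x)"
    if "x \<in> S" for x
    using that Suc.prems by (intro has_derivative_add iffD1[OF frechet_derivative_works]) simp_all
  have "Ck_on k S (\<lambda>x. frechet_derivative (\<lambda>x. f x + g x) (at x) v)" for v
  proof (rule Ck_on_cong[OF assms(1) _ Suc.IH])
    show "Ck_on k S (\<lambda>x. frechet_derivative f (at x) v)" "Ck_on k S (\<lambda>x. frechet_derivative g (at x) v)"
      using Suc.prems by simp_all
    show "frechet_derivative f (at y) v + frechet_derivative g (at y) v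
        = frechet_derivative (\<lambda>x. f x + g x) (at y) v" if "y \<in> S" for y
      by (rule fun_cong[OF frechet_derivative_at[OF D[OF that]]])
  qed
  moreover have "\<forall>x\<in>S. (\<lambda>x. f x + g x) differentiable (at x)"
    by (intro ballI differentiableI[OF D]) auto
  ultimately show ?case by simp
qed

lemma Ck_on_scaleR:
  assumes "open S" "Ck_on k S f" "Ck_on k S g"
  shows "Ck_on k S (\<lambda>x. f x *\<^sub>R g x)"
  using assms(2,3)
proof (induction k arbitrary: f g)
  case 0
  then show ?case by (simp add: continuous_on_scaleR)
next
  case (Suc k)
  have D: "((\<lambda>x. f x *\<^sub>R g x) has_derivative
      (\<lambda>v. f x *\<^sub>R frechet_derivative g (at x) v + frechet_derivative f (at x) v *\<^sub>R g x)) (at x)"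
    if "x \<in> S" for x
    using that Suc.prems by (intro has_derivative_scaleR iffD1[OF frechet_derivative_works]) simp_all
  \<comment> \<open>The product rule leaves one factor undifferentiated in each summand, so the
    induction hypothesis also needs \<open>f\<close> and \<open>g\<close> themselves at level
    \<open>k\<close>.\<close>
  have fg: "Ck_on k S f" "Ck_on k S g" using Suc.prems by (auto intro: Ck_on_Suc_imp simp del: Ck_on.simps)
  have "Ck_on k S (\<lambda>x. frechet_derivative (\<lambda>x. f x *\<^sub>R g x) (at x) v)" for v
  proof (rule Ck_on_cong[OF assms(1)])
    have "Ck_on k S (\<lambda>x. frechet_derivative f (at x) v)" "Ck_on k S (\<lambda>x. frechet_derivative g (at x) v)"
      using Suc.prems by simp_all
    then show "Ck_on k S (\<lambda>y. f y *\<^sub>R frechet_derivative g (at y) v + frechet_derivative f (at y) v *\<^sub>R g y)"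
      using fg by (intro Ck_on_add[OF assms(1)] Suc.IH)
    show "f y *\<^sub>R frechet_derivative g (at y) v + frechet_derivative f (at y) v *\<^sub>R g y
        = frechet_derivative (\<lambda>x. f x *\<^sub>R g x) (at y) v" if "y \<in> S" for y
      by (rule fun_cong[OF frechet_derivative_at[OF D[OF that]]])
  qed
  moreover have "\<forall>x\<in>S. (\<lambda>x. f x *\<^sub>R g x) differentiable (at x)"
    by (intro ballI differentiableI[OF D]) auto
  ultimately show ?case by simp
qed

text \<open>Taylor coefficients of the integrator at step size 0 are restrictions to
  \<open>h = 0\<close> of iterated derivatives in \<open>(h, y)\<close>; this is how they become
  smooth functions of \<open>y\<close>.\<close>

lemma Ck_on_slice:
  fixes f :: "'a::euclidean_space \<times> 'b::euclidean_space \<Rightarrow> 'c::real_normed_vector"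
  assumes "open S" "Ck_on k S f"
  shows "Ck_on k {y. (c, y) \<in> S} (\<lambda>y. f (c, y))"
  using assms(2)
proof (induction k arbitrary: f)
  have o: "open {y. (c, y) \<in> S}"
    using open_vimage[OF assms(1), of "Pair c"] by (simp add: vimage_def continuous_on_Pair)
  case 0
  then show ?case
    by (auto intro!: continuous_on_compose2[of S f] continuous_intros)
next
  case (Suc k)
  have o: "open {y. (c, y) \<in> S}"
    using open_vimage[OF assms(1), of "Pair c"] by (simp add: vimage_def continuous_on_Pair)
  have D: "((\<lambda>y. f (c, y)) has_derivative (\<lambda>v. frechet_derivative f (at (c, y)) (0, v))) (at y)"
    if "(c, y) \<in> S" for y
  proof (rule has_derivative_compose[of "Pair c" "Pair 0", simplified])
    show "(Pair c has_derivative Pair 0) (at y)"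
      by (auto intro!: derivative_eq_intros)
    show "(f has_derivative frechet_derivative f (at (c, y))) (at (c, y))"
      using that Suc.prems by (intro iffD1[OF frechet_derivative_works]) simp
  qed
  have "Ck_on k {y. (c, y) \<in> S} (\<lambda>y. frechet_derivative (\<lambda>y. f (c, y)) (at y) v)" for v
  proof (rule Ck_on_cong[OF o])
    show "Ck_on k {y. (c, y) \<in> S} (\<lambda>y. frechet_derivative f (at (c, y)) (0, v))"
      using Suc.IH[of "\<lambda>p. frechet_derivative f (at p) (0, v)"] Suc.prems by simp
    show "frechet_derivative f (at (c, y)) (0, v) = frechet_derivative (\<lambda>y. f (c, y)) (at y) v"
      if "y \<in> {y. (c, y) \<in> S}" for y
      using that by (intro fun_cong[OF frechet_derivative_at[OF D]]) simp
  qed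
  moreover have "\<forall>y\<in>{y. (c, y) \<in> S}. (\<lambda>y. f (c, y)) differentiable (at y)"
    by (intro ballI differentiableI[OF D]) auto
  ultimately show ?case by simp
qed

lemma smooth_on_const: "open S \<Longrightarrow> smooth_on S (\<lambda>x. c)"
  by (simp add: smooth_on_def Ck_on_const del: Ck_on.simps)

lemma smooth_on_id: "open S \<Longrightarrow> smooth_on S (\<lambda>x. x)"
proof -
  have "Ck_on k S (\<lambda>x. x)" for k
    by (cases k) (auto simp: frechet_derivative_ident Ck_on_const)
  then show "open S \<Longrightarrow> smooth_on S (\<lambda>x. x)" by (simp add: smooth_on_def)
qed

lemma smooth_on_subset: "smooth_on S f \<Longrightarrow> T \<subseteq> S \<Longrightarrow> open T \<Longrightarrow> smooth_on T f"
  by (auto simp: smooth_on_def intro: Ck_on_subset simp del: Ck_on.simps)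

lemma smooth_on_add: "smooth_on S f \<Longrightarrow> smooth_on S g \<Longrightarrow> smooth_on S (\<lambda>x. f x + g x)"
  by (simp add: smooth_on_def Ck_on_add del: Ck_on.simps)

lemma smooth_on_scaleR: "smooth_on S f \<Longrightarrow> smooth_on S g \<Longrightarrow> smooth_on S (\<lambda>x. f x *\<^sub>R g x)"
  by (simp add: smooth_on_def Ck_on_scaleR del: Ck_on.simps)

lemma smooth_on_bounded_linear: "smooth_on S f \<Longrightarrow> bounded_linear L \<Longrightarrow> smooth_on S (\<lambda>x. L (f x))"
  by (simp add: smooth_on_def Ck_on_bounded_linear del: Ck_on.simps)

lemma smooth_on_diff: "smooth_on S f \<Longrightarrow> smooth_on S g \<Longrightarrow> smooth_on S (\<lambda>x. f x - g x)"
  using smooth_on_add[OF _ smooth_on_bounded_linear, of S f g uminus]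
    bounded_linear_minus[OF bounded_linear_ident] by simp

lemma smooth_on_sum:
  "open S \<Longrightarrow> (\<And>i. i \<in> I \<Longrightarrow> smooth_on S (f i)) \<Longrightarrow> smooth_on S (\<lambda>x. \<Sum>i\<in>I. f i x)"
  by (induction I rule: infinite_finite_induct) (auto intro: smooth_on_const smooth_on_add)

lemma smooth_on_cong: "smooth_on S f \<Longrightarrow> (\<And>y. y \<in> S \<Longrightarrow> f y = g y) \<Longrightarrow> smooth_on S g"
  by (auto simp: smooth_on_def intro: Ck_on_cong[of S f] simp del: Ck_on.simps)

lemma smooth_on_slice:
  fixes f :: "'a::euclidean_space \<times> 'b::euclidean_space \<Rightarrow> 'c::real_normed_vector"
  assumes "smooth_on S f"
  shows "smooth_on {y. (c, y) \<in> S} (\<lambda>y. f (c, y))"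
proof -
  have "open S" using assms by (simp add: smooth_on_def)
  then have "open {y. (c, y) \<in> S}"
    using open_vimage[of S "Pair c"] by (simp add: vimage_def continuous_on_Pair)
  then show ?thesis using assms by (simp add: smooth_on_def Ck_on_slice del: Ck_on.simps)
qed

lemma smooth_on_frechet_derivative: "smooth_on S f \<Longrightarrow> smooth_on S (\<lambda>x. frechet_derivative f (at x) v)"
  using Ck_on.simps(2)[of _ S f] by (simp add: smooth_on_def)

lemma smooth_on_has_derivative:
  "smooth_on S f \<Longrightarrow> x \<in> S \<Longrightarrow> (f has_derivative frechet_derivative f (at x)) (at x)"
  using Ck_on.simps(2)[of 0 S f] by (simp add: smooth_on_def frechet_derivative_works[symmetric])

lemma smooth_on_continuous_on: "smooth_on S f \<Longrightarrow> continuous_on S f"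
  using Ck_on.simps(1)[of S f] by (simp add: smooth_on_def)

lemma smooth_on_linear_frechet: "smooth_on S f \<Longrightarrow> x \<in> S \<Longrightarrow> linear (frechet_derivative f (at x))"
  using smooth_on_has_derivative has_derivative_linear by blast

section \<open>Derivatives in variable directions and estimates on compact sets\<close>

lemma frechet_derivative_basis:
  assumes "smooth_on S f" "x \<in> S"
  shows "frechet_derivative f (at x) v = (\<Sum>b\<in>Basis. (v \<bullet> b) *\<^sub>R frechet_derivative f (at x) b)"
proof -
  have l: "linear (frechet_derivative f (at x))" by (rule smooth_on_linear_frechet[OF assms])
  have "frechet_derivative f (at x) v = frechet_derivative f (at x) (\<Sum>b\<in>Basis. (v \<bullet> b) *\<^sub>R b)"
    by (simp add: euclidean_representation)
  also have "\<dots> = (\<Sum>b\<in>Basis. (v \<bullet> b) *\<^sub>R frechet_derivative f (at x) b)"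
    by (simp add: linear_sum[OF l] linear_scale[OF l])
  finally show ?thesis .
qed

text \<open>\<open>Ck_on\<close> speaks of fixed directions only. Expanding \<open>g x\<close> in
  the basis turns the derivative in a varying direction into a sum of scalar functions times partial
  derivatives.\<close>

lemma smooth_on_directional_derivative:
  assumes "smooth_on S f" "smooth_on S g"
  shows "smooth_on S (\<lambda>x. frechet_derivative f (at x) (g x))"
proof (rule smooth_on_cong)
  show "smooth_on S (\<lambda>x. \<Sum>b\<in>Basis. (g x \<bullet> b) *\<^sub>R frechet_derivative f (at x) b)"
    using assms
    by (intro smooth_on_sum smooth_on_scaleR smooth_on_frechet_derivative
          smooth_on_bounded_linear[OF assms(2) bounded_linear_inner_left]) (auto simp: smooth_on_def)
qed (simp add: frechet_derivative_basis[OF assms(1)])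

lemma frechet_derivative_bound:
  assumes "smooth_on S f" "compact K" "K \<subseteq> S"
  shows "\<exists>L\<ge>0. \<forall>x\<in>K. \<forall>v. norm (frechet_derivative f (at x) v) \<le> L * norm v"
proof -
  have "\<exists>M. \<forall>x\<in>K. norm (frechet_derivative f (at x) b) \<le> M" for b
  proof -
    have "bounded ((\<lambda>x. frechet_derivative f (at x) b) ` K)"
      using assms smooth_on_continuous_on[OF smooth_on_frechet_derivative[OF assms(1), of b]]
      by (intro compact_imp_bounded compact_continuous_image) (auto intro: continuous_on_subset)
    then show ?thesis by (auto simp: bounded_iff)
  qed
  then obtain M where M: "\<And>b x. x \<in> K \<Longrightarrow> norm (frechet_derivative f (at x) b) \<le> M b" by metis
  have "norm (frechet_derivative f (at x) v) \<le> (\<Sum>b\<in>Basis. \<bar>M b\<bar>) * norm v" if "x \<in> K" for x v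
  proof -
    have "norm (frechet_derivative f (at x) v) \<le> (\<Sum>b\<in>Basis. norm ((v \<bullet> b) *\<^sub>R frechet_derivative f (at x) b))"
      unfolding frechet_derivative_basis[OF assms(1) subsetD[OF assms(3) that], of v] by (rule norm_sum)
    also have "\<dots> \<le> (\<Sum>b\<in>Basis. norm v * \<bar>M b\<bar>)"
      using that by (intro sum_mono) (auto intro!: mult_mono simp: Basis_le_norm intro: order_trans[OF M abs_ge_self])
    finally show ?thesis by (simp add: sum_distrib_left mult.commute)
  qed
  then show ?thesis by (intro exI[of _ "\<Sum>b\<in>Basis. \<bar>M b\<bar>"]) (auto intro: sum_nonneg)
qed

lemma smooth_on_lipschitz:
  assumes "smooth_on S f" "compact K" "convex K" "K \<subseteq> S"
  shows "\<exists>L\<ge>0. \<forall>u\<in>K. \<forall>v\<in>K. norm (f u - f v) \<le> L * norm (u - v)"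
proof -
  obtain L where L: "L \<ge> 0" "\<And>x v. x \<in> K \<Longrightarrow> norm (frechet_derivative f (at x) v) \<le> L * norm v"
    using frechet_derivative_bound[OF assms(1,2,4)] by blast
  have "norm (f u - f v) \<le> L * norm (u - v)" if "u \<in> K" "v \<in> K" for u v
  proof (rule differentiable_bound[OF assms(3) _ _ that])
    fix x assume "x \<in> K"
    then show "(f has_derivative frechet_derivative f (at x)) (at x within K)"
      using smooth_on_has_derivative[OF assms(1)] assms(4) by (blast intro: has_derivative_at_withinI)
    show "onorm (frechet_derivative f (at x)) \<le> L"
      using L \<open>x \<in> K\<close> by (intro onorm_le) auto
  qed
  with L show ?thesis by blast
qed

text \<open>On the segment from \<open>v\<close> to \<open>u\<close> the map
  \<open>f z - Df(y) z\<close> has derivative \<open>Df(z) - Df(y)\<close>, of size at most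
  \<open>L |z - y|\<close>, and \<open>|z - y| \<le> |u - y| + |v - y|\<close>. The derivative sits
  at a third point because the coefficients of the expansion are taken at the common starting point,
  while \<open>f\<close> is compared at the perturbed and the exact iterate.\<close>

lemma smooth_on_linearization:
  fixes f :: "'a::euclidean_space \<Rightarrow> 'b::euclidean_space"
  assumes "smooth_on S f" "compact K" "convex K" "K \<subseteq> S"
  shows "\<exists>L\<ge>0. \<forall>u\<in>K. \<forall>v\<in>K. \<forall>y\<in>K.
    norm (f u - f v - frechet_derivative f (at y) (u - v)) \<le> L * norm (u - v) * (norm (u - y) + norm (v - y))"
proof -
  have "\<exists>M\<ge>0. \<forall>u\<in>K. \<forall>y\<in>K. norm (frechet_derivative f (at u) b - frechet_derivative f (at y) b) \<le> M * norm (u - y)" for b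
    using smooth_on_lipschitz[OF smooth_on_frechet_derivative[OF assms(1)] assms(2-4)] .
  then obtain M where M: "\<And>b. M b \<ge> 0" "\<And>b u y. u \<in> K \<Longrightarrow> y \<in> K \<Longrightarrow>
      norm (frechet_derivative f (at u) b - frechet_derivative f (at y) b) \<le> M b * norm (u - y)"
    by metis
  define L where "L = (\<Sum>b\<in>Basis. M b)"
  have L0: "L \<ge> 0" unfolding L_def by (intro sum_nonneg M)
  have L: "norm (frechet_derivative f (at u) w - frechet_derivative f (at y) w) \<le> L * norm (u - y) * norm w"
    if "u \<in> K" "y \<in> K" for u y w
  proof -
    have "frechet_derivative f (at u) w - frechet_derivative f (at y) w =
       (\<Sum>b\<in>Basis. (w \<bullet> b) *\<^sub>R (frechet_derivative f (at u) b - frechet_derivative f (at y) b))"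
      unfolding frechet_derivative_basis[OF assms(1) subsetD[OF assms(4) that(1)], of w]
        frechet_derivative_basis[OF assms(1) subsetD[OF assms(4) that(2)], of w]
      by (simp add: sum_subtractf scaleR_diff_right)
    also have "norm \<dots> \<le> (\<Sum>b\<in>Basis. norm w * (M b * norm (u - y)))"
      using that by (intro order_trans[OF norm_sum] sum_mono) (auto intro!: mult_mono M simp: Basis_le_norm)
    finally show ?thesis by (simp add: L_def sum_distrib_left sum_distrib_right mult_ac)
  qed
  have "norm (f u - f v - frechet_derivative f (at y) (u - v)) \<le> (L * (norm (u - y) + norm (v - y))) * norm (u - v)"
    if "u \<in> K" "v \<in> K" "y \<in> K" for u v y
  proof -
    let ?D = "\<lambda>x. frechet_derivative f (at x)"
    have seg: "closed_segment v u \<subseteq> K" using that assms(3) by (simp add: closed_segment_subset)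
    have bl: "bounded_linear (?D y)"
      using smooth_on_has_derivative[OF assms(1)] that assms(4) has_derivative_bounded_linear by blast
    have "norm ((f u - ?D y u) - (f v - ?D y v)) \<le> (L * (norm (u - y) + norm (v - y))) * norm (u - v)"
    proof (rule differentiable_bound[of "closed_segment v u" "\<lambda>z. f z - ?D y z" "\<lambda>z w. ?D z w - ?D y w"])
      fix z assume z: "z \<in> closed_segment v u"
      show "((\<lambda>z. f z - ?D y z) has_derivative (\<lambda>w. ?D z w - ?D y w)) (at z within closed_segment v u)"
        using smooth_on_has_derivative[OF assms(1), of z] assms(4) z seg
        by (intro has_derivative_diff bounded_linear.has_derivative[OF bl] has_derivative_ident)
           (auto intro: has_derivative_at_withinI)
      have "norm (z - y) \<le> norm (u - y) + norm (v - y)"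
      proof -
        have "y + (z - y) \<in> closed_segment (y + (v - y)) (y + (u - y))" using z by simp
        then have "z - y \<in> closed_segment (v - y) (u - y)"
          by (subst (asm) closed_segment_translation_eq)
        then obtain t where t: "0 \<le> t" "t \<le> 1" "z - y = (1 - t) *\<^sub>R (v - y) + t *\<^sub>R (u - y)"
          by (auto simp: closed_segment_def)
        then have "norm (z - y) \<le> (1 - t) * norm (v - y) + t * norm (u - y)"
          by (metis abs_of_nonneg diff_ge_0_iff_ge norm_scaleR norm_triangle_ineq)
        also have "\<dots> \<le> 1 * norm (v - y) + 1 * norm (u - y)"
          using t by (intro add_mono mult_right_mono) auto
        finally show ?thesis by simp
      qed
      then show "onorm (\<lambda>w. ?D z w - ?D y w) \<le> L * (norm (u - y) + norm (v - y))"
        using L[of z y] z seg that L0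
        by (intro onorm_le) (meson subsetD order_trans mult_left_mono mult_right_mono norm_ge_zero)
    qed auto
    then show ?thesis
      using bounded_linear.linear[OF bl] by (simp add: linear_diff algebra_simps)
  qed
  then show ?thesis using L0 by (intro exI[of _ L]) (auto simp: mult_ac)
qed

section \<open>Flows of smooth vector fields\<close>

lemma norm_diff_le_of_vector_derivative:
  fixes w :: "real \<Rightarrow> 'v::real_normed_vector"
  assumes "\<And>s. s \<in> closed_segment 0 t \<Longrightarrow> (w has_vector_derivative w' s) (at s within closed_segment 0 t)"
    and "\<And>s. s \<in> closed_segment 0 t \<Longrightarrow> norm (w' s) \<le> B"
  shows "norm (w t - w 0) \<le> B * \<bar>t\<bar>"
proof -
  have "norm (w t - w 0) \<le> B * norm (t - 0)"
  proof (rule differentiable_bound[of "closed_segment 0 t" w "\<lambda>s h. h *\<^sub>R w' s"])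
    show "(w has_derivative (\<lambda>h. h *\<^sub>R w' s)) (at s within closed_segment 0 t)"
      if "s \<in> closed_segment 0 t" for s
      using assms(1)[OF that] by (simp add: has_vector_derivative_def)
    show "onorm (\<lambda>h. h *\<^sub>R w' s) \<le> B" if "s \<in> closed_segment 0 t" for s
      using mult_left_mono[OF assms(2)[OF that] abs_ge_zero] by (intro onorm_le) (simp add: mult.commute)
  qed auto
  then show ?thesis by simp
qed

lemma abs_le_of_mem_segment: "s \<in> closed_segment 0 t \<Longrightarrow> \<bar>s\<bar> \<le> \<bar>t\<bar>" for s t :: real
  by (auto simp: closed_segment_eq_real_ivl split: if_splits)

lemma segment_0_subset: "s \<in> closed_segment 0 t \<Longrightarrow> closed_segment 0 s \<subseteq> closed_segment 0 t" for s t :: real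
  by (simp add: subset_closed_segment)

text \<open>Induction on \<open>n\<close>: the family shifted by one is the derivative, and the mean
  value inequality integrates its remainder once. This loses the factor \<open>1 / n!\<close>, which
  costs nothing since only orders matter. Segments based at 0 cover both signs of
  \<open>t\<close>.\<close>

lemma taylor_remainder_bound:
  fixes g :: "nat \<Rightarrow> real \<Rightarrow> 'v::real_normed_vector"
  assumes "\<And>k s. k < n \<Longrightarrow> s \<in> closed_segment 0 t \<Longrightarrow> (g k has_vector_derivative g (Suc k) s) (at s within closed_segment 0 t)"
    and "\<And>s. s \<in> closed_segment 0 t \<Longrightarrow> norm (g n s) \<le> B"
  shows "norm (g 0 t - (\<Sum>k<n. (t ^ k / fact k) *\<^sub>R g k 0)) \<le> B * \<bar>t\<bar> ^ n"
  using assms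
proof (induction n arbitrary: g t)
  case 0
  then show ?case by simp
next
  case (Suc n)
  have B: "B \<ge> 0" using Suc.prems(2)[of 0] by (simp add: order_trans[OF norm_ge_zero])
  define p where "p s = (\<Sum>k<Suc n. (s ^ k / fact k) *\<^sub>R g k 0)" for s
  define p' where "p' s = (\<Sum>k<n. (s ^ k / fact k) *\<^sub>R g (Suc k) 0)" for s
  have p: "(p has_vector_derivative p' s) (at s within A)" for s A
  proof -
    have "((\<lambda>s. s ^ k / fact k) has_real_derivative (if k = 0 then 0 else s ^ (k - 1) / fact (k - 1))) (at s within A)" for k
      by (auto intro!: derivative_eq_intros simp: fact_reduce[of k] divide_simps)
    note d = has_vector_derivative_eq_rhs[OF has_vector_derivative_scaleR[OF this has_vector_derivative_const]]
    have "(p has_vector_derivative (\<Sum>k<Suc n. (if k = 0 then 0 else s ^ (k - 1) / fact (k - 1)) *\<^sub>R g k 0)) (at s within A)"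
      unfolding p_def [abs_def]
      by (intro has_vector_derivative_sum d) simp
    also have "(\<Sum>k<Suc n. (if k = 0 then 0 else s ^ (k - 1) / fact (k - 1)) *\<^sub>R g k 0) = p' s"
      unfolding p'_def by (subst sum.lessThan_Suc_shift) simp
    finally show ?thesis .
  qed
  have "norm ((g 0 t - p t) - (g 0 0 - p 0)) \<le> (B * \<bar>t\<bar> ^ n) * \<bar>t\<bar>"
  proof (rule norm_diff_le_of_vector_derivative[of t "\<lambda>s. g 0 s - p s" "\<lambda>s. g 1 s - p' s"])
    fix s assume s: "s \<in> closed_segment 0 t"
    show "((\<lambda>s. g 0 s - p s) has_vector_derivative g 1 s - p' s) (at s within closed_segment 0 t)"
      using Suc.prems(1)[of 0 s] s p by (auto intro!: has_vector_derivative_diff)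
    have "norm (g (Suc 0) s - (\<Sum>k<n. (s ^ k / fact k) *\<^sub>R g (Suc k) 0)) \<le> B * \<bar>s\<bar> ^ n"
    proof (rule Suc.IH[of s "\<lambda>k. g (Suc k)"])
      fix k r assume k: "k < n" and r: "r \<in> closed_segment 0 s"
      show "(g (Suc k) has_vector_derivative g (Suc (Suc k)) r) (at r within closed_segment 0 s)"
        using k r segment_0_subset[OF s]
        by (intro has_vector_derivative_within_subset[OF Suc.prems(1)]) auto
    next
      fix r assume r: "r \<in> closed_segment 0 s"
      then show "norm (g (Suc n) r) \<le> B" using segment_0_subset[OF s] by (intro Suc.prems(2)) auto
    qed
    also have "\<dots> \<le> B * \<bar>t\<bar> ^ n"
      using B abs_le_of_mem_segment[OF s] by (intro mult_left_mono power_mono) auto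
    finally show "norm (g 1 s - p' s) \<le> B * \<bar>t\<bar> ^ n" by (simp add: p'_def)
  qed
  moreover have "p 0 = g 0 0" unfolding p_def by (subst sum.lessThan_Suc_shift) simp
  ultimately show ?case by (simp add: p_def mult_ac)
qed

text \<open>This is the differential equation inside the description in \<open>flow\<close>,
  separated from the initial value; at the ends of the segment the derivative is one-sided.\<close>

definition solves :: "('v::real_normed_vector \<Rightarrow> 'v) \<Rightarrow> (real \<Rightarrow> 'v) \<Rightarrow> real \<Rightarrow> bool" where
  "solves f u t \<longleftrightarrow> (\<forall>s\<in>closed_segment 0 t. (u has_vector_derivative f (u s)) (at s within closed_segment 0 t))"

lemma solves_continuous_on: "solves f u t \<Longrightarrow> continuous_on (closed_segment 0 t) u"
  unfolding solves_def continuous_on_eq_continuous_within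
  using has_vector_derivative_continuous by blast

lemma solves_unique:
  fixes f :: "'v::euclidean_space \<Rightarrow> 'v"
  assumes f: "smooth_on UNIV f" and u: "solves f u t" and v: "solves f v t" and "u 0 = v 0"
  shows "u t = v t"
proof -
  \<comment> \<open>Both trajectories are compact, hence lie in one ball. A smooth field has a
    Lipschitz constant there, although possibly none globally.\<close>
  have "bounded (u ` closed_segment 0 t \<union> v ` closed_segment 0 t)"
    using u v by (intro bounded_Un[THEN iffD2] conjI compact_imp_bounded compact_continuous_image solves_continuous_on) auto
  then obtain R where R: "\<And>s. s \<in> closed_segment 0 t \<Longrightarrow> u s \<in> cball 0 R \<and> v s \<in> cball 0 R"
    unfolding bounded_iff by (auto simp: image_iff)
  obtain L where L: "L \<ge> 0" "\<And>y z. y \<in> cball 0 R \<Longrightarrow> z \<in> cball 0 R \<Longrightarrow> norm (f y - f z) \<le> L * norm (y - z)"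
    using smooth_on_lipschitz[OF f, of "cball 0 R"] by auto
  \<comment> \<open>The substitution \<open>s = \<sigma> * t\<close> replaces the segment, whatever
    the sign of \<open>t\<close>, by the unit interval; the field acquires the factor
    \<open>t\<close>, whence \<open>c = \<bar>t\<bar> * L\<close> below.\<close>
  have seg: "\<sigma> * t \<in> closed_segment 0 t" if "\<sigma> \<in> {0..1}" for \<sigma>
    using that by (auto simp: closed_segment_def intro!: exI[of _ \<sigma>])
  have img: "(\<lambda>\<sigma>. \<sigma> * t) ` {0..1} \<subseteq> closed_segment 0 t" using seg by auto
  have lin: "((\<lambda>\<sigma>. \<sigma> * t) has_vector_derivative t) (at \<sigma> within {0..1})" for \<sigma>
    by (auto intro!: derivative_eq_intros)
  define w where "w \<sigma> = u (\<sigma> * t) - v (\<sigma> * t)" for \<sigma>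
  have chain: "((\<lambda>\<sigma>. q (\<sigma> * t)) has_vector_derivative t *\<^sub>R f (q (\<sigma> * t))) (at \<sigma> within {0..1})"
    if "solves f q t" "\<sigma> \<in> {0..1}" for q \<sigma>
  proof -
    have "(q has_vector_derivative f (q (\<sigma> * t))) (at (\<sigma> * t) within (\<lambda>\<sigma>. \<sigma> * t) ` {0..1})"
      using that seg img unfolding solves_def by (intro has_vector_derivative_within_subset[OF _ img]) auto
    from vector_diff_chain_within[OF lin this] show ?thesis by (simp add: o_def)
  qed
  have w: "(w has_vector_derivative t *\<^sub>R (f (u (\<sigma> * t)) - f (v (\<sigma> * t)))) (at \<sigma> within {0..1})"
    if "\<sigma> \<in> {0..1}" for \<sigma>
    unfolding w_def [abs_def] scaleR_diff_right
    using chain[OF u that] chain[OF v that] by (intro has_vector_derivative_diff)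
  define c where "c = \<bar>t\<bar> * L"
  \<comment> \<open>Gronwall: \<open>E\<close> is nonincreasing and vanishes at \<open>0\<close>.\<close>
  define E where "E \<sigma> = (w \<sigma> \<bullet> w \<sigma>) * exp (- 2 * c * \<sigma>)" for \<sigma>
  have "E 1 \<le> E 0"
  proof (rule DERIV_nonpos_imp_decreasing_open[of 0 1 E])
    have "continuous_on {0..1} w"
      using w has_vector_derivative_continuous unfolding continuous_on_eq_continuous_within by blast
    then show "continuous_on {0..1} E" unfolding E_def [abs_def] by (auto intro!: continuous_intros)
  next
    fix \<sigma> :: real assume s: "0 < \<sigma>" "\<sigma> < 1"
    define q where "q = t *\<^sub>R (f (u (\<sigma> * t)) - f (v (\<sigma> * t)))"
    have "(w has_vector_derivative q) (at \<sigma>)"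
      using w[of \<sigma>] s by (simp add: q_def at_within_Icc_at)
    then have "(w has_derivative (\<lambda>h. h *\<^sub>R q)) (at \<sigma>)" by (simp add: has_vector_derivative_def)
    from has_derivative_inner[OF this this]
    have "((\<lambda>\<sigma>. w \<sigma> \<bullet> w \<sigma>) has_real_derivative 2 * (w \<sigma> \<bullet> q)) (at \<sigma>)"
      unfolding has_field_derivative_def
      by (rule has_derivative_eq_rhs) (auto simp: inner_commute algebra_simps)
    moreover have "((\<lambda>\<sigma>. exp (- 2 * c * \<sigma>)) has_real_derivative (- 2 * c) * exp (- 2 * c * \<sigma>)) (at \<sigma>)"
      by (auto intro!: derivative_eq_intros)
    ultimately have "(E has_real_derivative (w \<sigma> \<bullet> w \<sigma>) * ((- 2 * c) * exp (- 2 * c * \<sigma>)) + 2 * (w \<sigma> \<bullet> q) * exp (- 2 * c * \<sigma>)) (at \<sigma>)"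
      unfolding E_def [abs_def] by (rule DERIV_mult')
    moreover have "(w \<sigma> \<bullet> w \<sigma>) * ((- 2 * c) * exp (- 2 * c * \<sigma>)) + 2 * (w \<sigma> \<bullet> q) * exp (- 2 * c * \<sigma>)
        = 2 * exp (- 2 * c * \<sigma>) * (w \<sigma> \<bullet> q - c * (w \<sigma> \<bullet> w \<sigma>))"
      by (simp add: algebra_simps)
    moreover have "w \<sigma> \<bullet> q \<le> c * (w \<sigma> \<bullet> w \<sigma>)"
    proof -
      have "norm q \<le> \<bar>t\<bar> * (L * norm (w \<sigma>))"
        unfolding q_def w_def norm_scaleR using R[OF seg, of \<sigma>] s by (intro mult_left_mono L(2)) auto
      then have "norm (w \<sigma>) * norm q \<le> norm (w \<sigma>) * (c * norm (w \<sigma>))"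
        by (intro mult_left_mono) (auto simp: c_def mult_ac)
      then show ?thesis
        using norm_cauchy_schwarz[of "w \<sigma>" q] by (simp add: dot_square_norm power2_eq_square mult_ac)
    qed
    ultimately show "\<exists>y. (E has_real_derivative y) (at \<sigma>) \<and> y \<le> 0"
      by (intro exI conjI) (assumption, simp add: mult_nonneg_nonpos)
  qed simp
  also have "E 0 = 0" using assms(4) by (simp add: E_def w_def)
  finally have "w 1 \<bullet> w 1 \<le> 0" by (simp add: E_def mult_le_0_iff)
  then have "w 1 = 0" using inner_ge_zero[of "w 1"] by (simp add: order_antisym)
  then show ?thesis by (simp add: w_def)
qed

lemma flow_eqI:
  assumes "smooth_on UNIV f" "solves f u t" "u 0 = x"
  shows "flow f t x = u t"
  unfolding flow_def
proof (rule the_equality)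
  show "\<exists>ua. ua 0 = x \<and> ua t = u t \<and> (\<forall>s\<in>closed_segment 0 t. (ua has_vector_derivative f (ua s)) (at s within closed_segment 0 t))"
    using assms(2,3) by (auto simp: solves_def)
  show "y = u t" if "\<exists>v. v 0 = x \<and> v t = y \<and> (\<forall>s\<in>closed_segment 0 t. (v has_vector_derivative f (v s)) (at s within closed_segment 0 t))" for y
  proof -
    from that obtain v where "v 0 = x" "v t = y" "solves f v t" by (auto simp: solves_def)
    then show ?thesis using solves_unique[OF assms(1), of v t u] assms(2,3) by simp
  qed
qed

section \<open>Local existence and Lipschitz dependence on the initial value\<close>

lemma picard_solution:
  fixes g :: "'v::euclidean_space \<Rightarrow> 'v"
  assumes lip: "\<And>u v. norm (g u - g v) \<le> L * norm (u - v)" and bdd: "\<And>u. norm (g u) \<le> M"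
    and \<delta>: "\<delta> > 0" "8 * \<delta> * L \<le> 1" and L: "L \<ge> 0"
  shows "\<exists>u. u 0 = y \<and> (\<forall>s\<in>{-\<delta>..\<delta>}. (u has_vector_derivative g (u s)) (at s within {-\<delta>..\<delta>}))"
proof -
  have gcont: "continuous_on UNIV g"
  proof (rule continuous_onI)
    fix u and e :: real assume "e > 0"
    then show "\<exists>d>0. \<forall>v\<in>UNIV. dist v u < d \<longrightarrow> dist (g v) (g u) \<le> e"
      using L lip[of _ u]
      by (intro exI[of _ "e / (L + 1)"])
         (auto simp: dist_norm field_simps intro!: order_trans[OF lip], smt (verit) mult_left_mono norm_ge_zero mult.commute)
  qed
  \<comment> \<open>Clamping time to the interval lets the integral operator act on bounded
    continuous functions on the whole line, a complete space to which Banach's theorem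
    applies.\<close>
  define cl where "cl s = max (-\<delta>) (min \<delta> s)" for s
  have cl: "cl s \<in> {-\<delta>..\<delta>}" for s using \<delta> by (auto simp: cl_def)
  have clc: "continuous_on UNIV cl" unfolding cl_def [abs_def] by (intro continuous_intros)
  \<comment> \<open>The difference of the two integrals is the oriented integral from 0 to
    \<open>cl s\<close>, so positive and negative times are treated alike.\<close>
  define G where "G h s = y + integral {-\<delta>..cl s} h - integral {-\<delta>..0} h" for h :: "real \<Rightarrow> 'v" and s
  have Gb: "norm (integral {-\<delta>..r} h) \<le> 2 * \<delta> * B" if "continuous_on UNIV h" "\<And>s. norm (h s) \<le> B" "r \<in> {-\<delta>..\<delta>}" for h :: "real \<Rightarrow> 'v" and B r
  proof -
    have "B \<ge> 0" using that(2)[of 0] norm_ge_zero order_trans by blast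
    have "norm (integral {-\<delta>..r} h) \<le> B * (r - - \<delta>)"
      using that by (intro integral_bound continuous_on_subset[OF that(1)]) auto
    also have "\<dots> \<le> B * (2 * \<delta>)" using that(3) \<open>B \<ge> 0\<close> by (intro mult_left_mono) auto
    finally show ?thesis by (simp add: mult_ac)
  qed
  have Gc: "continuous_on UNIV (G h)" if "continuous_on UNIV h" for h
  proof -
    have "continuous_on {-\<delta>..\<delta>} (\<lambda>r. integral {-\<delta>..r} h)"
      using that by (intro indefinite_integral_continuous_1 integrable_continuous_real continuous_on_subset[OF that]) auto
    then have "continuous_on UNIV (\<lambda>s. integral {-\<delta>..cl s} h)"
      by (rule continuous_on_compose2[OF _ clc]) (use cl in auto)
    then show ?thesis unfolding G_def [abs_def] by (intro continuous_intros)
  qed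
  define P :: "(real \<Rightarrow>\<^sub>C 'v) \<Rightarrow> (real \<Rightarrow>\<^sub>C 'v)" where "P u = Bcontfun (G (\<lambda>s. g (u s)))" for u
  have gu: "continuous_on UNIV (\<lambda>s. g (apply_bcontfun u s))" for u :: "real \<Rightarrow>\<^sub>C 'v"
    by (rule continuous_on_compose2[OF gcont]) auto
  have Pu: "apply_bcontfun (P u) = G (\<lambda>s. g (u s))" for u
    unfolding P_def
  proof (rule Bcontfun_inverse, rule bcontfun_normI[OF Gc[OF gu]])
    fix s
    show "norm (G (\<lambda>s. g (apply_bcontfun u s)) s) \<le> norm y + 2 * \<delta> * M + 2 * \<delta> * M"
      unfolding G_def using Gb[OF gu bdd cl[of s], of u] Gb[OF gu bdd, of 0 u] \<delta>
      by (intro order_trans[OF norm_triangle_ineq4] add_mono order_trans[OF norm_triangle_ineq]) auto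
  qed
  \<comment> \<open>Each of the two integrals is at most \<open>2 * \<delta>\<close> times a bound
    of its integrand, so the operator has Lipschitz constant \<open>4 * \<delta> * L\<close>; this
    explains the 8 in the assumption.\<close>
  have "\<exists>!u. P u = u"
  proof (rule banach_fix_type[of "1/2"])
    show "\<forall>u v. dist (P u) (P v) \<le> 1 / 2 * dist u v"
    proof (intro allI dist_bound)
      fix u v :: "real \<Rightarrow>\<^sub>C 'v" and s
      define h where "h s = g (u s) - g (v s)" for s
      have hc: "continuous_on UNIV h" unfolding h_def [abs_def] by (intro continuous_intros gu)
      have hb: "norm (h r) \<le> L * dist u v" for r
        unfolding h_def using lip[of "u r" "v r"] dist_bounded[of u r v] L
        by (smt (verit) dist_norm mult_left_mono)
      have int: "(\<lambda>s. g (apply_bcontfun w s)) integrable_on {-\<delta>..r}" for w :: "real \<Rightarrow>\<^sub>C 'v" and r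
        by (intro integrable_continuous_real continuous_on_subset[OF gu]) auto
      have "P u s - P v s = integral {-\<delta>..cl s} h - integral {-\<delta>..0} h"
        unfolding Pu G_def h_def by (simp add: integral_diff[OF int int])
      also have "norm \<dots> \<le> 2 * \<delta> * (L * dist u v) + 2 * \<delta> * (L * dist u v)"
        using \<delta> by (intro order_trans[OF norm_triangle_ineq4] add_mono Gb[OF hc hb] cl) auto
      also have "\<dots> \<le> 1 / 2 * dist u v"
        using mult_right_mono[OF \<delta>(2), of "dist u v"] by (simp add: algebra_simps)
      finally show "dist (P u s) (P v s) \<le> 1 / 2 * dist u v" by (simp add: dist_norm)
    qed
  qed auto
  then obtain u where "P u = u" by blast
  then have u: "apply_bcontfun u = G (\<lambda>s. g (u s))" using Pu by metis
  show ?thesis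
  proof (intro exI[of _ "apply_bcontfun u"] conjI ballI)
    show "apply_bcontfun u 0 = y"
      by (subst u) (use \<delta> in \<open>simp add: G_def cl_def\<close>)
    fix s assume s: "s \<in> {-\<delta>..\<delta>}"
    have "((\<lambda>s. y + integral {-\<delta>..s} (\<lambda>s. g (u s)) - integral {-\<delta>..0} (\<lambda>s. g (u s)))
        has_vector_derivative g (u s)) (at s within {-\<delta>..\<delta>})"
      using integral_has_vector_derivative[OF continuous_on_subset[OF gu subset_UNIV] s, of u]
      by (auto intro!: derivative_eq_intros)
    then show "(apply_bcontfun u has_vector_derivative g (u s)) (at s within {-\<delta>..\<delta>})"
    proof (rule has_vector_derivative_transform[OF s, rotated])
      show "apply_bcontfun u r = y + integral {-\<delta>..r} (\<lambda>s. g (u s)) - integral {-\<delta>..0} (\<lambda>s. g (u s))"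
        if "r \<in> {-\<delta>..\<delta>}" for r
        by (subst u) (use that in \<open>simp add: G_def cl_def\<close>)
    qed
  qed
qed

lemma flow_0:
  assumes "smooth_on UNIV f"
  shows "flow f 0 x = x"
proof -
  have "solves f (\<lambda>s. x) 0"
    by (simp add: solves_def has_vector_derivative_def has_derivative_within_singleton_iff bounded_linear_scaleR_left)
  from flow_eqI[OF assms this refl] show ?thesis .
qed

lemma flow_local:
  fixes f :: "'v::euclidean_space \<Rightarrow> 'v"
  assumes f: "smooth_on UNIV f"
  shows "\<exists>\<delta>>0. \<forall>t y. \<bar>t\<bar> \<le> \<delta> \<longrightarrow> y \<in> cball x \<delta> \<longrightarrow>
    solves f (\<lambda>s. flow f s y) t \<and> flow f t y \<in> cball x 1 \<and>
    (\<forall>z\<in>cball x \<delta>. norm (flow f t y - flow f t z) \<le> 2 * norm (y - z))"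
proof -
  let ?K = "cball x 1"
  obtain L where L: "L \<ge> 0" "\<And>u v. u \<in> ?K \<Longrightarrow> v \<in> ?K \<Longrightarrow> norm (f u - f v) \<le> L * norm (u - v)"
    using smooth_on_lipschitz[OF f, of ?K] by auto
  have "bounded (f ` ?K)"
    by (intro compact_imp_bounded compact_continuous_image continuous_on_subset[OF smooth_on_continuous_on[OF f]]) auto
  then obtain M where M: "\<And>u. u \<in> ?K \<Longrightarrow> norm (f u) \<le> M" unfolding bounded_iff by blast
  have M0: "M \<ge> 0" using order_trans[OF norm_ge_zero M[of x]] by simp
  \<comment> \<open>A bounded, globally Lipschitz field; its solutions stay in \<open>?K\<close> for short times, where it equals \<open>f\<close>.\<close>
  define g where "g u = f (closest_point ?K u)" for u
  have cp: "closest_point ?K u \<in> ?K" for u by (intro closest_point_in_set) auto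
  have gl: "norm (g u - g v) \<le> L * norm (u - v)" for u v
  proof -
    have "norm (closest_point ?K u - closest_point ?K v) \<le> norm (u - v)"
      using closest_point_lipschitz[of ?K u v] by (simp add: dist_norm)
    then show ?thesis
      unfolding g_def by (intro order_trans[OF L(2)[OF cp cp]] mult_left_mono L)
  qed
  have gb: "norm (g u) \<le> M" for u unfolding g_def by (rule M[OF cp])
  \<comment> \<open>\<open>L\<close> serves the contraction and later the Lipschitz dependence,
    \<open>M\<close> and 1 the confinement to the unit ball: a trajectory starts within 1/8 of
    \<open>x\<close> and travels at most 1/8.\<close>
  define \<delta> where "\<delta> = 1 / (8 * (L + M + 1))"
  have \<delta>: "\<delta> > 0" "8 * \<delta> * L \<le> 1" "8 * \<delta> * M \<le> 1" "8 * \<delta> \<le> 1"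
    using L(1) M0 by (auto simp: \<delta>_def field_simps)
  have main: "solves f (\<lambda>s. flow f s y) t \<and> flow f t y \<in> ?K" if ty: "\<bar>t\<bar> \<le> \<delta>" "y \<in> cball x \<delta>" for t y
  proof -
    obtain u where u: "u 0 = y" "\<And>s. s \<in> {-\<delta>..\<delta>} \<Longrightarrow> (u has_vector_derivative g (u s)) (at s within {-\<delta>..\<delta>})"
      using picard_solution[OF gl gb \<delta>(1,2) L(1), of y] by blast
    have sub: "closed_segment 0 s \<subseteq> {-\<delta>..\<delta>}" if "\<bar>s\<bar> \<le> \<delta>" for s
      using that \<delta> by (auto simp: closed_segment_eq_real_ivl split: if_splits)
    have uK: "u s \<in> ?K" if "\<bar>s\<bar> \<le> \<delta>" for s
    proof -
      have "norm (u s - u 0) \<le> M * \<bar>s\<bar>"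
        using sub[OF that]
        by (intro norm_diff_le_of_vector_derivative[of s u "\<lambda>r. g (u r)"] has_vector_derivative_within_subset[OF u(2)] gb) auto
      also have "\<dots> \<le> M * \<delta>" using that M0 by (intro mult_left_mono) auto
      finally have "dist y (u s) \<le> M * \<delta>" using u(1) by (simp add: dist_norm norm_minus_commute)
      moreover have "dist x (u s) \<le> dist x y + dist y (u s)" by (rule dist_triangle)
      ultimately show ?thesis using ty(2) \<delta> by (simp add: mult_ac)
    qed
    have su: "solves f u s" if "\<bar>s\<bar> \<le> \<delta>" for s
      unfolding solves_def
    proof
      fix r assume r: "r \<in> closed_segment 0 s"
      then have r': "\<bar>r\<bar> \<le> \<delta>" using abs_le_of_mem_segment that by fastforce
      have "g (u r) = f (u r)" unfolding g_def using uK[OF r'] by (simp add: closest_point_self)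
      then show "(u has_vector_derivative f (u r)) (at r within closed_segment 0 s)"
        using has_vector_derivative_within_subset[OF u(2) sub[OF that], of r] r' by (auto simp: abs_le_iff)
    qed
    have eq: "flow f s y = u s" if "\<bar>s\<bar> \<le> \<delta>" for s
      using flow_eqI[OF f su[OF that] u(1)] .
    have eq': "flow f s y = u s" if "s \<in> closed_segment 0 t" for s
      using eq abs_le_of_mem_segment[OF that] ty(1) by auto
    have "solves f (\<lambda>s. flow f s y) t"
      unfolding solves_def
    proof
      fix s assume s: "s \<in> closed_segment 0 t"
      show "((\<lambda>s. flow f s y) has_vector_derivative f (flow f s y)) (at s within closed_segment 0 t)"
        using su[OF ty(1)] s eq' unfolding solves_def
        by (intro has_vector_derivative_transform[OF s eq']) auto
    qed
    then show ?thesis using eq[OF ty(1)] uK[OF ty(1)] by auto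
  qed
  have "norm (flow f t y - flow f t z) \<le> 2 * norm (y - z)"
    if ty: "\<bar>t\<bar> \<le> \<delta>" "y \<in> cball x \<delta>" "z \<in> cball x \<delta>" for t y z
  proof -
    let ?S = "closed_segment 0 t"
    define w where "w s = flow f s y - flow f s z" for s
    have sol: "solves f (\<lambda>s. flow f s y) s" "solves f (\<lambda>s. flow f s z) s" if "s \<in> ?S" for s
      using main ty abs_le_of_mem_segment[OF that] by auto
    have inK: "flow f s y \<in> ?K" "flow f s z \<in> ?K" if "s \<in> ?S" for s
      using main[of s] ty abs_le_of_mem_segment[OF that] by auto
    have "continuous_on ?S (\<lambda>s. norm (w s))"
      unfolding w_def by (intro continuous_intros solves_continuous_on[OF sol(1)] solves_continuous_on[OF sol(2)]) auto
    \<comment> \<open>At a maximum of the separation over the compact segment, the separation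
      exceeds its initial value by at most half of itself, and that half is absorbed on the left.
      This yields the constant 2.\<close>
    then obtain m where m: "m \<in> ?S" "\<And>s. s \<in> ?S \<Longrightarrow> norm (w s) \<le> norm (w m)"
      using continuous_attains_sup[of ?S "\<lambda>s. norm (w s)"] by auto
    have "norm (w m - w 0) \<le> (L * norm (w m)) * \<bar>m\<bar>"
    proof (rule norm_diff_le_of_vector_derivative)
      fix s assume s: "s \<in> closed_segment 0 m"
      then have s': "s \<in> ?S" using segment_0_subset[OF m(1)] by auto
      show "(w has_vector_derivative f (flow f s y) - f (flow f s z)) (at s within closed_segment 0 m)"
        unfolding w_def [abs_def] using sol[OF m(1)] s by (auto simp: solves_def intro: has_vector_derivative_diff)
      show "norm (f (flow f s y) - f (flow f s z)) \<le> L * norm (w m)"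
        using L(2)[OF inK[OF s']] m(2)[OF s'] L(1) unfolding w_def
        by (meson mult_left_mono order_trans)
    qed
    also have "\<dots> \<le> (L * norm (w m)) * \<delta>"
      using abs_le_of_mem_segment[OF m(1)] ty(1) L(1) by (intro mult_left_mono) auto
    also have "\<dots> \<le> norm (w m) / 2"
    proof -
      have "8 * (L * norm (w m) * \<delta>) \<le> norm (w m)"
        using mult_right_mono[OF \<delta>(2), of "norm (w m)"] by (simp add: mult_ac)
      then show ?thesis using norm_ge_zero[of "w m"] by linarith
    qed
    finally have "norm (w m - w 0) \<le> norm (w m) / 2" .
    moreover have "norm (w m) \<le> norm (w m - w 0) + norm (w 0)"
      by (metis norm_triangle_sub add.commute)
    ultimately have "norm (w m) \<le> 2 * norm (w 0)" by simp
    then show ?thesis using m(2)[of t] flow_0[OF f] by (simp add: w_def)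
  qed
  with main \<delta>(1) show ?thesis by blast
qed

text \<open>This is the k-fold Lie derivative along \<open>f\<close> of the identity map: by the
  chain rule, \<open>lie f k (u s)\<close> is the k-th time derivative of any solution
  \<open>u\<close>. Time derivatives of the flow are thus smooth functions evaluated at the
  flow.\<close>

primrec lie :: "('v::euclidean_space \<Rightarrow> 'v) \<Rightarrow> nat \<Rightarrow> 'v \<Rightarrow> 'v" where
  "lie f 0 = (\<lambda>y. y)"
| "lie f (Suc k) = (\<lambda>y. frechet_derivative (lie f k) (at y) (f y))"

lemma smooth_on_lie: "smooth_on UNIV f \<Longrightarrow> smooth_on UNIV (lie f k)"
  by (induction k) (auto intro: smooth_on_id smooth_on_directional_derivative)

lemma lie_1: "lie f (Suc 0) = f"
  by (simp add: frechet_derivative_ident)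

lemma has_vector_derivative_compose_smooth:
  assumes "smooth_on S f" "(u has_vector_derivative u') (at s within A)" "u s \<in> S"
  shows "((\<lambda>s. f (u s)) has_vector_derivative frechet_derivative f (at (u s)) u') (at s within A)"
proof -
  have "((\<lambda>s. f (u s)) has_derivative (\<lambda>h. frechet_derivative f (at (u s)) (h *\<^sub>R u'))) (at s within A)"
    using assms(2) smooth_on_has_derivative[OF assms(1,3)]
    unfolding has_vector_derivative_def by (rule has_derivative_compose)
  then show ?thesis
    by (simp add: has_vector_derivative_def linear_scale[OF smooth_on_linear_frechet[OF assms(1,3)]])
qed

lemma has_vector_derivative_lie:
  assumes "smooth_on UNIV f" "solves f u t" "s \<in> closed_segment 0 t"
  shows "((\<lambda>s. lie f k (u s)) has_vector_derivative lie f (Suc k) (u s)) (at s within closed_segment 0 t)"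
  using assms has_vector_derivative_compose_smooth[OF smooth_on_lie[OF assms(1)], of u "f (u s)"]
  by (simp add: solves_def)

text \<open>Both bounds are second-order Taylor formulas in time. For the second, Taylor's formula
  is applied to the difference of two trajectories: its second time derivative is the difference of
  \<open>lie f 2\<close> at two points, and Lipschitz continuity of \<open>lie f 2\<close> and of
  the flow extracts the factor \<open>norm (y - z)\<close>.\<close>

lemma flow_expansion:
  fixes f :: "'v::euclidean_space \<Rightarrow> 'v"
  assumes f: "smooth_on UNIV f"
  shows "\<exists>\<delta>>0. \<exists>C. \<forall>t. \<forall>y\<in>cball x \<delta>. \<forall>z\<in>cball x \<delta>. \<bar>t\<bar> \<le> \<delta> \<longrightarrow>
    norm (flow f t y - y - t *\<^sub>R f y) \<le> C * t\<^sup>2 \<and>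
    norm (flow f t y - flow f t z - (y - z) - t *\<^sub>R (f y - f z)) \<le> C * (t\<^sup>2 * norm (y - z))"
proof -
  let ?K = "cball x 1"
  obtain \<delta> where \<delta>: "\<delta> > 0" "\<And>t y. \<bar>t\<bar> \<le> \<delta> \<Longrightarrow> y \<in> cball x \<delta> \<Longrightarrow> solves f (\<lambda>s. flow f s y) t"
    "\<And>t y. \<bar>t\<bar> \<le> \<delta> \<Longrightarrow> y \<in> cball x \<delta> \<Longrightarrow> flow f t y \<in> ?K"
    "\<And>t y z. \<bar>t\<bar> \<le> \<delta> \<Longrightarrow> y \<in> cball x \<delta> \<Longrightarrow> z \<in> cball x \<delta> \<Longrightarrow> norm (flow f t y - flow f t z) \<le> 2 * norm (y - z)"
    using flow_local[OF f, of x] by blast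
  obtain L where L: "L \<ge> 0" "\<And>u v. u \<in> ?K \<Longrightarrow> v \<in> ?K \<Longrightarrow> norm (lie f 2 u - lie f 2 v) \<le> L * norm (u - v)"
    using smooth_on_lipschitz[OF smooth_on_lie[OF f, of 2], of ?K] by auto
  have "bounded (lie f 2 ` ?K)"
    by (intro compact_imp_bounded compact_continuous_image continuous_on_subset[OF smooth_on_continuous_on[OF smooth_on_lie[OF f]]]) auto
  then obtain M where M: "\<And>u. u \<in> ?K \<Longrightarrow> norm (lie f 2 u) \<le> M" unfolding bounded_iff by blast
  have d: "((\<lambda>s. lie f k (flow f s y)) has_vector_derivative lie f (Suc k) (flow f s y)) (at s within closed_segment 0 t)"
    if "\<bar>t\<bar> \<le> \<delta>" "y \<in> cball x \<delta>" "s \<in> closed_segment 0 t" for k s t y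
    using has_vector_derivative_lie[OF f \<delta>(2)] that by blast
  have 1: "norm (flow f t y - y - t *\<^sub>R f y) \<le> M * t\<^sup>2" if "\<bar>t\<bar> \<le> \<delta>" "y \<in> cball x \<delta>" for t y
  proof -
    have "norm (lie f 0 (flow f t y) - (\<Sum>k<2. (t ^ k / fact k) *\<^sub>R lie f k (flow f 0 y))) \<le> M * \<bar>t\<bar> ^ 2"
      using that abs_le_of_mem_segment[of _ t]
      by (intro taylor_remainder_bound[of 2 t "\<lambda>k s. lie f k (flow f s y)"] d M \<delta>) fastforce+
    then show ?thesis
      by (simp add: flow_0[OF f] numeral_2_eq_2 lie_1 del: lie.simps(2) add: diff_diff_eq)
  qed
  have 2: "norm (flow f t y - flow f t z - (y - z) - t *\<^sub>R (f y - f z)) \<le> (2 * L * norm (y - z)) * t\<^sup>2"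
    if "\<bar>t\<bar> \<le> \<delta>" "y \<in> cball x \<delta>" "z \<in> cball x \<delta>" for t y z
  proof -
    let ?g = "\<lambda>k s. lie f k (flow f s y) - lie f k (flow f s z)"
    have "norm (?g 0 t - (\<Sum>k<2. (t ^ k / fact k) *\<^sub>R ?g k 0)) \<le> (2 * L * norm (y - z)) * \<bar>t\<bar> ^ 2"
    proof (rule taylor_remainder_bound[of 2 t ?g])
      fix s assume s: "s \<in> closed_segment 0 t"
      then show "(?g k has_vector_derivative ?g (Suc k) s) (at s within closed_segment 0 t)" for k
        using that by (intro has_vector_derivative_diff d)
      have s': "\<bar>s\<bar> \<le> \<delta>" using abs_le_of_mem_segment[OF s] that by simp
      have "norm (?g 2 s) \<le> L * norm (flow f s y - flow f s z)"
        using s' that by (intro L(2) \<delta>(3))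
      also have "\<dots> \<le> L * (2 * norm (y - z))"
        using s' that L(1) by (intro mult_left_mono \<delta>(4))
      finally show "norm (?g 2 s) \<le> 2 * L * norm (y - z)" by simp
    qed
    then show ?thesis
      by (simp add: flow_0[OF f] numeral_2_eq_2 lie_1 del: lie.simps(2) add: diff_diff_eq add.assoc)
  qed
  show ?thesis
  proof (rule exI[of _ \<delta>], rule conjI[OF \<delta>(1)], rule exI[of _ "max M (2 * L)"], intro conjI ballI allI impI)
    fix t y z assume a: "y \<in> cball x \<delta>" "z \<in> cball x \<delta>" "\<bar>t\<bar> \<le> \<delta>"
    show "norm (flow f t y - y - t *\<^sub>R f y) \<le> max M (2 * L) * t\<^sup>2"
      by (intro order_trans[OF 1[OF a(3,1)]] mult_right_mono) auto
    have "norm (flow f t y - flow f t z - (y - z) - t *\<^sub>R (f y - f z)) \<le> (2 * L) * (t\<^sup>2 * norm (y - z))"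
      using 2[OF a(3,1,2)] by (simp add: mult_ac)
    also have "\<dots> \<le> max M (2 * L) * (t\<^sup>2 * norm (y - z))" by (intro mult_right_mono) auto
    finally show "norm (flow f t y - flow f t z - (y - z) - t *\<^sub>R (f y - f z)) \<le> max M (2 * L) * (t\<^sup>2 * norm (y - z))" .
  qed
qed

text \<open>The trajectory read from its endpoint, \<open>s \<mapsto> flow f (t + s) y\<close>,
  solves the equation on the segment from 0 to \<open>- t\<close>; uniqueness identifies it with the
  flow.\<close>

lemma flow_minus_flow:
  fixes f :: "'v::euclidean_space \<Rightarrow> 'v"
  assumes f: "smooth_on UNIV f" and sol: "solves f (\<lambda>s. flow f s y) t"
  shows "flow f (- t) (flow f t y) = y"
proof -
  have "solves f (\<lambda>s. flow f (t + s) y) (- t)"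
    unfolding solves_def
  proof
    fix s assume s: "s \<in> closed_segment 0 (- t)"
    have img: "(\<lambda>s. t + s) ` closed_segment 0 (- t) = closed_segment 0 t"
      using closed_segment_translation[of t 0 "- t"] by (simp add: closed_segment_commute)
    have "((\<lambda>s. flow f s y) has_vector_derivative f (flow f (t + s) y)) (at (t + s) within (\<lambda>s. t + s) ` closed_segment 0 (- t))"
      unfolding img using sol s img unfolding solves_def by blast
    moreover have "((\<lambda>s. t + s) has_vector_derivative 1) (at s within closed_segment 0 (- t))"
      by (auto intro!: derivative_eq_intros)
    ultimately show "((\<lambda>s. flow f (t + s) y) has_vector_derivative f (flow f (t + s) y)) (at s within closed_segment 0 (- t))"
      using vector_diff_chain_within[of "\<lambda>s. t + s" 1] by (fastforce simp: o_def)
  qed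
  from flow_eqI[OF f this refl] show ?thesis by (simp add: flow_0[OF f])
qed

text \<open>If \<open>u\<close> solves \<open>x' = f(x)\<close>, then
  \<open>s \<mapsto> u (s * c)\<close> solves \<open>x' = c f(x)\<close>. The factor
  \<open>c\<close> may have any sign or vanish; existence is therefore asked for on the segment up
  to \<open>t * c\<close>.\<close>

lemma flow_scaleR_field:
  fixes f :: "'v::euclidean_space \<Rightarrow> 'v"
  assumes f: "smooth_on UNIV f" and sol: "solves f (\<lambda>s. flow f s y) (t * c)"
  shows "flow (\<lambda>z. c *\<^sub>R f z) t y = flow f (t * c) y"
proof -
  have "solves (\<lambda>z. c *\<^sub>R f z) (\<lambda>s. flow f (s * c) y) t"
    unfolding solves_def
  proof
    fix s assume s: "s \<in> closed_segment 0 t"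
    have img: "(\<lambda>s. s * c) ` closed_segment 0 t = closed_segment 0 (t * c)"
      by (auto simp: closed_segment_def image_iff)
    have "((\<lambda>s. flow f s y) has_vector_derivative f (flow f (s * c) y)) (at (s * c) within (\<lambda>s. s * c) ` closed_segment 0 t)"
      unfolding img using sol s img unfolding solves_def by blast
    moreover have "((\<lambda>s. s * c) has_vector_derivative c) (at s within closed_segment 0 t)"
      by (auto intro!: derivative_eq_intros)
    ultimately show "((\<lambda>s. flow f (s * c) y) has_vector_derivative c *\<^sub>R f (flow f (s * c) y)) (at s within closed_segment 0 t)"
      using vector_diff_chain_within[of "\<lambda>s. s * c" c] by (fastforce simp: o_def)
  qed
  moreover have "smooth_on UNIV (\<lambda>z. c *\<^sub>R f z)"
    using f by (intro smooth_on_scaleR smooth_on_const) auto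
  ultimately show ?thesis using flow_eqI[of "\<lambda>z. c *\<^sub>R f z" "\<lambda>s. flow f (s * c) y" t y] by (simp add: flow_0[OF f])
qed

section \<open>Domination along a filter\<close>

text \<open>A vector-valued counterpart of \<open>O[F](g)\<close>. The absolute value on the right
  lets signed monomials in \<epsilon> and \<tau> serve as bounds; an arbitrary filter on an
  arbitrary index type lets step size, parameter and base point vary together.\<close>

definition dominated :: "'p filter \<Rightarrow> ('p \<Rightarrow> 'v::real_normed_vector) \<Rightarrow> ('p \<Rightarrow> real) \<Rightarrow> bool" where
  "dominated F f g \<longleftrightarrow> (\<exists>C. \<forall>\<^sub>F p in F. norm (f p) \<le> C * \<bar>g p\<bar>)"

lemma dominatedI: "(\<forall>\<^sub>F p in F. norm (f p) \<le> C * \<bar>g p\<bar>) \<Longrightarrow> dominated F f g"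
  by (auto simp: dominated_def)

lemma dominated_0: "dominated F (\<lambda>p. 0) g"
  by (rule dominatedI[where C=0]) simp

lemma dominatedE:
  assumes "dominated F f g"
  obtains C where "C \<ge> 0" "\<forall>\<^sub>F p in F. norm (f p) \<le> C * \<bar>g p\<bar>"
proof -
  from assms obtain C where "\<forall>\<^sub>F p in F. norm (f p) \<le> C * \<bar>g p\<bar>" by (auto simp: dominated_def)
  then have "\<forall>\<^sub>F p in F. norm (f p) \<le> max C 0 * \<bar>g p\<bar>"
    by eventually_elim (rule order_trans, assumption, auto intro: mult_right_mono)
  then show ?thesis by (rule that[rotated]) simp
qed

lemma dominated_iff_bigo: "dominated F f g \<longleftrightarrow> (\<lambda>p. norm (f p)) \<in> O[F](g)"
proof
  assume "dominated F f g"
  then obtain C where "\<forall>\<^sub>F p in F. norm (f p) \<le> C * \<bar>g p\<bar>" by (auto simp: dominated_def)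
  then show "(\<lambda>p. norm (f p)) \<in> O[F](g)" by (intro bigoI[of _ C]) simp
next
  assume "(\<lambda>p. norm (f p)) \<in> O[F](g)"
  then obtain C where "\<forall>\<^sub>F p in F. norm (norm (f p)) \<le> C * norm (g p)" by (rule landau_o.bigE)
  then show "dominated F f g" by (intro dominatedI[where C=C]) simp
qed

lemma dominated_trans:
  assumes "dominated F f g" "dominated F g h"
  shows "dominated F f h"
proof -
  obtain C where C: "C \<ge> 0" "\<forall>\<^sub>F p in F. norm (f p) \<le> C * \<bar>g p\<bar>" using assms(1) by (rule dominatedE)
  obtain D where D: "\<forall>\<^sub>F p in F. norm (g p) \<le> D * \<bar>h p\<bar>" using assms(2) by (auto simp: dominated_def)
  have "\<forall>\<^sub>F p in F. norm (f p) \<le> (C * D) * \<bar>h p\<bar>"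
    using C(2) D
  proof eventually_elim
    case (elim p)
    then show ?case using mult_left_mono[OF elim(2) C(1)] by (simp add: mult_ac)
  qed
  then show ?thesis by (rule dominatedI)
qed

lemma dominated_norm_self: "dominated F f (\<lambda>p. norm (f p))"
  by (rule dominatedI[where C=1]) simp

lemma dominated_refl: "dominated F g g" for g :: "'p \<Rightarrow> real"
  by (rule dominatedI[where C=1]) simp

lemma dominated_norm_iff: "dominated F (\<lambda>p. norm (f p)) g \<longleftrightarrow> dominated F f g"
  by (simp add: dominated_def)

lemma dominated_add:
  assumes "dominated F f h" "dominated F g h"
  shows "dominated F (\<lambda>p. f p + g p) h"
proof -
  obtain C where C: "\<forall>\<^sub>F p in F. norm (f p) \<le> C * \<bar>h p\<bar>" using assms(1) by (auto simp: dominated_def)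
  obtain D where D: "\<forall>\<^sub>F p in F. norm (g p) \<le> D * \<bar>h p\<bar>" using assms(2) by (auto simp: dominated_def)
  have "\<forall>\<^sub>F p in F. norm (f p + g p) \<le> (C + D) * \<bar>h p\<bar>"
    using C D by eventually_elim (metis norm_triangle_mono distrib_right)
  then show ?thesis by (rule dominatedI)
qed

lemma dominated_minus: "dominated F f h \<Longrightarrow> dominated F (\<lambda>p. - f p) h"
  by (simp add: dominated_def)

lemma dominated_diff: "dominated F f h \<Longrightarrow> dominated F g h \<Longrightarrow> dominated F (\<lambda>p. f p - g p) h"
  using dominated_add[OF _ dominated_minus, of F f h g] by simp

lemma dominated_scaleR:
  assumes "dominated F a g" "dominated F f h"
  shows "dominated F (\<lambda>p. a p *\<^sub>R f p) (\<lambda>p. g p * h p)"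
proof -
  obtain C where C: "C \<ge> 0" "\<forall>\<^sub>F p in F. norm (a p) \<le> C * \<bar>g p\<bar>" using assms(1) by (rule dominatedE)
  obtain D where D: "D \<ge> 0" "\<forall>\<^sub>F p in F. norm (f p) \<le> D * \<bar>h p\<bar>" using assms(2) by (rule dominatedE)
  have "\<forall>\<^sub>F p in F. norm (a p *\<^sub>R f p) \<le> (C * D) * \<bar>g p * h p\<bar>"
    using C(2) D(2)
  proof eventually_elim
    case (elim p)
    have "norm (a p) * norm (f p) \<le> (C * \<bar>g p\<bar>) * (D * \<bar>h p\<bar>)"
      using elim C(1) D(1) by (intro mult_mono) auto
    then show ?case by (simp add: abs_mult mult_ac)
  qed
  then show ?thesis by (rule dominatedI)
qed

lemma dominated_mult: "dominated F a g \<Longrightarrow> dominated F b h \<Longrightarrow> dominated F (\<lambda>p. a p * b p) (\<lambda>p. g p * h p)"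
  for a b :: "'p \<Rightarrow> real"
  using dominated_scaleR[of F a g b h] by simp

lemma dominated_eventually_eq:
  assumes "\<forall>\<^sub>F p in F. f p = f' p" "dominated F f g"
  shows "dominated F f' g"
proof -
  obtain C where "\<forall>\<^sub>F p in F. norm (f p) \<le> C * \<bar>g p\<bar>" using assms(2) by (auto simp: dominated_def)
  with assms(1) have "\<forall>\<^sub>F p in F. norm (f' p) \<le> C * \<bar>g p\<bar>" by eventually_elim simp
  then show ?thesis by (rule dominatedI)
qed

lemma tendsto_imp_dominated_1:
  assumes "(f \<longlongrightarrow> l) F"
  shows "dominated F f (\<lambda>p. 1)"
proof -
  have "\<forall>\<^sub>F p in F. dist (f p) l < 1" using tendstoD[OF assms, of 1] by simp
  then have "\<forall>\<^sub>F p in F. norm (f p) \<le> (norm l + 1) * \<bar>1\<bar>"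
  proof eventually_elim
    case (elim p)
    then show ?case using norm_triangle_sub[of "f p" l] by (simp add: dist_norm)
  qed
  then show ?thesis by (rule dominatedI)
qed

lemma dominated_tendsto_0:
  assumes "dominated F f g" "(g \<longlongrightarrow> 0) F"
  shows "(f \<longlongrightarrow> 0) F"
proof -
  obtain C where C: "\<forall>\<^sub>F p in F. norm (f p) \<le> C * \<bar>g p\<bar>" using assms(1) by (auto simp: dominated_def)
  have "((\<lambda>p. C * \<bar>g p\<bar>) \<longlongrightarrow> C * \<bar>0\<bar>) F" by (intro tendsto_intros assms)
  then show ?thesis by (intro Lim_null_comparison[OF C]) simp
qed

lemma dominated_power_mono:
  fixes \<epsilon> \<tau> :: "'p \<Rightarrow> real"
  assumes "(\<epsilon> \<longlongrightarrow> e) F" "(\<tau> \<longlongrightarrow> t) F" "i' \<le> i" "j' \<le> j"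
  shows "dominated F (\<lambda>p. \<epsilon> p ^ i * \<tau> p ^ j) (\<lambda>p. \<epsilon> p ^ i' * \<tau> p ^ j')"
proof -
  have "dominated F (\<lambda>p. (\<epsilon> p ^ (i - i') * \<tau> p ^ (j - j')) * (\<epsilon> p ^ i' * \<tau> p ^ j')) (\<lambda>p. 1 * (\<epsilon> p ^ i' * \<tau> p ^ j'))"
    by (intro dominated_mult dominated_refl tendsto_imp_dominated_1[OF tendsto_mult[OF tendsto_power[OF assms(1)] tendsto_power[OF assms(2)]]])
  moreover have "(\<epsilon> p ^ (i - i') * \<tau> p ^ (j - j')) * (\<epsilon> p ^ i' * \<tau> p ^ j') = \<epsilon> p ^ i * \<tau> p ^ j" for p
    using power_add[of "\<epsilon> p" "i - i'" i'] power_add[of "\<tau> p" "j - j'" j'] assms(3,4) by (simp add: mult_ac)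
  ultimately show ?thesis by simp
qed

section \<open>Smooth maps and flows along convergent families\<close>

lemma eventually_in_cball:
  assumes "(U \<longlongrightarrow> x) F" "\<delta> > 0"
  shows "\<forall>\<^sub>F p in F. U p \<in> cball x \<delta>"
  using tendstoD[OF assms] by eventually_elim (simp add: dist_commute)

lemma smooth_on_tendsto:
  assumes "smooth_on S f" "x \<in> S" "(Y \<longlongrightarrow> x) F"
  shows "((\<lambda>p. f (Y p)) \<longlongrightarrow> f x) F"
  using smooth_on_continuous_on[OF assms(1)] assms(1,2)
  by (intro isCont_tendsto_compose[OF _ assms(3)]) (simp add: continuous_on_eq_continuous_at smooth_on_def)

lemma eventually_in_open:
  assumes "smooth_on S f" "x \<in> S" "(Y \<longlongrightarrow> x) F"
  shows "\<forall>\<^sub>F p in F. Y p \<in> S"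
  using assms by (auto simp: smooth_on_def dest: topological_tendstoD)

lemma frechet_derivative_tendsto:
  assumes "smooth_on S f" "x \<in> S" "(Y \<longlongrightarrow> x) F" "(w \<longlongrightarrow> w0) F"
  shows "((\<lambda>p. frechet_derivative f (at (Y p)) (w p)) \<longlongrightarrow> frechet_derivative f (at x) w0) F"
proof -
  have "((\<lambda>p. \<Sum>b\<in>Basis. (w p \<bullet> b) *\<^sub>R frechet_derivative f (at (Y p)) b)
      \<longlongrightarrow> (\<Sum>b\<in>Basis. (w0 \<bullet> b) *\<^sub>R frechet_derivative f (at x) b)) F"
    by (intro tendsto_intros assms smooth_on_tendsto[OF smooth_on_frechet_derivative[OF assms(1)] assms(2,3)])
  then show ?thesis
    unfolding frechet_derivative_basis[OF assms(1,2), of w0, symmetric]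
    by (rule Lim_transform_eventually)
       (use eventually_in_open[OF assms(1-3)] in eventually_elim, simp add: frechet_derivative_basis[OF assms(1)])
qed

lemma smooth_on_cball_subset:
  assumes "smooth_on S f" "x \<in> S"
  obtains \<delta> where "\<delta> > 0" "cball x \<delta> \<subseteq> S"
  using assms open_contains_cball by (metis smooth_on_def)

lemma dominated_smooth_diff:
  assumes "smooth_on S f" "x \<in> S" "(U \<longlongrightarrow> x) F" "(V \<longlongrightarrow> x) F"
  shows "dominated F (\<lambda>p. f (U p) - f (V p)) (\<lambda>p. norm (U p - V p))"
proof -
  obtain \<delta> where \<delta>: "\<delta> > 0" "cball x \<delta> \<subseteq> S" using smooth_on_cball_subset[OF assms(1,2)] .
  obtain L where L: "\<And>u v. u \<in> cball x \<delta> \<Longrightarrow> v \<in> cball x \<delta> \<Longrightarrow> norm (f u - f v) \<le> L * norm (u - v)"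
    using smooth_on_lipschitz[OF assms(1) compact_cball convex_cball \<delta>(2)] by blast
  show ?thesis
    by (rule dominatedI[where C=L])
       (use eventually_in_cball[OF assms(3) \<delta>(1)] eventually_in_cball[OF assms(4) \<delta>(1)] in
         \<open>eventually_elim, simp add: L del: mem_cball\<close>)
qed

lemma dominated_smooth_linearization:
  fixes f :: "'a::euclidean_space \<Rightarrow> 'b::euclidean_space"
  assumes "smooth_on S f" "x \<in> S" "(U \<longlongrightarrow> x) F" "(V \<longlongrightarrow> x) F" "(Y \<longlongrightarrow> x) F"
  shows "dominated F (\<lambda>p. f (U p) - f (V p) - frechet_derivative f (at (Y p)) (U p - V p))
    (\<lambda>p. norm (U p - V p) * (norm (U p - Y p) + norm (V p - Y p)))"
proof -
  obtain \<delta> where \<delta>: "\<delta> > 0" "cball x \<delta> \<subseteq> S" using smooth_on_cball_subset[OF assms(1,2)] .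
  obtain L where L: "\<And>u v y. u \<in> cball x \<delta> \<Longrightarrow> v \<in> cball x \<delta> \<Longrightarrow> y \<in> cball x \<delta> \<Longrightarrow>
      norm (f u - f v - frechet_derivative f (at y) (u - v)) \<le> L * norm (u - v) * (norm (u - y) + norm (v - y))"
    using smooth_on_linearization[OF assms(1) compact_cball convex_cball \<delta>(2)] by blast
  show ?thesis
  proof (rule dominatedI[where C=L])
    show "\<forall>\<^sub>F p in F. norm (f (U p) - f (V p) - frechet_derivative f (at (Y p)) (U p - V p))
        \<le> L * \<bar>norm (U p - V p) * (norm (U p - Y p) + norm (V p - Y p))\<bar>"
      using eventually_in_cball[OF assms(3) \<delta>(1)] eventually_in_cball[OF assms(4) \<delta>(1)]
        eventually_in_cball[OF assms(5) \<delta>(1)]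
    proof eventually_elim
      case (elim p)
      then show ?case using L[OF elim] by (simp add: mult.assoc)
    qed
  qed
qed

lemma dominated_frechet_derivative:
  assumes "smooth_on S f" "x \<in> S" "(Y \<longlongrightarrow> x) F"
  shows "dominated F (\<lambda>p. frechet_derivative f (at (Y p)) (w p)) (\<lambda>p. norm (w p))"
proof -
  obtain \<delta> where \<delta>: "\<delta> > 0" "cball x \<delta> \<subseteq> S" using smooth_on_cball_subset[OF assms(1,2)] .
  obtain L where L: "\<And>u v. u \<in> cball x \<delta> \<Longrightarrow> norm (frechet_derivative f (at u) v) \<le> L * norm v"
    using frechet_derivative_bound[OF assms(1) compact_cball \<delta>(2)] by blast
  show ?thesis
    by (rule dominatedI[where C=L])
       (use eventually_in_cball[OF assms(3) \<delta>(1)] in \<open>eventually_elim, simp add: L del: mem_cball\<close>)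
qed

lemma dominated_flow_expansion:
  fixes f :: "'v::euclidean_space \<Rightarrow> 'v"
  assumes f: "smooth_on UNIV f" and "(t \<longlongrightarrow> 0) F" "(U \<longlongrightarrow> x) F" "(V \<longlongrightarrow> x) F"
  shows "dominated F (\<lambda>p. flow f (t p) (U p) - U p - t p *\<^sub>R f (U p)) (\<lambda>p. (t p)\<^sup>2)"
    and "dominated F (\<lambda>p. flow f (t p) (U p) - flow f (t p) (V p) - (U p - V p) - t p *\<^sub>R (f (U p) - f (V p)))
      (\<lambda>p. (t p)\<^sup>2 * norm (U p - V p))"
proof -
  obtain \<delta> C where \<delta>: "\<delta> > 0" "\<And>t y z. y \<in> cball x \<delta> \<Longrightarrow> z \<in> cball x \<delta> \<Longrightarrow> \<bar>t\<bar> \<le> \<delta> \<Longrightarrow>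
    norm (flow f t y - y - t *\<^sub>R f y) \<le> C * t\<^sup>2 \<and>
    norm (flow f t y - flow f t z - (y - z) - t *\<^sub>R (f y - f z)) \<le> C * (t\<^sup>2 * norm (y - z))"
    using flow_expansion[OF f, of x] by blast
  have t: "\<forall>\<^sub>F p in F. \<bar>t p\<bar> \<le> \<delta>"
    using eventually_in_cball[OF assms(2) \<delta>(1)] by eventually_elim simp
  note ev = eventually_in_cball[OF assms(3) \<delta>(1)] eventually_in_cball[OF assms(4) \<delta>(1)] t
  show "dominated F (\<lambda>p. flow f (t p) (U p) - U p - t p *\<^sub>R f (U p)) (\<lambda>p. (t p)\<^sup>2)"
    by (rule dominatedI[where C=C]) (use ev in \<open>eventually_elim, simp add: \<delta>(2) del: mem_cball\<close>)
  show "dominated F (\<lambda>p. flow f (t p) (U p) - flow f (t p) (V p) - (U p - V p) - t p *\<^sub>R (f (U p) - f (V p)))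
      (\<lambda>p. (t p)\<^sup>2 * norm (U p - V p))"
    by (rule dominatedI[where C=C]) (use ev in \<open>eventually_elim, simp add: \<delta>(2) abs_mult del: mem_cball\<close>)
qed

section \<open>Taylor expansion of the integrator error in the step size\<close>

lemma poly_coeffs_zero_of_small:
  fixes v :: "nat \<Rightarrow> 'v::real_normed_vector"
  assumes "\<forall>\<^sub>F h in at 0. norm (\<Sum>k<n. h ^ k *\<^sub>R v k) \<le> C * \<bar>h\<bar> ^ n" "k < n"
  shows "v k = 0"
  using assms
proof (induction n arbitrary: v k)
  case 0
  then show ?case by simp
next
  case (Suc n)
  have split: "(\<Sum>k<Suc n. h ^ k *\<^sub>R v k) = v 0 + h *\<^sub>R (\<Sum>k<n. h ^ k *\<^sub>R v (Suc k))" for h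
    by (subst sum.lessThan_Suc_shift) (simp add: scaleR_sum_right)
  have "((\<lambda>h. \<Sum>k<Suc n. h ^ k *\<^sub>R v k) \<longlongrightarrow> v 0 + 0 *\<^sub>R (\<Sum>k<n. 0 ^ k *\<^sub>R v (Suc k))) (at 0)"
    unfolding split by (intro tendsto_intros)
  moreover have "((\<lambda>h. \<Sum>k<Suc n. h ^ k *\<^sub>R v k) \<longlongrightarrow> 0) (at 0)"
  proof (rule Lim_null_comparison[OF Suc.prems(1)])
    have "((\<lambda>h. C * \<bar>h\<bar> ^ Suc n) \<longlongrightarrow> C * \<bar>0\<bar> ^ Suc n) (at (0::real))" by (intro tendsto_intros)
    then show "((\<lambda>h. C * \<bar>h\<bar> ^ Suc n) \<longlongrightarrow> 0) (at (0::real))" by simp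
  qed
  ultimately have v0: "v 0 = 0" using tendsto_unique[OF at_neq_bot] by fastforce
  \<comment> \<open>The constant term being zero, a factor \<open>h\<close> splits off; dividing by
    it for \<open>h \<noteq> 0\<close> lowers the degree.\<close>
  have "\<forall>\<^sub>F h in at 0. norm (\<Sum>k<n. h ^ k *\<^sub>R v (Suc k)) \<le> C * \<bar>h\<bar> ^ n"
    using Suc.prems(1) eventually_neq_at_within[of 0 0 UNIV]
  proof eventually_elim
    case (elim h)
    then have "\<bar>h\<bar> * norm (\<Sum>k<n. h ^ k *\<^sub>R v (Suc k)) \<le> \<bar>h\<bar> * (C * \<bar>h\<bar> ^ n)"
      unfolding split v0 by (simp add: mult_ac)
    then show ?case using elim(2) by (simp add: mult_le_cancel_left_pos)
  qed
  then show ?case using Suc.IH[of "\<lambda>k. v (Suc k)" "k - 1"] Suc.prems(2) v0 by (cases k) auto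
qed

primrec time_derivative :: "(real \<times> 'v::euclidean_space \<Rightarrow> 'v) \<Rightarrow> nat \<Rightarrow> real \<times> 'v \<Rightarrow> 'v" where
  "time_derivative \<Psi> 0 = \<Psi>"
| "time_derivative \<Psi> (Suc k) = (\<lambda>p. frechet_derivative (time_derivative \<Psi> k) (at p) (1, 0))"

lemma smooth_on_time_derivative: "smooth_on U \<Psi> \<Longrightarrow> smooth_on U (time_derivative \<Psi> k)"
  by (induction k) (auto intro: smooth_on_frechet_derivative)

text \<open>The hypothesis of second order is pointwise in \<open>y\<close>, with no uniform
  constant. It shows that the Taylor coefficients of degree below 3 vanish at each \<open>y\<close>;
  the uniform remainder comes from joint smoothness of the integrator in \<open>(h, y)\<close>,
  through bounds on fifth time derivatives over compact sets.\<close>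

lemma integrator_expansion:
  fixes g :: "'v::euclidean_space \<Rightarrow> 'v"
  assumes "smooth_integrator \<Phi>" "second_order_integrator \<Phi>" and g: "smooth_on UNIV g"
  shows "\<exists>V d e. x \<in> V \<and> smooth_on V d \<and> smooth_on V e \<and> (\<exists>\<delta>>0. \<exists>C. \<forall>h. \<forall>y\<in>cball x \<delta>. \<bar>h\<bar> \<le> \<delta> \<longrightarrow>
    norm (\<Phi> g h y - flow g h y - h ^ 3 *\<^sub>R d y - h ^ 4 *\<^sub>R e y) \<le> C * \<bar>h\<bar> ^ 5)"
proof -
  define \<Psi> where "\<Psi> = (\<lambda>(h, y). \<Phi> g h y)"
  obtain U where U: "(0, x) \<in> U" "smooth_on U \<Psi>"
    using assms(1) g unfolding smooth_integrator_def \<Psi>_def by blast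
  obtain \<delta>1 where \<delta>1: "\<delta>1 > 0" "\<And>t y. \<bar>t\<bar> \<le> \<delta>1 \<Longrightarrow> y \<in> cball x \<delta>1 \<Longrightarrow> solves g (\<lambda>s. flow g s y) t"
    "\<And>t y. \<bar>t\<bar> \<le> \<delta>1 \<Longrightarrow> y \<in> cball x \<delta>1 \<Longrightarrow> flow g t y \<in> cball x 1"
    using flow_local[OF g, of x] by blast
  obtain \<delta>2 where \<delta>2: "\<delta>2 > 0" "cball (0, x) \<delta>2 \<subseteq> U" using smooth_on_cball_subset[OF U(2,1)] .
  \<comment> \<open>Halving \<open>\<delta>2\<close> makes the product of an interval and a ball,
    both of radius \<delta>, fit into the ball of radius \<open>\<delta>2\<close> in the product
    space.\<close>
  define \<delta> where "\<delta> = min \<delta>1 (\<delta>2 / 2)"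
  have \<delta>: "\<delta> > 0" "\<delta> \<le> \<delta>1" "2 * \<delta> \<le> \<delta>2" using \<delta>1(1) \<delta>2(1) by (auto simp: \<delta>_def)
  have box: "cball (0, x) \<delta>2 \<supseteq> {- \<delta>..\<delta>} \<times> cball x \<delta>"
  proof clarify
    fix h y assume h: "h \<in> {- \<delta>..\<delta>}" and y: "y \<in> cball x \<delta>"
    have "dist (0, x) (h, y) \<le> dist 0 h + dist x y"
      using sqrt_sum_squares_le_sum_abs[of h "dist x y"] by (simp add: dist_Pair_Pair)
    also have "\<dots> \<le> \<delta> + \<delta>" using h y by (intro add_mono) auto
    finally show "(h, y) \<in> cball (0, x) \<delta>2" using \<delta>(3) by simp
  qed
  \<comment> \<open>This is the k-th time derivative of integrator minus flow. At time 0 the flow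
    part is \<open>lie g k y\<close>, so the Taylor coefficients are smooth in \<open>y\<close>
    without any appeal to smoothness of the flow in \<open>y\<close>.\<close>
  define c where "c k s y = time_derivative \<Psi> k (s, y) - lie g k (flow g s y)" for k s y
  have cderiv: "((\<lambda>s. c k s y) has_vector_derivative c (Suc k) s y) (at s within closed_segment 0 t)"
    if t: "\<bar>t\<bar> \<le> \<delta>" and y: "y \<in> cball x \<delta>" and s: "s \<in> closed_segment 0 t" for k s t y
  proof -
    have "\<bar>s\<bar> \<le> \<delta>" using abs_le_of_mem_segment[OF s] t by linarith
    then have "s \<in> {- \<delta>..\<delta>}" by auto
    then have "(s, y) \<in> U" using y box \<delta>2(2) by blast
    moreover have "((\<lambda>s. (s, y)) has_vector_derivative (1, 0)) (at s within closed_segment 0 t)"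
      by (auto simp: has_vector_derivative_def intro!: derivative_eq_intros)
    ultimately have "((\<lambda>s. time_derivative \<Psi> k (s, y)) has_vector_derivative time_derivative \<Psi> (Suc k) (s, y))
        (at s within closed_segment 0 t)"
      using has_vector_derivative_compose_smooth[OF smooth_on_time_derivative[OF U(2), of k], of "\<lambda>s. (s, y)"] by simp
    moreover have "solves g (\<lambda>s. flow g s y) t" using \<delta>1(2) t y \<delta>(2) by auto
    note has_vector_derivative_lie[OF g this s, of k]
    ultimately show ?thesis unfolding c_def by (rule has_vector_derivative_diff)
  qed
  have cbound: "\<exists>B. \<forall>h. \<forall>y\<in>cball x \<delta>. \<bar>h\<bar> \<le> \<delta> \<longrightarrow> norm (c k h y) \<le> B" for k
  proof -
    have "bounded (time_derivative \<Psi> k ` cball (0, x) \<delta>2)"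
      by (intro compact_imp_bounded compact_continuous_image compact_cball
          continuous_on_subset[OF smooth_on_continuous_on[OF smooth_on_time_derivative[OF U(2)]] \<delta>2(2)])
    then obtain B1 where B1: "\<forall>q\<in>time_derivative \<Psi> k ` cball (0, x) \<delta>2. norm q \<le> B1"
      unfolding bounded_iff by (rule exE)
    have "bounded (lie g k ` cball x 1)"
      by (intro compact_imp_bounded compact_continuous_image compact_cball
          continuous_on_subset[OF smooth_on_continuous_on[OF smooth_on_lie[OF g]] subset_UNIV])
    then obtain B2 where B2: "\<forall>q\<in>lie g k ` cball x 1. norm q \<le> B2"
      unfolding bounded_iff by (rule exE)
    have "norm (c k h y) \<le> B1 + B2" if "y \<in> cball x \<delta>" "\<bar>h\<bar> \<le> \<delta>" for h y
    proof -
      have "h \<in> {- \<delta>..\<delta>}" using that(2) by (simp add: abs_le_iff)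
      then have "(h, y) \<in> cball (0, x) \<delta>2" using that(1) box by blast
      moreover have "flow g h y \<in> cball x 1" using that \<delta> by (intro \<delta>1(3)) auto
      ultimately show ?thesis
        unfolding c_def
        by (intro order_trans[OF norm_triangle_ineq4] add_mono bspec[OF B1] bspec[OF B2] imageI)
    qed
    then show ?thesis by (intro exI[of _ "B1 + B2"]) simp
  qed
  have taylor: "\<exists>B. \<forall>h. \<forall>y\<in>cball x \<delta>. \<bar>h\<bar> \<le> \<delta> \<longrightarrow>
      norm (\<Phi> g h y - flow g h y - (\<Sum>k<n. h ^ k *\<^sub>R ((1 / fact k) *\<^sub>R c k 0 y))) \<le> B * \<bar>h\<bar> ^ n" for n
  proof -
    obtain B where B: "\<And>h y. y \<in> cball x \<delta> \<Longrightarrow> \<bar>h\<bar> \<le> \<delta> \<Longrightarrow> norm (c n h y) \<le> B" using cbound by blast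
    have "norm (c 0 h y - (\<Sum>k<n. (h ^ k / fact k) *\<^sub>R c k 0 y)) \<le> B * \<bar>h\<bar> ^ n"
      if "y \<in> cball x \<delta>" "\<bar>h\<bar> \<le> \<delta>" for h y
      by (rule taylor_remainder_bound[of n h "\<lambda>k s. c k s y"])
        (use that cderiv B abs_le_of_mem_segment in \<open>force+\<close>)
    moreover have "c 0 h y = \<Phi> g h y - flow g h y" for h y by (simp add: c_def \<Psi>_def)
    ultimately show ?thesis by (intro exI[of _ B]) simp
  qed
  have c0: "c k 0 y = 0" if k: "k < 3" and y: "y \<in> cball x \<delta>" for k y
  proof -
    obtain B where B: "\<And>h. \<bar>h\<bar> \<le> \<delta> \<Longrightarrow>
      norm (\<Phi> g h y - flow g h y - (\<Sum>k<3. h ^ k *\<^sub>R ((1 / fact k) *\<^sub>R c k 0 y))) \<le> B * \<bar>h\<bar> ^ 3"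
      using taylor[of 3] y by blast
    obtain A where A: "\<forall>\<^sub>F h in at 0. norm (\<Phi> g h y - flow g h y) \<le> A * \<bar>h\<bar> ^ 3"
      using assms(2) g unfolding second_order_integrator_def dominated_iff_bigo[symmetric] dominated_def by fastforce
    have "\<forall>\<^sub>F h in at (0::real). \<bar>h\<bar> \<le> \<delta>"
      using eventually_in_cball[of "\<lambda>h. h" 0 "at 0", OF tendsto_ident_at \<delta>(1)] by eventually_elim simp
    with A have "\<forall>\<^sub>F h in at 0. norm (\<Sum>k<3. h ^ k *\<^sub>R ((1 / fact k) *\<^sub>R c k 0 y)) \<le> (A + B) * \<bar>h\<bar> ^ 3"
    proof eventually_elim
      case (elim h)
      from norm_triangle_ineq4[of "\<Phi> g h y - flow g h y" "\<Phi> g h y - flow g h y - (\<Sum>k<3. h ^ k *\<^sub>R ((1 / fact k) *\<^sub>R c k 0 y))"]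
      show ?case using elim(1) B[OF elim(2)] by (simp add: distrib_right)
    qed
    from poly_coeffs_zero_of_small[OF this k] show ?thesis by simp
  qed
  define V where "V = {y. (0, y) \<in> U}"
  define d e where "d = (\<lambda>y. (1 / fact 3) *\<^sub>R c 3 0 y)" and "e = (\<lambda>y. (1 / fact 4) *\<^sub>R c 4 0 y)"
  have smooth: "smooth_on V (\<lambda>y. q *\<^sub>R c k 0 y)" for k and q :: real
  proof -
    have o: "open V" using smooth_on_slice[OF U(2), of 0] by (simp add: V_def smooth_on_def)
    show ?thesis
      unfolding c_def flow_0[OF g] V_def
      by (intro smooth_on_scaleR smooth_on_const smooth_on_diff smooth_on_slice smooth_on_time_derivative U(2)
          smooth_on_subset[OF smooth_on_lie[OF g]] o[unfolded V_def]) auto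
  qed
  obtain B where B: "\<And>h y. y \<in> cball x \<delta> \<Longrightarrow> \<bar>h\<bar> \<le> \<delta> \<Longrightarrow>
      norm (\<Phi> g h y - flow g h y - (\<Sum>k<5. h ^ k *\<^sub>R ((1 / fact k) *\<^sub>R c k 0 y))) \<le> B * \<bar>h\<bar> ^ 5"
    using taylor[of 5] by blast
  have sum5: "(\<Sum>k<5. h ^ k *\<^sub>R ((1 / fact k) *\<^sub>R c k 0 y)) = h ^ 3 *\<^sub>R d y + h ^ 4 *\<^sub>R e y"
    if "y \<in> cball x \<delta>" for h y
  proof -
    have "{..<5} = {0,1,2,3,4::nat}" by auto
    then show ?thesis using c0[of _ y] that by (simp add: d_def e_def del: mem_cball)
  qed
  show ?thesis
  proof (rule exI[of _ V], rule exI[of _ d], rule exI[of _ e], intro conjI)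
    show "x \<in> V" using U(1) by (simp add: V_def)
    show "smooth_on V d" "smooth_on V e" unfolding d_def e_def by (rule smooth)+
    show "\<exists>\<delta>>0. \<exists>C. \<forall>h. \<forall>y\<in>cball x \<delta>. \<bar>h\<bar> \<le> \<delta> \<longrightarrow>
        norm (\<Phi> g h y - flow g h y - h ^ 3 *\<^sub>R d y - h ^ 4 *\<^sub>R e y) \<le> C * \<bar>h\<bar> ^ 5"
    proof (rule exI[of _ \<delta>], rule conjI[OF \<delta>(1)], rule exI[of _ B], intro allI ballI impI)
      fix h y assume "y \<in> cball x \<delta>" "\<bar>h\<bar> \<le> \<delta>"
      with B sum5 show "norm (\<Phi> g h y - flow g h y - h ^ 3 *\<^sub>R d y - h ^ 4 *\<^sub>R e y) \<le> B * \<bar>h\<bar> ^ 5"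
        by (simp add: diff_diff_eq add.assoc del: mem_cball)
    qed
  qed
qed

section \<open>One factor of the composition\<close>

text \<open>
  All estimates below are along families \<open>\<tau> p\<close>, \<open>\<epsilon> p\<close>, \<open>Y p\<close> tending to \<open>0\<close>, \<open>0\<close>, \<open>x\<close>; composing maps then
  needs no bookkeeping of domains, and constants are uniform in \<open>(\<tau>, \<epsilon>, y)\<close> near \<open>(0, 0, x)\<close>.
\<close>

lemma flow_step:
  fixes f :: "'v::euclidean_space \<Rightarrow> 'v" and \<tau> \<epsilon> c :: "'p \<Rightarrow> real"
  assumes f: "smooth_on UNIV f" and \<tau>: "(\<tau> \<longlongrightarrow> 0) F" and \<epsilon>: "(\<epsilon> \<longlongrightarrow> 0) F" and c: "(c \<longlongrightarrow> c0) F"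
    and Y: "(Y \<longlongrightarrow> x) F" and W: "(W \<longlongrightarrow> W0) F" and D: "(D \<longlongrightarrow> D0) F" and H: "(H \<longlongrightarrow> H0) F"
    and S: "dominated F (\<lambda>p. S p - Y p - \<tau> p *\<^sub>R W p) (\<lambda>p. \<tau> p ^ 2)"
    and E: "dominated F (\<lambda>p. S p - R p - (\<epsilon> p * \<tau> p) ^ 3 *\<^sub>R (\<beta> *\<^sub>R D p + \<tau> p *\<^sub>R H p)) (\<lambda>p. \<epsilon> p ^ 3 * \<tau> p ^ 5)"
  shows "dominated F (\<lambda>p. S p - R p) (\<lambda>p. \<epsilon> p ^ 3 * \<tau> p ^ 3)"
    and "dominated F (\<lambda>p. S p - Y p) \<tau>"
    and "(S \<longlongrightarrow> x) F" and "(R \<longlongrightarrow> x) F"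
    and "dominated F (\<lambda>p. flow f (c p * \<tau> p) (S p) - Y p - \<tau> p *\<^sub>R (W p + c p *\<^sub>R f (Y p))) (\<lambda>p. \<tau> p ^ 2)"
    and "dominated F (\<lambda>p. flow f (c p * \<tau> p) (S p) - flow f (c p * \<tau> p) (R p) - (\<epsilon> p * \<tau> p) ^ 3 *\<^sub>R
      (\<beta> *\<^sub>R D p + \<tau> p *\<^sub>R (H p + (\<beta> * c p) *\<^sub>R frechet_derivative f (at (Y p)) (D p)))) (\<lambda>p. \<epsilon> p ^ 3 * \<tau> p ^ 5)"
proof -
  \<comment> \<open>With \<open>m i j\<close> for \<open>\<epsilon>^i \<tau>^j\<close>, multiplying
    bounds becomes adding exponents, and \<open>mono\<close> discards surplus powers.\<close>
  define m where "m i j p = \<epsilon> p ^ i * \<tau> p ^ j" for i j p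
  have mono: "dominated F (m i j) (m i' j')" if "i' \<le> i" "j' \<le> j" for i j i' j'
    unfolding m_def [abs_def] using dominated_power_mono[OF \<epsilon> \<tau> that] .
  have mm: "m i j p * m k l p = m (i + k) (j + l) p" for i j k l p
    by (simp add: m_def power_add mult_ac)
  have m33: "(\<lambda>p. \<epsilon> p ^ 3 * \<tau> p ^ 3) = m 3 3" "(\<lambda>p. \<epsilon> p ^ 3 * \<tau> p ^ 5) = m 3 5" "(\<lambda>p. \<tau> p ^ 2) = m 0 2"
    and m01: "\<tau> = m 0 1"
    by (auto simp: m_def)
  have S': "dominated F (\<lambda>p. S p - Y p - \<tau> p *\<^sub>R W p) (m 0 2)" using S m33 by simp
  have E': "dominated F (\<lambda>p. S p - R p - (\<epsilon> p * \<tau> p) ^ 3 *\<^sub>R (\<beta> *\<^sub>R D p + \<tau> p *\<^sub>R H p)) (m 3 5)" using E m33 by simp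
  have d\<tau>: "dominated F \<tau> (m 0 1)" unfolding m01[symmetric] by (rule dominated_refl)
  have mul: "dominated F (\<lambda>p. a p *\<^sub>R g p) (m (i + k) (j + l))"
    if "dominated F a (m i j)" "dominated F g (m k l)" for a :: "'p \<Rightarrow> real" and g :: "'p \<Rightarrow> 'v" and i j k l
    using dominated_scaleR[OF that] by (simp add: mm)
  have bd: "dominated F g (m 0 0)" if "(g \<longlongrightarrow> l) F" for g :: "'p \<Rightarrow> 'a::real_normed_vector" and l
    using tendsto_imp_dominated_1[OF that] by (simp add: m_def [abs_def])
  have d3: "dominated F (\<lambda>p. (\<epsilon> p * \<tau> p) ^ 3) (m 3 3)"
    by (rule dominated_trans[OF dominated_refl]) (simp add: power_mult_distrib dominated_refl m33(1)[symmetric])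
  have dc: "dominated F (\<lambda>p. c p * \<tau> p) (m 0 1)"
    using dominated_mult[OF bd[OF c] d\<tau>] by (simp add: mm)
  have dH: "dominated F (\<lambda>p. (\<epsilon> p * \<tau> p) ^ 3 *\<^sub>R (\<tau> p *\<^sub>R H p)) (m 3 4)"
    using mul[OF d3 mul[OF d\<tau> bd[OF H]]] by simp
  have dD: "dominated F (\<lambda>p. (\<epsilon> p * \<tau> p) ^ 3 *\<^sub>R (\<beta> *\<^sub>R D p)) (m 3 3)"
    using mul[OF d3 bd[OF tendsto_scaleR[OF tendsto_const D]]] by simp
  have E34: "dominated F (\<lambda>p. S p - R p - (\<epsilon> p * \<tau> p) ^ 3 *\<^sub>R (\<beta> *\<^sub>R D p)) (m 3 4)"
    using dominated_add[OF dominated_trans[OF E' mono] dH] by (simp add: algebra_simps)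
  have E33: "dominated F (\<lambda>p. S p - R p) (m 3 3)"
    using dominated_add[OF dominated_trans[OF E34 mono] dD] by simp
  then show "dominated F (\<lambda>p. S p - R p) (\<lambda>p. \<epsilon> p ^ 3 * \<tau> p ^ 3)" by (simp add: m33)
  have SY: "dominated F (\<lambda>p. S p - Y p) (m 0 1)"
  proof -
    have "dominated F (\<lambda>p. \<tau> p *\<^sub>R W p) (m 0 1)" using mul[OF d\<tau> bd[OF W]] by simp
    from dominated_add[OF dominated_trans[OF S' mono] this] show ?thesis by simp
  qed
  then show "dominated F (\<lambda>p. S p - Y p) \<tau>" by (simp only: m01[symmetric])
  have RY: "dominated F (\<lambda>p. R p - Y p) (m 0 1)"
    using dominated_diff[OF SY dominated_trans[OF E33 mono]] by simp
  have lim: "(U \<longlongrightarrow> x) F" if "dominated F (\<lambda>p. U p - Y p) (m 0 1)" for U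
    using tendsto_add[OF dominated_tendsto_0[OF that] Y] \<tau> by (simp add: m01)
  show Sx: "(S \<longlongrightarrow> x) F" and Rx: "(R \<longlongrightarrow> x) F" using lim SY RY by auto
  have c\<tau>: "((\<lambda>p. c p * \<tau> p) \<longlongrightarrow> 0) F" using tendsto_mult[OF c \<tau>] by simp
  have nrm: "dominated F (\<lambda>p. norm (U p)) g" if "dominated F U g" for U :: "'p \<Rightarrow> 'v" and g
    using that by (simp add: dominated_norm_iff)
  have dc2: "dominated F (\<lambda>p. (c p * \<tau> p)\<^sup>2) (m 0 2)"
    using dominated_mult[OF dc dc] by (simp add: mm power2_eq_square numeral_2_eq_2)
  have "dominated F (\<lambda>p. (flow f (c p * \<tau> p) (S p) - S p - (c p * \<tau> p) *\<^sub>R f (S p)) + (S p - Y p - \<tau> p *\<^sub>R W p)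
      + (c p * \<tau> p) *\<^sub>R (f (S p) - f (Y p))) (m 0 2)"
  proof (intro dominated_add S')
    show "dominated F (\<lambda>p. flow f (c p * \<tau> p) (S p) - S p - (c p * \<tau> p) *\<^sub>R f (S p)) (m 0 2)"
      by (rule dominated_trans[OF dominated_flow_expansion(1)[OF f c\<tau> Sx Sx] dc2])
    show "dominated F (\<lambda>p. (c p * \<tau> p) *\<^sub>R (f (S p) - f (Y p))) (m 0 2)"
      using mul[OF dc dominated_trans[OF dominated_smooth_diff[OF f UNIV_I Sx Y] nrm[OF SY]]]
      by (simp add: numeral_2_eq_2)
  qed
  then show "dominated F (\<lambda>p. flow f (c p * \<tau> p) (S p) - Y p - \<tau> p *\<^sub>R (W p + c p *\<^sub>R f (Y p))) (\<lambda>p. \<tau> p ^ 2)"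
    by (simp add: m33 algebra_simps)
  let ?f' = "\<lambda>p. frechet_derivative f (at (Y p))"
  have lin: "linear (?f' p)" for p using smooth_on_linear_frechet[OF f] by simp
  \<comment> \<open>Four sources of error, each of size \<open>\<epsilon>^3 \<tau>^5\<close>: the
    second-order part of the flow acting on a difference of size
    \<open>\<epsilon>^3 \<tau>^3\<close>; linearization of \<open>f\<close> at \<open>Y\<close>
    rather than between \<open>R\<close> and \<open>S\<close>; the derivative applied to what
    exceeds the leading discrepancy; and the remainder present before the step.\<close>
  let ?A = "\<lambda>p. flow f (c p * \<tau> p) (S p) - flow f (c p * \<tau> p) (R p) - (S p - R p) - (c p * \<tau> p) *\<^sub>R (f (S p) - f (R p))"
  let ?B = "\<lambda>p. (c p * \<tau> p) *\<^sub>R (f (S p) - f (R p) - ?f' p (S p - R p))"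
  let ?C = "\<lambda>p. (c p * \<tau> p) *\<^sub>R ?f' p (S p - R p - (\<epsilon> p * \<tau> p) ^ 3 *\<^sub>R (\<beta> *\<^sub>R D p))"
  let ?E = "\<lambda>p. S p - R p - (\<epsilon> p * \<tau> p) ^ 3 *\<^sub>R (\<beta> *\<^sub>R D p + \<tau> p *\<^sub>R H p)"
  have "dominated F (\<lambda>p. ?A p + ?B p + ?C p + ?E p) (m 3 5)"
  proof (intro dominated_add E')
    have "dominated F (\<lambda>p. (c p * \<tau> p)\<^sup>2 * norm (S p - R p)) (m 3 5)"
      using dominated_mult[OF dc2 nrm[OF E33]] by (simp add: mm)
    then show "dominated F ?A (m 3 5)"
      by (rule dominated_trans[OF dominated_flow_expansion(2)[OF f c\<tau> Sx Rx]])
    have "dominated F (\<lambda>p. norm (S p - R p) * (norm (S p - Y p) + norm (R p - Y p))) (m 3 4)"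
      using dominated_mult[OF nrm[OF E33] dominated_add[OF nrm[OF SY] nrm[OF RY]]] by (simp add: mm)
    then have "dominated F (\<lambda>p. f (S p) - f (R p) - ?f' p (S p - R p)) (m 3 4)"
      by (rule dominated_trans[OF dominated_smooth_linearization[OF f UNIV_I Sx Rx Y]])
    from mul[OF dc this] show "dominated F ?B (m 3 5)" by simp
    have "dominated F (\<lambda>p. ?f' p (S p - R p - (\<epsilon> p * \<tau> p) ^ 3 *\<^sub>R (\<beta> *\<^sub>R D p))) (m 3 4)"
      by (rule dominated_trans[OF dominated_frechet_derivative[OF f UNIV_I Y] nrm[OF E34]])
    from mul[OF dc this] show "dominated F ?C (m 3 5)" by simp
  qed
  moreover have "?A p + ?B p + ?C p + ?E p = flow f (c p * \<tau> p) (S p) - flow f (c p * \<tau> p) (R p) - (\<epsilon> p * \<tau> p) ^ 3 *\<^sub>R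
      (\<beta> *\<^sub>R D p + \<tau> p *\<^sub>R (H p + (\<beta> * c p) *\<^sub>R ?f' p (D p)))" for p
    unfolding linear_diff[OF lin, of _ "S p - R p"] linear_scale[OF lin] by (simp add: algebra_simps)
  ultimately show "dominated F (\<lambda>p. flow f (c p * \<tau> p) (S p) - flow f (c p * \<tau> p) (R p) - (\<epsilon> p * \<tau> p) ^ 3 *\<^sub>R
      (\<beta> *\<^sub>R D p + \<tau> p *\<^sub>R (H p + (\<beta> * c p) *\<^sub>R ?f' p (D p)))) (\<lambda>p. \<epsilon> p ^ 3 * \<tau> p ^ 5)"
    by (simp only: m33)
qed

text \<open>\<open>N\<close> stands for integrator minus flow, evaluated at the iterate
  \<open>S = Y + \<tau> W + O(\<tau>^2)\<close> with step \<open>h = b \<epsilon> \<tau>\<close>.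
  Moving the argument of \<open>h^3 d\<close> to \<open>Y\<close> produces the derivative of
  \<open>d\<close> along the drift; \<open>h^4 e\<close> enters with an additional \<epsilon>
  because \<open>h^4 = (\<epsilon> \<tau>)^3 \<tau> b^4 \<epsilon>\<close>. The first, coarser bound
  says that the drift is the same for integrator and flow.\<close>

lemma perturbation_step:
  fixes N :: "real \<Rightarrow> 'v::euclidean_space \<Rightarrow> 'v" and \<tau> \<epsilon> :: "'p \<Rightarrow> real"
  assumes \<tau>: "(\<tau> \<longlongrightarrow> 0) F" and \<epsilon>: "(\<epsilon> \<longlongrightarrow> 0) F"
    and Y: "(Y \<longlongrightarrow> x) F" and W: "(W \<longlongrightarrow> W0) F"
    and d: "smooth_on V d" and e: "smooth_on V e" and x: "x \<in> V"
    and \<delta>: "\<delta> > 0" and N: "\<And>h y. y \<in> cball x \<delta> \<Longrightarrow> \<bar>h\<bar> \<le> \<delta> \<Longrightarrow> norm (N h y - h ^ 3 *\<^sub>R d y - h ^ 4 *\<^sub>R e y) \<le> C * \<bar>h\<bar> ^ 5"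
    and S: "dominated F (\<lambda>p. S p - Y p - \<tau> p *\<^sub>R W p) (\<lambda>p. \<tau> p ^ 2)"
  shows "dominated F (\<lambda>p. N (b * \<epsilon> p * \<tau> p) (S p)) (\<lambda>p. \<tau> p ^ 2)"
    and "dominated F (\<lambda>p. N (b * \<epsilon> p * \<tau> p) (S p) - (\<epsilon> p * \<tau> p) ^ 3 *\<^sub>R
      (b ^ 3 *\<^sub>R d (Y p) + \<tau> p *\<^sub>R (b ^ 3 *\<^sub>R frechet_derivative d (at (Y p)) (W p) + (b ^ 4 * \<epsilon> p) *\<^sub>R e (Y p))))
    (\<lambda>p. \<epsilon> p ^ 3 * \<tau> p ^ 5)"
proof -
  define m where "m i j p = \<epsilon> p ^ i * \<tau> p ^ j" for i j p
  have mono: "dominated F (m i j) (m i' j')" if "i' \<le> i" "j' \<le> j" for i j i' j'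
    unfolding m_def [abs_def] using dominated_power_mono[OF \<epsilon> \<tau> that] .
  have mm: "m i j p * m k l p = m (i + k) (j + l) p" for i j k l p
    by (simp add: m_def power_add mult_ac)
  have m35: "(\<lambda>p. \<epsilon> p ^ 3 * \<tau> p ^ 5) = m 3 5" "(\<lambda>p. \<tau> p ^ 2) = m 0 2"
    and m01: "\<tau> = m 0 1"
    by (auto simp: m_def)
  have S': "dominated F (\<lambda>p. S p - Y p - \<tau> p *\<^sub>R W p) (m 0 2)" using S m35 by simp
  have d\<tau>: "dominated F \<tau> (m 0 1)" unfolding m01[symmetric] by (rule dominated_refl)
  have mul: "dominated F (\<lambda>p. a p *\<^sub>R g p) (m (i + k) (j + l))"
    if "dominated F a (m i j)" "dominated F g (m k l)" for a :: "'p \<Rightarrow> real" and g :: "'p \<Rightarrow> 'v" and i j k l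
    using dominated_scaleR[OF that] by (simp add: mm)
  have bd: "dominated F g (m 0 0)" if "(g \<longlongrightarrow> l) F" for g :: "'p \<Rightarrow> 'a::real_normed_vector" and l
    using tendsto_imp_dominated_1[OF that] by (simp add: m_def [abs_def])
  have SY: "dominated F (\<lambda>p. S p - Y p) (m 0 1)"
  proof -
    have "dominated F (\<lambda>p. \<tau> p *\<^sub>R W p) (m 0 1)" using mul[OF d\<tau> bd[OF W]] by simp
    from dominated_add[OF dominated_trans[OF S' mono] this] show ?thesis by simp
  qed
  have Sx: "(S \<longlongrightarrow> x) F"
    using tendsto_add[OF dominated_tendsto_0[OF SY] Y] \<tau> by (simp add: m01)
  have nrm: "dominated F (\<lambda>p. norm (U p)) g" if "dominated F U g" for U :: "'p \<Rightarrow> 'v" and g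
    using that by (simp add: dominated_norm_iff)
  define h where "h p = b * \<epsilon> p * \<tau> p" for p
  have hk: "dominated F (\<lambda>p. h p ^ k) (m k k)" for k
  proof -
    have "(\<lambda>p. h p ^ k) = (\<lambda>p. b ^ k * m k k p)" by (simp add: h_def m_def power_mult_distrib mult_ac)
    then show ?thesis
      using dominated_mult[OF bd[OF tendsto_const, of "b ^ k"] dominated_refl[of F "m k k"]] by (simp add: mm)
  qed
  have h0: "(h \<longlongrightarrow> 0) F" using tendsto_mult[OF tendsto_mult[OF tendsto_const \<epsilon>] \<tau>, of b] by (simp add: h_def [abs_def])
  let ?d' = "\<lambda>p. frechet_derivative d (at (Y p))"
  let ?A = "\<lambda>p. N (h p) (S p) - h p ^ 3 *\<^sub>R d (S p) - h p ^ 4 *\<^sub>R e (S p)"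
  let ?B = "\<lambda>p. h p ^ 3 *\<^sub>R (d (S p) - d (Y p) - ?d' p (S p - Y p))"
  let ?C = "\<lambda>p. h p ^ 3 *\<^sub>R ?d' p (S p - Y p - \<tau> p *\<^sub>R W p)"
  let ?D = "\<lambda>p. h p ^ 4 *\<^sub>R (e (S p) - e (Y p))"
  have "dominated F (\<lambda>p. ?A p + ?B p + ?C p + ?D p) (m 3 5)"
  proof (intro dominated_add)
    have "\<forall>\<^sub>F p in F. norm (?A p) \<le> C * \<bar>h p ^ 5\<bar>"
      using eventually_in_cball[OF Sx \<delta>] eventually_in_cball[OF h0 \<delta>]
    proof eventually_elim
      case (elim p)
      then show ?case using N[OF elim(1), of "h p"] by (simp add: power_abs)
    qed
    then have "dominated F ?A (\<lambda>p. h p ^ 5)" by (rule dominatedI)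
    then show "dominated F ?A (m 3 5)"
      by (rule dominated_trans[OF dominated_trans[OF _ hk] mono]) auto
    have "dominated F (\<lambda>p. norm (S p - Y p) * (norm (S p - Y p) + norm (Y p - Y p))) (m 0 2)"
      using dominated_mult[OF nrm[OF SY] nrm[OF SY]] by (simp add: mm numeral_2_eq_2)
    then have "dominated F (\<lambda>p. d (S p) - d (Y p) - ?d' p (S p - Y p)) (m 0 2)"
      by (rule dominated_trans[OF dominated_smooth_linearization[OF d x Sx Y Y]])
    from mul[OF hk this, of 3] show "dominated F ?B (m 3 5)" by simp
    have "dominated F (\<lambda>p. ?d' p (S p - Y p - \<tau> p *\<^sub>R W p)) (m 0 2)"
      by (rule dominated_trans[OF dominated_frechet_derivative[OF d x Y] nrm[OF S']])
    from mul[OF hk this, of 3] show "dominated F ?C (m 3 5)" by simp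
    have "dominated F (\<lambda>p. e (S p) - e (Y p)) (m 0 1)"
      by (rule dominated_trans[OF dominated_smooth_diff[OF e x Sx Y] nrm[OF SY]])
    from mul[OF hk this, of 4] show "dominated F ?D (m 3 5)"
      by (rule dominated_trans[OF _ mono]) auto
  qed
  \<comment> \<open>\<open>d\<close> is smooth only on \<open>V\<close>, so linearity of its
    derivative at \<open>Y p\<close> is available once \<open>Y p\<close> lies in \<open>V\<close>;
    hence the identity is claimed eventually rather than everywhere.\<close>
  moreover have "\<forall>\<^sub>F p in F. ?A p + ?B p + ?C p + ?D p = N (b * \<epsilon> p * \<tau> p) (S p) - (\<epsilon> p * \<tau> p) ^ 3 *\<^sub>R
      (b ^ 3 *\<^sub>R d (Y p) + \<tau> p *\<^sub>R (b ^ 3 *\<^sub>R ?d' p (W p) + (b ^ 4 * \<epsilon> p) *\<^sub>R e (Y p)))"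
    using eventually_in_open[OF d x Y]
  proof eventually_elim
    case (elim p)
    have lin: "linear (?d' p)" using smooth_on_linear_frechet[OF d elim] .
    have h3: "h p ^ 3 = (\<epsilon> p * \<tau> p) ^ 3 * b ^ 3" and h4: "h p ^ 4 = (\<epsilon> p * \<tau> p) ^ 3 * (\<tau> p * (b ^ 4 * \<epsilon> p))"
      by (simp_all add: h_def power_mult_distrib eval_nat_numeral)
    have "?A p + ?B p + ?C p + ?D p = N (h p) (S p) - h p ^ 3 *\<^sub>R (d (Y p) + \<tau> p *\<^sub>R ?d' p (W p)) - h p ^ 4 *\<^sub>R e (Y p)"
      unfolding linear_diff[OF lin, of _ "\<tau> p *\<^sub>R W p"] linear_scale[OF lin] by (simp add: algebra_simps)
    also have "\<dots> = N (b * \<epsilon> p * \<tau> p) (S p) - (\<epsilon> p * \<tau> p) ^ 3 *\<^sub>R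
      (b ^ 3 *\<^sub>R d (Y p) + \<tau> p *\<^sub>R (b ^ 3 *\<^sub>R ?d' p (W p) + (b ^ 4 * \<epsilon> p) *\<^sub>R e (Y p)))"
      unfolding h3 h4 unfolding h_def by (simp add: algebra_simps)
    finally show ?case .
  qed
  ultimately have main: "dominated F (\<lambda>p. N (b * \<epsilon> p * \<tau> p) (S p) - (\<epsilon> p * \<tau> p) ^ 3 *\<^sub>R
      (b ^ 3 *\<^sub>R d (Y p) + \<tau> p *\<^sub>R (b ^ 3 *\<^sub>R ?d' p (W p) + (b ^ 4 * \<epsilon> p) *\<^sub>R e (Y p)))) (m 3 5)"
    by (rule dominated_eventually_eq[rotated])
  then show "dominated F (\<lambda>p. N (b * \<epsilon> p * \<tau> p) (S p) - (\<epsilon> p * \<tau> p) ^ 3 *\<^sub>R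
      (b ^ 3 *\<^sub>R d (Y p) + \<tau> p *\<^sub>R (b ^ 3 *\<^sub>R ?d' p (W p) + (b ^ 4 * \<epsilon> p) *\<^sub>R e (Y p)))) (\<lambda>p. \<epsilon> p ^ 3 * \<tau> p ^ 5)"
    by (simp only: m35)
  have "(\<lambda>p. (\<epsilon> p * \<tau> p) ^ 3) = m 3 3" by (simp add: fun_eq_iff m_def power_mult_distrib)
  then have "dominated F (\<lambda>p. (\<epsilon> p * \<tau> p) ^ 3) (m 3 3)" by (simp add: dominated_refl)
  from mul[OF this bd[OF tendsto_add[OF tendsto_scaleR[OF tendsto_const smooth_on_tendsto[OF d x Y]]
    tendsto_scaleR[OF \<tau> tendsto_add[OF tendsto_scaleR[OF tendsto_const frechet_derivative_tendsto[OF d x Y W]]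
      tendsto_scaleR[OF tendsto_mult[OF tendsto_const \<epsilon>] smooth_on_tendsto[OF e x Y]]]]]]]
  have "dominated F (\<lambda>p. (\<epsilon> p * \<tau> p) ^ 3 *\<^sub>R
      (b ^ 3 *\<^sub>R d (Y p) + \<tau> p *\<^sub>R (b ^ 3 *\<^sub>R ?d' p (W p) + (b ^ 4 * \<epsilon> p) *\<^sub>R e (Y p)))) (m 3 3)" by simp
  from dominated_add[OF dominated_trans[OF main mono] dominated_trans[OF this mono], of 0 2]
  show "dominated F (\<lambda>p. N (b * \<epsilon> p * \<tau> p) (S p)) (\<lambda>p. \<tau> p ^ 2)"
    unfolding m35(2) by simp
qed

section \<open>Expansion of the perturbed splitting\<close>

lemma eventually_flow_solves:
  fixes f :: "'v::euclidean_space \<Rightarrow> 'v"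
  assumes "smooth_on UNIV f" "(t \<longlongrightarrow> 0) F" "(U \<longlongrightarrow> x) F"
  shows "\<forall>\<^sub>F p in F. solves f (\<lambda>s. flow f s (U p)) (t p)"
proof -
  obtain \<delta> where \<delta>: "\<delta> > 0" "\<And>t y. \<bar>t\<bar> \<le> \<delta> \<Longrightarrow> y \<in> cball x \<delta> \<Longrightarrow> solves f (\<lambda>s. flow f s y) t"
    using flow_local[OF assms(1), of x] by blast
  show ?thesis
    using eventually_in_cball[OF assms(2) \<delta>(1)] eventually_in_cball[OF assms(3) \<delta>(1)]
    by eventually_elim (rule \<delta>(2), simp_all)
qed

lemma flow_tendsto:
  fixes f :: "'v::euclidean_space \<Rightarrow> 'v"
  assumes f: "smooth_on UNIV f" and t: "(t \<longlongrightarrow> 0) F" and U: "(U \<longlongrightarrow> x) F"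
  shows "((\<lambda>p. flow f (t p) (U p)) \<longlongrightarrow> x) F"
proof -
  have "((\<lambda>p. (t p)\<^sup>2) \<longlongrightarrow> 0) F" using tendsto_power[OF t, of 2] by simp
  from tendsto_add[OF tendsto_add[OF dominated_tendsto_0[OF dominated_flow_expansion(1)[OF f t U U] this]
      tendsto_scaleR[OF t smooth_on_tendsto[OF f UNIV_I U]]] U]
  show ?thesis by simp
qed

lemma dominated_flow_diff:
  fixes f :: "'v::euclidean_space \<Rightarrow> 'v"
  assumes f: "smooth_on UNIV f" and t: "(t \<longlongrightarrow> 0) F" and U: "(U \<longlongrightarrow> x) F" and V: "(V \<longlongrightarrow> x) F"
  shows "dominated F (\<lambda>p. flow f (t p) (U p) - flow f (t p) (V p) - (U p - V p)) (\<lambda>p. t p * norm (U p - V p))"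
proof -
  have "dominated F (\<lambda>p. (t p * t p) * norm (U p - V p)) (\<lambda>p. (1 * t p) * norm (U p - V p))"
    by (intro dominated_mult dominated_refl tendsto_imp_dominated_1[OF t])
  then have "dominated F (\<lambda>p. (t p)\<^sup>2 * norm (U p - V p)) (\<lambda>p. t p * norm (U p - V p))"
    by (simp add: power2_eq_square)
  from dominated_add[OF dominated_trans[OF dominated_flow_expansion(2)[OF f t U V] this]
      dominated_scaleR[OF dominated_refl dominated_smooth_diff[OF f UNIV_I U V], of t]]
  show ?thesis by simp
qed

lemma eventually_flow_scaleR_field:
  fixes f :: "'v::euclidean_space \<Rightarrow> 'v"
  assumes "smooth_on UNIV f" "(t \<longlongrightarrow> 0) F" "(c \<longlongrightarrow> 0) F" "(U \<longlongrightarrow> x) F"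
  shows "\<forall>\<^sub>F p in F. flow (\<lambda>z. c p *\<^sub>R f z) (t p) (U p) = flow f (t p * c p) (U p)"
proof -
  have "((\<lambda>p. t p * c p) \<longlongrightarrow> 0) F" using tendsto_mult[OF assms(2,3)] by simp
  from eventually_flow_solves[OF assms(1) this assms(4)]
  show ?thesis by eventually_elim (rule flow_scaleR_field[OF assms(1)])
qed

lemma eventually_flow_minus_flow:
  fixes f :: "'v::euclidean_space \<Rightarrow> 'v"
  assumes "smooth_on UNIV f" "(t \<longlongrightarrow> 0) F" "(U \<longlongrightarrow> x) F"
  shows "\<forall>\<^sub>F p in F. flow f (- t p) (flow f (t p) (U p)) = U p"
  using eventually_flow_solves[OF assms] by eventually_elim (rule flow_minus_flow[OF assms(1)])

text \<open>The recursion of \<open>splitting\<close> peels the factors applied last, whereas in a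
  step forward followed by a step back the cancellation happens at the junction: the outer
  composition must release the factors that it applies first.\<close>

lemma splitting_Suc_left:
  "splitting P Q a b (Suc s) t
    = splitting P Q (\<lambda>i. a (Suc i)) (\<lambda>i. b (Suc i)) s t \<circ> Q (b 1 * t) \<circ> P (a 1 * t)"
proof (induction s)
  case 0
  show ?case by (simp add: o_assoc)
next
  case (Suc s)
  show ?case by (subst splitting.simps(2), subst Suc) (simp add: o_assoc)
qed

lemma splitting_tendsto:
  assumes P: "\<And>t U. (t \<longlongrightarrow> 0) F \<Longrightarrow> (U \<longlongrightarrow> x) F \<Longrightarrow> ((\<lambda>p. P (t p) (U p)) \<longlongrightarrow> x) F"
    and Q: "\<And>t U. (t \<longlongrightarrow> 0) F \<Longrightarrow> (U \<longlongrightarrow> x) F \<Longrightarrow> ((\<lambda>p. Q p (t p) (U p)) \<longlongrightarrow> x) F"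
    and \<tau>: "(\<tau> \<longlongrightarrow> 0) F" and U: "(U \<longlongrightarrow> x) F"
  shows "((\<lambda>p. splitting P (Q p) a b s (\<tau> p) (U p)) \<longlongrightarrow> x) F"
proof (induction s)
  case 0
  show ?case using P[OF tendsto_mult_right_zero[OF \<tau>] U] by simp
next
  case (Suc s)
  show ?case
    using P[OF tendsto_mult_right_zero[OF \<tau>] Q[OF tendsto_mult_right_zero[OF \<tau>] Suc]] by simp
qed

text \<open>Stripping the adjoining factors removes the end of one coefficient sequence and the
  start of the other, which destroys a palindrome. The induction therefore runs over two sequences,
  each the reverse of the other; the inner one stays fixed and the outer one is shifted.
  \<open>Q\<close> depends on \<open>p\<close> because the field does, through \<epsilon>.\<close>

lemma splitting_inverse:
  fixes x :: "'v::topological_space" and \<tau> :: "'p \<Rightarrow> real"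
  assumes P: "\<And>t U. (t \<longlongrightarrow> 0) F \<Longrightarrow> (U \<longlongrightarrow> x) F \<Longrightarrow> ((\<lambda>p. P (t p) (U p)) \<longlongrightarrow> x) F"
    and Q: "\<And>t U. (t \<longlongrightarrow> 0) F \<Longrightarrow> (U \<longlongrightarrow> x) F \<Longrightarrow> ((\<lambda>p. Q p (t p) (U p)) \<longlongrightarrow> x) F"
    and Pc: "\<And>t U. (t \<longlongrightarrow> 0) F \<Longrightarrow> (U \<longlongrightarrow> x) F \<Longrightarrow> \<forall>\<^sub>F p in F. P (- t p) (P (t p) (U p)) = U p"
    and Qc: "\<And>t U. (t \<longlongrightarrow> 0) F \<Longrightarrow> (U \<longlongrightarrow> x) F \<Longrightarrow> \<forall>\<^sub>F p in F. Q p (- t p) (Q p (t p) (U p)) = U p"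
    and \<tau>: "(\<tau> \<longlongrightarrow> 0) F" and U: "(U \<longlongrightarrow> x) F"
    and "\<forall>i\<in>{1..s + 1}. a' (s + 2 - i) = a i" "\<forall>i\<in>{1..s}. b' (s + 1 - i) = b i"
  shows "\<forall>\<^sub>F p in F. splitting P (Q p) a b s (- \<tau> p) (splitting P (Q p) a' b' s (\<tau> p) (U p)) = U p"
  using assms(7,8)
proof (induction s arbitrary: a b)
  case 0
  then show ?case using Pc[OF tendsto_mult_right_zero[OF \<tau>] U, of "a 1"] by simp
next
  case (Suc s)
  define Z where "Z p = splitting P (Q p) a' b' s (\<tau> p) (U p)" for p
  have Z: "(Z \<longlongrightarrow> x) F" unfolding Z_def [abs_def] by (rule splitting_tendsto[OF P Q \<tau> U])
  have ab: "a' (s + 2) = a 1" "b' (s + 1) = b 1"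
    using Suc.prems(1)[rule_format, of 1] Suc.prems(2)[rule_format, of 1] by auto
  have "\<forall>\<^sub>F p in F. splitting P (Q p) (\<lambda>i. a (Suc i)) (\<lambda>i. b (Suc i)) s (- \<tau> p) (Z p) = U p"
    unfolding Z_def
  proof (rule Suc.IH)
    show "\<forall>i\<in>{1..s + 1}. a' (s + 2 - i) = a (Suc i)"
    proof
      fix i assume "i \<in> {1..s + 1}"
      then show "a' (s + 2 - i) = a (Suc i)" using Suc.prems(1)[rule_format, of "Suc i"] by simp
    qed
    show "\<forall>i\<in>{1..s}. b' (s + 1 - i) = b (Suc i)"
    proof
      fix i assume "i \<in> {1..s}"
      then show "b' (s + 1 - i) = b (Suc i)" using Suc.prems(2)[rule_format, of "Suc i"] by simp
    qed
  qed
  moreover note Qc[OF tendsto_mult_right_zero[OF \<tau>, of "b 1"] Z]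
  moreover note Pc[OF tendsto_mult_right_zero[OF \<tau>, of "a 1"] Q[OF tendsto_mult_right_zero[OF \<tau>, of "b 1"] Z]]
  ultimately show ?case
  proof eventually_elim
    case (elim p)
    have "splitting P (Q p) a' b' (Suc s) (\<tau> p) (U p) = P (a 1 * \<tau> p) (Q p (b 1 * \<tau> p) (Z p))"
      using ab by (simp add: Z_def)
    then show ?case using elim by (simp add: splitting_Suc_left del: splitting.simps)
  qed
qed

text \<open>\<open>n\<close> will be the exact flow applied to the perturbed iterate. Passing
  through it separates the propagation of the old discrepancy from the new one made by the
  integrator.\<close>

lemma expansions_add:
  fixes d :: "'v::real_vector"
  shows "(n - r - q *\<^sub>R (\<beta> *\<^sub>R d + t *\<^sub>R h)) + (p - n - q *\<^sub>R (\<beta>' *\<^sub>R d + t *\<^sub>R k))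
    = p - r - q *\<^sub>R ((\<beta> + \<beta>') *\<^sub>R d + t *\<^sub>R (h + k))"
  by (simp add: algebra_simps)

text \<open>Coefficient of \<tau> in the expansion of the first \<open>s\<close> stages about the
  identity. The partial sums matter, and not only their final value: the integrator error of a stage
  is evaluated at a point displaced by the drift accumulated so far.\<close>

primrec drift :: "(nat \<Rightarrow> real) \<Rightarrow> (nat \<Rightarrow> real) \<Rightarrow> ('v::euclidean_space \<Rightarrow> 'v) \<Rightarrow> ('v \<Rightarrow> 'v) \<Rightarrow> nat \<Rightarrow> real \<Rightarrow> 'v \<Rightarrow> 'v"
where
  "drift a b fa fb 0 \<epsilon> y = a 1 *\<^sub>R fa y"
| "drift a b fa fb (Suc s) \<epsilon> y = drift a b fa fb s \<epsilon> y + (b (s + 1) * \<epsilon>) *\<^sub>R fb y + a (s + 2) *\<^sub>R fa y"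

text \<open>The coefficient of \<open>\<epsilon>\<^sup>3 \<tau>\<^sup>4\<close> in the difference of the two splittings, as a function of \<open>\<epsilon>\<close> and \<open>y\<close>.\<close>

primrec fourth_order_coeff ::
  "(nat \<Rightarrow> real) \<Rightarrow> (nat \<Rightarrow> real) \<Rightarrow> ('v::euclidean_space \<Rightarrow> 'v) \<Rightarrow> ('v \<Rightarrow> 'v) \<Rightarrow> ('v \<Rightarrow> 'v) \<Rightarrow> ('v \<Rightarrow> 'v)
    \<Rightarrow> nat \<Rightarrow> real \<Rightarrow> 'v \<Rightarrow> 'v"
where
  "fourth_order_coeff a b fa fb d e 0 \<epsilon> y = 0"
| "fourth_order_coeff a b fa fb d e (Suc s) \<epsilon> y =
    fourth_order_coeff a b fa fb d e s \<epsilon> y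
    + ((\<Sum>i = 1..s. b i ^ 3) * (b (s + 1) * \<epsilon>)) *\<^sub>R frechet_derivative fb (at y) (d y)
    + (b (s + 1) ^ 3 *\<^sub>R frechet_derivative d (at y) (drift a b fa fb s \<epsilon> y) + (b (s + 1) ^ 4 * \<epsilon>) *\<^sub>R e y)
    + ((\<Sum>i = 1..Suc s. b i ^ 3) * a (s + 2)) *\<^sub>R frechet_derivative fa (at y) (d y)"

text \<open>With the fields and the base point fixed, \<open>d\<close> and \<open>e\<close> become
  fixed functions too. They live on a neighbourhood \<open>V\<close> of \<open>x\<close> because
  smoothness of the integrator is local.\<close>

locale perturbed_splitting =
  fixes \<Phi> :: "'v::euclidean_space integrator" and a b :: "nat \<Rightarrow> real" and fa fb :: "'v \<Rightarrow> 'v" and x :: 'v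
    and V :: "'v set" and d e :: "'v \<Rightarrow> 'v" and \<delta> C :: real
  assumes fa: "smooth_on UNIV fa" and fb: "smooth_on UNIV fb" and scaling: "scaling_integrator \<Phi>"
    and d: "smooth_on V d" and e: "smooth_on V e" and x: "x \<in> V" and \<delta>: "\<delta> > 0"
    and expansion: "\<And>h y. y \<in> cball x \<delta> \<Longrightarrow> \<bar>h\<bar> \<le> \<delta> \<Longrightarrow>
      norm (\<Phi> fb h y - flow fb h y - h ^ 3 *\<^sub>R d y - h ^ 4 *\<^sub>R e y) \<le> C * \<bar>h\<bar> ^ 5"
begin

abbreviation "W \<equiv> drift a b fa fb"
abbreviation "H \<equiv> fourth_order_coeff a b fa fb d e"
abbreviation "S s \<epsilon> \<equiv> approx_splitting_method \<Phi> a b s fa fb \<epsilon>"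
abbreviation "R s \<epsilon> \<equiv> splitting_method a b s fa fb \<epsilon>"

lemma drift_tendsto:
  assumes \<epsilon>: "(\<epsilon> \<longlongrightarrow> e0) F" and Y: "(Y \<longlongrightarrow> x) F"
  shows "((\<lambda>p. W s (\<epsilon> p) (Y p)) \<longlongrightarrow> W s e0 x) F"
proof (induction s)
  case 0
  show ?case unfolding drift.simps by (intro tendsto_scaleR tendsto_const smooth_on_tendsto[OF fa UNIV_I Y])
next
  case (Suc s)
  show ?case
    unfolding drift.simps
    by (intro tendsto_add tendsto_scaleR tendsto_mult tendsto_const Suc \<epsilon>
        smooth_on_tendsto[OF fa UNIV_I Y] smooth_on_tendsto[OF fb UNIV_I Y])
qed

lemma coeff_tendsto:
  assumes \<epsilon>: "(\<epsilon> \<longlongrightarrow> e0) F" and Y: "(Y \<longlongrightarrow> x) F"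
  shows "((\<lambda>p. H s (\<epsilon> p) (Y p)) \<longlongrightarrow> H s e0 x) F"
proof (induction s)
  case 0
  show ?case by simp
next
  case (Suc s)
  note dl = smooth_on_tendsto[OF d x Y]
  show ?case
    unfolding fourth_order_coeff.simps
    by (intro tendsto_add tendsto_scaleR tendsto_mult tendsto_const Suc \<epsilon>
        frechet_derivative_tendsto[OF fa UNIV_I Y dl] frechet_derivative_tendsto[OF fb UNIV_I Y dl]
        frechet_derivative_tendsto[OF d x Y drift_tendsto[OF \<epsilon> Y]] smooth_on_tendsto[OF e x Y])
qed

lemma integrator_tendsto:
  assumes "(h \<longlongrightarrow> 0) F" "(U \<longlongrightarrow> x) F"
  shows "((\<lambda>p. \<Phi> fb (h p) (U p)) \<longlongrightarrow> x) F"
proof -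
  have "\<forall>\<^sub>F p in F. norm (\<Phi> fb (h p) (U p) - flow fb (h p) (U p) - h p ^ 3 *\<^sub>R d (U p) - h p ^ 4 *\<^sub>R e (U p)) \<le> C * \<bar>h p ^ 5\<bar>"
    using eventually_in_cball[OF assms(2) \<delta>] eventually_in_cball[OF assms(1) \<delta>]
  proof eventually_elim
    case (elim p)
    then show ?case using expansion[OF elim(1), of "h p"] by (simp add: power_abs)
  qed
  then have "dominated F (\<lambda>p. \<Phi> fb (h p) (U p) - flow fb (h p) (U p) - h p ^ 3 *\<^sub>R d (U p) - h p ^ 4 *\<^sub>R e (U p)) (\<lambda>p. h p ^ 5)"
    by (rule dominatedI)
  moreover have "((\<lambda>p. h p ^ 5) \<longlongrightarrow> 0) F"
    using tendsto_power[OF assms(1), of 5] by simp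
  ultimately have 1: "((\<lambda>p. \<Phi> fb (h p) (U p) - flow fb (h p) (U p) - h p ^ 3 *\<^sub>R d (U p) - h p ^ 4 *\<^sub>R e (U p)) \<longlongrightarrow> 0) F"
    by (rule dominated_tendsto_0)
  have 2: "((\<lambda>p. h p ^ 4 *\<^sub>R e (U p)) \<longlongrightarrow> 0) F"
    using tendsto_scaleR[OF tendsto_power[OF assms(1), of 4] smooth_on_tendsto[OF e x assms(2)]] by simp
  have 3: "((\<lambda>p. h p ^ 3 *\<^sub>R d (U p)) \<longlongrightarrow> 0) F"
    using tendsto_scaleR[OF tendsto_power[OF assms(1), of 3] smooth_on_tendsto[OF d x assms(2)]] by simp
  show ?thesis
    using tendsto_add[OF tendsto_add[OF tendsto_add[OF 1 2] 3] flow_tendsto[OF fb assms]]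
    by (simp only: diff_add_cancel add_0)
qed

lemma eventually_integrator_scaling:
  assumes "(t \<longlongrightarrow> 0) F" "(\<epsilon> \<longlongrightarrow> 0) F" "(U \<longlongrightarrow> x) F"
  shows "\<forall>\<^sub>F p in F. \<Phi> (\<lambda>z. \<epsilon> p *\<^sub>R fb z) (t p) (U p) = \<Phi> fb (t p * \<epsilon> p) (U p)"
proof -
  have "\<forall>\<^sub>F q in nhds (0, 0, x). case q of (\<tau>, \<epsilon>, y) \<Rightarrow> \<Phi> (\<lambda>z. \<epsilon> *\<^sub>R fb z) \<tau> y = \<Phi> fb (\<tau> * \<epsilon>) y"
    using scaling fb by (simp add: scaling_integrator_def)
  moreover have "filterlim (\<lambda>p. (t p, \<epsilon> p, U p)) (nhds (0, 0, x)) F"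
    by (intro tendsto_Pair assms)
  ultimately have "\<forall>\<^sub>F p in F. case (t p, \<epsilon> p, U p) of (\<tau>, \<epsilon>, y) \<Rightarrow> \<Phi> (\<lambda>z. \<epsilon> *\<^sub>R fb z) \<tau> y = \<Phi> fb (\<tau> * \<epsilon>) y"
    by (rule eventually_compose_filterlim)
  then show ?thesis by simp
qed

text \<open>Induction over the stages. Two facts travel together because the second uses the first:
  where the perturbed iterate lies to first order, and how it differs from the exact iterate up to
  \<open>\<tau>^4\<close>. The starting point is a family \<open>Y p\<close>, because the backward
  step will be started at the result of the forward step.\<close>

lemma splitting_expansion:
  assumes \<tau>: "(\<tau> \<longlongrightarrow> 0) F" and \<epsilon>: "(\<epsilon> \<longlongrightarrow> 0) F" and Y: "(Y \<longlongrightarrow> x) F"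
  shows "dominated F (\<lambda>p. S s (\<epsilon> p) (\<tau> p) (Y p) - Y p - \<tau> p *\<^sub>R W s (\<epsilon> p) (Y p)) (\<lambda>p. \<tau> p ^ 2) \<and>
    dominated F (\<lambda>p. S s (\<epsilon> p) (\<tau> p) (Y p) - R s (\<epsilon> p) (\<tau> p) (Y p)
      - (\<epsilon> p * \<tau> p) ^ 3 *\<^sub>R ((\<Sum>i = 1..s. b i ^ 3) *\<^sub>R d (Y p) + \<tau> p *\<^sub>R H s (\<epsilon> p) (Y p))) (\<lambda>p. \<epsilon> p ^ 3 * \<tau> p ^ 5)"
proof (induction s)
  case 0
  \<comment> \<open>Before the first flow, perturbed and exact iterates both equal \<open>Y\<close>;
    with \<open>\<beta> = 0\<close> the value chosen for \<open>D\<close> is immaterial.\<close>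
  have "dominated F (\<lambda>p. flow fa (a 1 * \<tau> p) (Y p) - Y p - \<tau> p *\<^sub>R (0 + a 1 *\<^sub>R fa (Y p))) (\<lambda>p. \<tau> p ^ 2)"
    by (rule flow_step(5)[where \<beta> = 0 and \<epsilon> = \<epsilon> and R = Y and D = Y and H = "\<lambda>p. 0" and c = "\<lambda>p. a 1",
          OF fa \<tau> \<epsilon> tendsto_const Y tendsto_const Y tendsto_const])
       (simp_all add: dominated_0)
  then show ?case by (simp add: approx_splitting_method_def splitting_method_def dominated_0)
next
  case (Suc s)
  define S' where "S' p = S s (\<epsilon> p) (\<tau> p) (Y p)" for p
  define R' where "R' p = R s (\<epsilon> p) (\<tau> p) (Y p)" for p
  define c where "c p = b (s + 1) * \<epsilon> p" for p
  define \<beta> where "\<beta> = (\<Sum>i = 1..s. b i ^ 3)"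
  note Wl = drift_tendsto[OF \<epsilon> Y] and dl = smooth_on_tendsto[OF d x Y]
  have c: "(c \<longlongrightarrow> 0) F" using tendsto_mult_right_zero[OF \<epsilon>] by (simp add: c_def [abs_def])
  have S1: "dominated F (\<lambda>p. S' p - Y p - \<tau> p *\<^sub>R W s (\<epsilon> p) (Y p)) (\<lambda>p. \<tau> p ^ 2)"
    and E1: "dominated F (\<lambda>p. S' p - R' p - (\<epsilon> p * \<tau> p) ^ 3 *\<^sub>R (\<beta> *\<^sub>R d (Y p) + \<tau> p *\<^sub>R H s (\<epsilon> p) (Y p))) (\<lambda>p. \<epsilon> p ^ 3 * \<tau> p ^ 5)"
    using Suc by (simp_all add: S'_def R'_def \<beta>_def)
  note step = flow_step[OF fb \<tau> \<epsilon> c Y Wl dl coeff_tendsto[OF \<epsilon> Y] S1 E1]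
  note pert = perturbation_step[where N = "\<lambda>h y. \<Phi> fb h y - flow fb h y" and b = "b (s + 1)",
      OF \<tau> \<epsilon> Y Wl d e x \<delta> expansion S1, folded c_def]
  \<comment> \<open>The inner maps are taken for the unscaled field \<open>fb\<close> with time
    \<open>b (s + 1) * \<epsilon> p * \<tau> p\<close>. Moving \<epsilon> from the field into the
    time is justified in \<open>eqS\<close> and \<open>eqR\<close>, by the scaling property of the
    integrator and its analogue for flows.\<close>
  define S2 where "S2 p = \<Phi> fb (c p * \<tau> p) (S' p)" for p
  define R2 where "R2 p = flow fb (c p * \<tau> p) (R' p)" for p
  define W2 where "W2 p = W s (\<epsilon> p) (Y p) + c p *\<^sub>R fb (Y p)" for p
  define H2 where "H2 p = H s (\<epsilon> p) (Y p) + (\<beta> * c p) *\<^sub>R frechet_derivative fb (at (Y p)) (d (Y p))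
    + (b (s + 1) ^ 3 *\<^sub>R frechet_derivative d (at (Y p)) (W s (\<epsilon> p) (Y p)) + (b (s + 1) ^ 4 * \<epsilon> p) *\<^sub>R e (Y p))" for p
  have W2: "(W2 \<longlongrightarrow> W s 0 x + 0 *\<^sub>R fb x) F"
    unfolding W2_def [abs_def] by (intro tendsto_add tendsto_scaleR Wl c smooth_on_tendsto[OF fb UNIV_I Y])
  have H2: "(H2 \<longlongrightarrow> H s 0 x + (\<beta> * 0) *\<^sub>R frechet_derivative fb (at x) (d x)
    + (b (s + 1) ^ 3 *\<^sub>R frechet_derivative d (at x) (W s 0 x) + (b (s + 1) ^ 4 * 0) *\<^sub>R e x)) F"
    unfolding H2_def [abs_def]
    by (intro tendsto_add tendsto_scaleR tendsto_mult tendsto_const Wl c \<epsilon> coeff_tendsto[OF \<epsilon> Y] smooth_on_tendsto[OF e x Y]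
        frechet_derivative_tendsto[OF fb UNIV_I Y dl] frechet_derivative_tendsto[OF d x Y Wl])
  have S2: "dominated F (\<lambda>p. S2 p - Y p - \<tau> p *\<^sub>R W2 p) (\<lambda>p. \<tau> p ^ 2)"
  proof -
    have "(\<lambda>p. S2 p - Y p - \<tau> p *\<^sub>R W2 p) = (\<lambda>p. (flow fb (c p * \<tau> p) (S' p) - Y p - \<tau> p *\<^sub>R (W s (\<epsilon> p) (Y p) + c p *\<^sub>R fb (Y p)))
        + (\<Phi> fb (c p * \<tau> p) (S' p) - flow fb (c p * \<tau> p) (S' p)))"
      by (simp add: S2_def W2_def algebra_simps)
    then show ?thesis using dominated_add[OF step(5) pert(1)] by (simp only:)
  qed
  have E2: "dominated F (\<lambda>p. S2 p - R2 p - (\<epsilon> p * \<tau> p) ^ 3 *\<^sub>R ((\<beta> + b (s + 1) ^ 3) *\<^sub>R d (Y p) + \<tau> p *\<^sub>R H2 p)) (\<lambda>p. \<epsilon> p ^ 3 * \<tau> p ^ 5)"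
    using dominated_add[OF step(6) pert(2)] unfolding S2_def R2_def H2_def expansions_add .
  note step2 = flow_step[OF fa \<tau> \<epsilon> tendsto_const[of "a (s + 2)"] Y W2 dl H2 S2 E2]
  have eqS: "\<forall>\<^sub>F p in F. S (Suc s) (\<epsilon> p) (\<tau> p) (Y p) = flow fa (a (s + 2) * \<tau> p) (S2 p)"
    using eventually_integrator_scaling[OF tendsto_mult_right_zero[OF \<tau>] \<epsilon> step(3), of "b (s + 1)"]
    by eventually_elim (simp add: approx_splitting_method_def S2_def S'_def c_def mult_ac)
  have eqR: "\<forall>\<^sub>F p in F. R (Suc s) (\<epsilon> p) (\<tau> p) (Y p) = flow fa (a (s + 2) * \<tau> p) (R2 p)"
    using eventually_flow_scaleR_field[OF fb tendsto_mult_right_zero[OF \<tau>] \<epsilon> step(4), of "b (s + 1)"]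
    by eventually_elim (simp add: splitting_method_def R2_def R'_def c_def mult_ac)
  have W3: "W (Suc s) (\<epsilon> p) (Y p) = W2 p + a (s + 2) *\<^sub>R fa (Y p)" for p
    by (simp add: W2_def c_def)
  have H3: "H (Suc s) (\<epsilon> p) (Y p) = H2 p + ((\<beta> + b (s + 1) ^ 3) * a (s + 2)) *\<^sub>R frechet_derivative fa (at (Y p)) (d (Y p))" for p
    by (simp add: H2_def c_def \<beta>_def)
  have \<beta>3: "(\<Sum>i = 1..Suc s. b i ^ 3) = \<beta> + b (s + 1) ^ 3" by (simp add: \<beta>_def)
  show ?case
    unfolding W3 H3 \<beta>3
  proof
    show "dominated F (\<lambda>p. S (Suc s) (\<epsilon> p) (\<tau> p) (Y p) - Y p - \<tau> p *\<^sub>R (W2 p + a (s + 2) *\<^sub>R fa (Y p))) (\<lambda>p. \<tau> p ^ 2)"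
      by (rule dominated_eventually_eq[OF _ step2(5)]) (use eqS in \<open>eventually_elim, simp\<close>)
    show "dominated F (\<lambda>p. S (Suc s) (\<epsilon> p) (\<tau> p) (Y p) - R (Suc s) (\<epsilon> p) (\<tau> p) (Y p)
      - (\<epsilon> p * \<tau> p) ^ 3 *\<^sub>R ((\<beta> + b (s + 1) ^ 3) *\<^sub>R d (Y p) + \<tau> p *\<^sub>R
        (H2 p + ((\<beta> + b (s + 1) ^ 3) * a (s + 2)) *\<^sub>R frechet_derivative fa (at (Y p)) (d (Y p))))) (\<lambda>p. \<epsilon> p ^ 3 * \<tau> p ^ 5)"
      by (rule dominated_eventually_eq[OF _ step2(6)]) (use eqS eqR in \<open>eventually_elim, simp\<close>)
  qed
qed

end

section \<open>Time reversal and the vanishing of the fourth-order coefficient\<close>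

lemma dominated_near_identity_compose:
  fixes U V U' V' U'' V'' :: "'p \<Rightarrow> 'w::real_normed_vector"
  assumes \<tau>: "(\<tau> \<longlongrightarrow> 0) F"
    and 1: "dominated F (\<lambda>p. U' p - V' p - (U p - V p)) (\<lambda>p. \<tau> p * norm (U p - V p))"
    and 2: "dominated F (\<lambda>p. U'' p - V'' p - (U' p - V' p)) (\<lambda>p. \<tau> p * norm (U' p - V' p))"
  shows "dominated F (\<lambda>p. U'' p - V'' p - (U p - V p)) (\<lambda>p. \<tau> p * norm (U p - V p))"
proof -
  let ?n = "\<lambda>p. norm (U p - V p)"
  have "dominated F (\<lambda>p. \<tau> p * ?n p) (\<lambda>p. 1 * ?n p)"
    by (intro dominated_mult dominated_refl tendsto_imp_dominated_1[OF \<tau>])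
  then have "dominated F (\<lambda>p. \<tau> p * ?n p) ?n" by simp
  from dominated_add[OF dominated_trans[OF 1 this] dominated_norm_self]
  have "dominated F (\<lambda>p. U' p - V' p) ?n" by simp
  then have "dominated F (\<lambda>p. \<tau> p * norm (U' p - V' p)) (\<lambda>p. \<tau> p * ?n p)"
    by (intro dominated_mult dominated_refl) (simp add: dominated_norm_iff)
  from dominated_add[OF dominated_trans[OF 2 this] 1] show ?thesis by (simp add: algebra_simps)
qed

lemma dominated_scaled_flow_diff:
  fixes f :: "'v::euclidean_space \<Rightarrow> 'v"
  assumes f: "smooth_on UNIV f" and \<tau>: "(\<tau> \<longlongrightarrow> 0) F" and c: "(c \<longlongrightarrow> c0) F" and U: "(U \<longlongrightarrow> x) F" and V: "(V \<longlongrightarrow> x) F"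
  shows "dominated F (\<lambda>p. flow f (c p * \<tau> p) (U p) - flow f (c p * \<tau> p) (V p) - (U p - V p)) (\<lambda>p. \<tau> p * norm (U p - V p))"
proof -
  have "((\<lambda>p. c p * \<tau> p) \<longlongrightarrow> 0) F" using tendsto_mult[OF c \<tau>] by simp
  moreover have "dominated F (\<lambda>p. (c p * \<tau> p) * norm (U p - V p)) (\<lambda>p. (1 * \<tau> p) * norm (U p - V p))"
    by (intro dominated_mult dominated_refl tendsto_imp_dominated_1[OF c])
  ultimately show ?thesis
    using dominated_trans[OF dominated_flow_diff[OF f _ U V]] by simp
qed

context perturbed_splitting
begin

lemma splitting_bounds:
  assumes \<tau>: "(\<tau> \<longlongrightarrow> 0) F" and \<epsilon>: "(\<epsilon> \<longlongrightarrow> 0) F" and Y: "(Y \<longlongrightarrow> x) F"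
  shows "dominated F (\<lambda>p. S s (\<epsilon> p) (\<tau> p) (Y p) - R s (\<epsilon> p) (\<tau> p) (Y p)) (\<lambda>p. \<epsilon> p ^ 3 * \<tau> p ^ 3)"
    and "dominated F (\<lambda>p. S s (\<epsilon> p) (\<tau> p) (Y p) - Y p) \<tau>"
    and "((\<lambda>p. S s (\<epsilon> p) (\<tau> p) (Y p)) \<longlongrightarrow> x) F" and "((\<lambda>p. R s (\<epsilon> p) (\<tau> p) (Y p)) \<longlongrightarrow> x) F"
  using flow_step(1-4)[OF fa \<tau> \<epsilon> tendsto_const Y drift_tendsto[OF \<epsilon> Y] smooth_on_tendsto[OF d x Y]
      coeff_tendsto[OF \<epsilon> Y] splitting_expansion[OF \<tau> \<epsilon> Y, THEN conjunct1] splitting_expansion[OF \<tau> \<epsilon> Y, THEN conjunct2]]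
  by blast+

text \<open>The exact splitting is the identity up to a map with local Lipschitz constant of order
  \<tau>. A discrepancy between two starting points thus passes through the backward step with
  relative error of order \<tau>.\<close>

lemma exact_splitting_diff:
  assumes \<tau>: "(\<tau> \<longlongrightarrow> 0) F" and \<epsilon>: "(\<epsilon> \<longlongrightarrow> 0) F" and U: "(U \<longlongrightarrow> x) F" and Y: "(Y \<longlongrightarrow> x) F"
  shows "dominated F (\<lambda>p. R s (\<epsilon> p) (\<tau> p) (U p) - R s (\<epsilon> p) (\<tau> p) (Y p) - (U p - Y p)) (\<lambda>p. \<tau> p * norm (U p - Y p))"
proof (induction s)
  case 0
  show ?case
    using dominated_scaled_flow_diff[OF fa \<tau> tendsto_const[of "a 1"] U Y] by (simp add: splitting_method_def)
next
  case (Suc s)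
  define c where "c p = b (s + 1) * \<epsilon> p" for p
  have c: "(c \<longlongrightarrow> 0) F" using tendsto_mult_right_zero[OF \<epsilon>] by (simp add: c_def [abs_def])
  have c\<tau>: "((\<lambda>p. c p * \<tau> p) \<longlongrightarrow> 0) F" using tendsto_mult[OF c \<tau>] by simp
  let ?Z = "\<lambda>U p. flow fb (c p * \<tau> p) (R s (\<epsilon> p) (\<tau> p) (U p))"
  have eq: "\<forall>\<^sub>F p in F. R (Suc s) (\<epsilon> p) (\<tau> p) (U p) = flow fa (a (s + 2) * \<tau> p) (?Z U p)" if U: "(U \<longlongrightarrow> x) F" for U
    using eventually_flow_scaleR_field[OF fb tendsto_mult_right_zero[OF \<tau>, of "b (s + 1)"] \<epsilon> splitting_bounds(4)[where s = s, OF \<tau> \<epsilon> U]]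
    by eventually_elim (simp add: splitting_method_def c_def mult_ac)
  have Z: "(?Z U \<longlongrightarrow> x) F" if "(U \<longlongrightarrow> x) F" for U
    by (rule flow_tendsto[OF fb c\<tau> splitting_bounds(4)[where s = s, OF \<tau> \<epsilon> that]])
  have "dominated F (\<lambda>p. ?Z U p - ?Z Y p - (U p - Y p)) (\<lambda>p. \<tau> p * norm (U p - Y p))"
    by (rule dominated_near_identity_compose[OF \<tau> Suc
          dominated_scaled_flow_diff[OF fb \<tau> c splitting_bounds(4)[where s = s, OF \<tau> \<epsilon> U] splitting_bounds(4)[where s = s, OF \<tau> \<epsilon> Y]]])
  from dominated_near_identity_compose[OF \<tau> this
      dominated_scaled_flow_diff[OF fa \<tau> tendsto_const[of "a (s + 2)"] Z[OF U] Z[OF Y]]]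
  show ?case
    by (rule dominated_eventually_eq[rotated]) (use eq[OF U] eq[OF Y] in \<open>eventually_elim, simp\<close>)
qed

lemma exact_splitting_inverse:
  assumes \<tau>: "(\<tau> \<longlongrightarrow> 0) F" and \<epsilon>: "(\<epsilon> \<longlongrightarrow> 0) F" and U: "(U \<longlongrightarrow> x) F"
    and "\<forall>i\<in>{1..s + 1}. a (s + 2 - i) = a i" "\<forall>i\<in>{1..s}. b (s + 1 - i) = b i"
  shows "\<forall>\<^sub>F p in F. R s (\<epsilon> p) (- \<tau> p) (R s (\<epsilon> p) (\<tau> p) (U p)) = U p"
  unfolding splitting_method_def
proof (rule splitting_inverse[where Q = "\<lambda>p. flow (\<lambda>y. \<epsilon> p *\<^sub>R fb y)", OF _ _ _ _ \<tau> U assms(4,5)])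
  fix t :: "'a \<Rightarrow> real" and U :: "'a \<Rightarrow> 'v" assume t: "(t \<longlongrightarrow> 0) F" and U: "(U \<longlongrightarrow> x) F"
  show "((\<lambda>p. flow fa (t p) (U p)) \<longlongrightarrow> x) F" by (rule flow_tendsto[OF fa t U])
  show "\<forall>\<^sub>F p in F. flow fa (- t p) (flow fa (t p) (U p)) = U p" by (rule eventually_flow_minus_flow[OF fa t U])
  have te: "((\<lambda>p. t p * \<epsilon> p) \<longlongrightarrow> 0) F" using tendsto_mult[OF t \<epsilon>] by simp
  have mt: "((\<lambda>p. - t p) \<longlongrightarrow> 0) F" using tendsto_minus[OF t] by simp
  note Z = flow_tendsto[OF fb te U]
  have eq: "\<forall>\<^sub>F p in F. flow (\<lambda>y. \<epsilon> p *\<^sub>R fb y) (t p) (U p) = flow fb (t p * \<epsilon> p) (U p)"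
    by (rule eventually_flow_scaleR_field[OF fb t \<epsilon> U])
  show "((\<lambda>p. flow (\<lambda>y. \<epsilon> p *\<^sub>R fb y) (t p) (U p)) \<longlongrightarrow> x) F"
    by (rule Lim_transform_eventually[OF Z]) (use eq in \<open>eventually_elim, simp\<close>)
  show "\<forall>\<^sub>F p in F. flow (\<lambda>y. \<epsilon> p *\<^sub>R fb y) (- t p) (flow (\<lambda>y. \<epsilon> p *\<^sub>R fb y) (t p) (U p)) = U p"
    using eq eventually_flow_scaleR_field[OF fb mt \<epsilon> Z] eventually_flow_minus_flow[OF fb te U]
    by eventually_elim simp
qed

lemma approx_splitting_inverse:
  assumes sym: "symmetric_integrator \<Phi>" and \<tau>: "(\<tau> \<longlongrightarrow> 0) F" and \<epsilon>: "(\<epsilon> \<longlongrightarrow> 0) F" and U: "(U \<longlongrightarrow> x) F"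
    and "\<forall>i\<in>{1..s + 1}. a (s + 2 - i) = a i" "\<forall>i\<in>{1..s}. b (s + 1 - i) = b i"
  shows "\<forall>\<^sub>F p in F. S s (\<epsilon> p) (- \<tau> p) (S s (\<epsilon> p) (\<tau> p) (U p)) = U p"
  unfolding approx_splitting_method_def
proof (rule splitting_inverse[where Q = "\<lambda>p. \<Phi> (\<lambda>y. \<epsilon> p *\<^sub>R fb y)", OF _ _ _ _ \<tau> U assms(5,6)])
  fix t :: "'a \<Rightarrow> real" and U :: "'a \<Rightarrow> 'v" assume t: "(t \<longlongrightarrow> 0) F" and U: "(U \<longlongrightarrow> x) F"
  show "((\<lambda>p. flow fa (t p) (U p)) \<longlongrightarrow> x) F" by (rule flow_tendsto[OF fa t U])
  show "\<forall>\<^sub>F p in F. flow fa (- t p) (flow fa (t p) (U p)) = U p" by (rule eventually_flow_minus_flow[OF fa t U])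
  have te: "((\<lambda>p. t p * \<epsilon> p) \<longlongrightarrow> 0) F" using tendsto_mult[OF t \<epsilon>] by simp
  have mt: "((\<lambda>p. - t p) \<longlongrightarrow> 0) F" using tendsto_minus[OF t] by simp
  note Z = integrator_tendsto[OF te U]
  have eq: "\<forall>\<^sub>F p in F. \<Phi> (\<lambda>y. \<epsilon> p *\<^sub>R fb y) (t p) (U p) = \<Phi> fb (t p * \<epsilon> p) (U p)"
    by (rule eventually_integrator_scaling[OF t \<epsilon> U])
  show "((\<lambda>p. \<Phi> (\<lambda>y. \<epsilon> p *\<^sub>R fb y) (t p) (U p)) \<longlongrightarrow> x) F"
    by (rule Lim_transform_eventually[OF Z]) (use eq in \<open>eventually_elim, simp\<close>)
  have "\<forall>\<^sub>F q in nhds (0, x). case q of (h, y) \<Rightarrow> \<Phi> fb (- h) (\<Phi> fb h y) = y"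
    using sym fb by (simp add: symmetric_integrator_def)
  from eventually_compose_filterlim[OF this tendsto_Pair[OF te U]]
  have "\<forall>\<^sub>F p in F. \<Phi> fb (- (t p * \<epsilon> p)) (\<Phi> fb (t p * \<epsilon> p) (U p)) = U p" by simp
  with eq eventually_integrator_scaling[OF mt \<epsilon> Z]
  show "\<forall>\<^sub>F p in F. \<Phi> (\<lambda>y. \<epsilon> p *\<^sub>R fb y) (- t p) (\<Phi> (\<lambda>y. \<epsilon> p *\<^sub>R fb y) (t p) (U p)) = U p"
    by eventually_elim simp
qed

text \<open>Inserting \<open>R(-\<tau>) S(\<tau>) x\<close> between
  \<open>S(-\<tau>) S(\<tau>) x\<close> and \<open>R(-\<tau>) R(\<tau>) x\<close>, both equal to
  \<open>x\<close>, writes 0 as the backward discrepancy at \<open>S(\<tau>) x\<close> plus the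
  transported forward discrepancy at \<open>x\<close>. Each is \<open>\<epsilon>^3 \<tau>^4\<close>
  times a value of \<open>H\<close>, up to \<open>O(\<epsilon>^3 \<tau>^5)\<close>, and the signs
  agree. Dividing by \<open>\<epsilon>^3 \<tau>^4\<close> and letting \<tau> tend to 0 gives
  \<open>2 H = 0\<close>, by continuity of \<open>H\<close> in the point.\<close>

lemma fourth_order_coeff_zero:
  assumes sym: "symmetric_integrator \<Phi>"
    and pal: "\<forall>i\<in>{1..s + 1}. a (s + 2 - i) = a i" "\<forall>i\<in>{1..s}. b (s + 1 - i) = b i"
    and cubes: "(\<Sum>i = 1..s. b i ^ 3) = 0"
  shows "\<forall>\<^sub>F \<epsilon> in nhds 0. \<epsilon> \<noteq> 0 \<longrightarrow> H s \<epsilon> x = 0"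
proof -
  define F where "F = nhds ((0::real), (0::real))"
  define \<tau> \<epsilon> :: "real \<times> real \<Rightarrow> real" where "\<tau> = fst" and "\<epsilon> = snd"
  have \<tau>: "(\<tau> \<longlongrightarrow> 0) F" and \<epsilon>: "(\<epsilon> \<longlongrightarrow> 0) F"
    using tendsto_fst[OF filterlim_ident, of "(0::real, 0::real)"] tendsto_snd[OF filterlim_ident, of "(0::real, 0::real)"]
    by (simp_all add: F_def \<tau>_def \<epsilon>_def)
  have m\<tau>: "((\<lambda>p. - \<tau> p) \<longlongrightarrow> 0) F" using tendsto_minus[OF \<tau>] by simp
  have x0: "((\<lambda>p. x) \<longlongrightarrow> x) F" by simp
  define Sx where "Sx p = S s (\<epsilon> p) (\<tau> p) x" for p
  define Rx where "Rx p = R s (\<epsilon> p) (\<tau> p) x" for p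
  note Sx0 = splitting_bounds(3)[where s = s, OF \<tau> \<epsilon> x0, folded Sx_def] and Rx0 = splitting_bounds(4)[where s = s, OF \<tau> \<epsilon> x0, folded Rx_def]
  let ?g = "\<lambda>p. \<epsilon> p ^ 3 * \<tau> p ^ 5"
  let ?q = "\<lambda>p. (\<epsilon> p * \<tau> p) ^ 3 * \<tau> p"
  have E1: "dominated F (\<lambda>p. Sx p - Rx p - ?q p *\<^sub>R H s (\<epsilon> p) x) ?g"
    using splitting_expansion[OF \<tau> \<epsilon> x0, of s, THEN conjunct2] cubes by (simp add: Sx_def Rx_def)
  \<comment> \<open>Since \<open>(\<epsilon> (-\<tau>))^3 (-\<tau>) = (\<epsilon> \<tau>)^3
    \<tau>\<close>, the prefactor \<open>?q\<close> is unchanged under reversal.\<close>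
  have "dominated F (\<lambda>p. S s (\<epsilon> p) (- \<tau> p) (Sx p) - R s (\<epsilon> p) (- \<tau> p) (Sx p) - ?q p *\<^sub>R H s (\<epsilon> p) (Sx p))
      (\<lambda>p. \<epsilon> p ^ 3 * (- \<tau> p) ^ 5)"
    using splitting_expansion[OF m\<tau> \<epsilon> Sx0, of s, THEN conjunct2] cubes by (simp add: power_mult_distrib)
  then have E2: "dominated F (\<lambda>p. S s (\<epsilon> p) (- \<tau> p) (Sx p) - R s (\<epsilon> p) (- \<tau> p) (Sx p) - ?q p *\<^sub>R H s (\<epsilon> p) (Sx p)) ?g"
    by (simp add: dominated_def abs_mult power_abs)
  have q: "?q p = \<epsilon> p ^ 3 * \<tau> p ^ 4" for p by (simp add: power_mult_distrib eval_nat_numeral)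
  have "dominated F (\<lambda>p. ?q p *\<^sub>R H s (\<epsilon> p) x) (\<lambda>p. (\<epsilon> p ^ 3 * \<tau> p ^ 4) * 1)"
    unfolding q by (intro dominated_scaleR dominated_refl tendsto_imp_dominated_1[OF coeff_tendsto[OF \<epsilon> x0]])
  then have "dominated F (\<lambda>p. ?q p *\<^sub>R H s (\<epsilon> p) x) (\<lambda>p. \<epsilon> p ^ 3 * \<tau> p ^ 4)" by simp
  from dominated_add[OF dominated_trans[OF E1 dominated_power_mono[OF \<epsilon> \<tau>]] this]
  have "dominated F (\<lambda>p. Sx p - Rx p) (\<lambda>p. \<epsilon> p ^ 3 * \<tau> p ^ 4)" by simp
  \<comment> \<open>With the cubes summing to 0 the discrepancy starts at
    \<open>\<epsilon>^3 \<tau>^4\<close>, so transporting it through the backward step costs only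
    \<open>\<epsilon>^3 \<tau>^5\<close>. A surviving \<open>\<tau>^3\<close> term would bring an
    error as large as the term under study.\<close>
  then have "dominated F (\<lambda>p. - \<tau> p * norm (Sx p - Rx p)) (\<lambda>p. - \<tau> p * (\<epsilon> p ^ 3 * \<tau> p ^ 4))"
    by (intro dominated_mult dominated_refl) (simp add: dominated_norm_iff)
  from dominated_trans[OF exact_splitting_diff[OF m\<tau> \<epsilon> Sx0 Rx0, of s] this]
  have E3: "dominated F (\<lambda>p. R s (\<epsilon> p) (- \<tau> p) (Sx p) - R s (\<epsilon> p) (- \<tau> p) (Rx p) - (Sx p - Rx p)) ?g"
    by (simp add: dominated_def abs_mult power_abs eval_nat_numeral mult_ac)
  \<comment> \<open>Once both compositions are replaced by the identity, everything except the two
    values of \<open>H\<close> cancels in this sum.\<close>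
  have "dominated F (\<lambda>p. (Sx p - Rx p - ?q p *\<^sub>R H s (\<epsilon> p) x)
      + (S s (\<epsilon> p) (- \<tau> p) (Sx p) - R s (\<epsilon> p) (- \<tau> p) (Sx p) - ?q p *\<^sub>R H s (\<epsilon> p) (Sx p))
      + (R s (\<epsilon> p) (- \<tau> p) (Sx p) - R s (\<epsilon> p) (- \<tau> p) (Rx p) - (Sx p - Rx p))) ?g"
    by (intro dominated_add E1 E2 E3)
  then have "dominated F (\<lambda>p. - (?q p *\<^sub>R (H s (\<epsilon> p) (Sx p) + H s (\<epsilon> p) x))) ?g"
  proof (rule dominated_eventually_eq[rotated])
    show "\<forall>\<^sub>F p in F. (Sx p - Rx p - ?q p *\<^sub>R H s (\<epsilon> p) x)
      + (S s (\<epsilon> p) (- \<tau> p) (Sx p) - R s (\<epsilon> p) (- \<tau> p) (Sx p) - ?q p *\<^sub>R H s (\<epsilon> p) (Sx p))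
      + (R s (\<epsilon> p) (- \<tau> p) (Sx p) - R s (\<epsilon> p) (- \<tau> p) (Rx p) - (Sx p - Rx p))
      = - (?q p *\<^sub>R (H s (\<epsilon> p) (Sx p) + H s (\<epsilon> p) x))"
      using approx_splitting_inverse[OF sym \<tau> \<epsilon> x0 pal] exact_splitting_inverse[OF \<tau> \<epsilon> x0 pal]
      by eventually_elim (simp add: Sx_def Rx_def scaleR_add_right)
  qed
  then obtain K where K: "\<forall>\<^sub>F p in F. norm (- (?q p *\<^sub>R (H s (\<epsilon> p) (Sx p) + H s (\<epsilon> p) x))) \<le> K * \<bar>?g p\<bar>"
    by (auto simp: dominated_def)
  obtain L where L: "\<forall>\<^sub>F p in F. norm (Sx p - x) \<le> L * \<bar>\<tau> p\<bar>"
    using splitting_bounds(2)[OF \<tau> \<epsilon> x0, of s] by (auto simp: dominated_def Sx_def)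
  \<comment> \<open>Neighbourhoods of (0, 0) contain products of neighbourhoods, so \<epsilon> can
    be frozen at a value \<open>c\<close> satisfying \<open>Q\<close> while \<tau> tends to 0, with
    constants \<open>K\<close> and \<open>L\<close> independent of \<open>c\<close>.\<close>
  from K L have "\<forall>\<^sub>F p in nhds 0 \<times>\<^sub>F nhds 0. norm (?q p *\<^sub>R (H s (\<epsilon> p) (Sx p) + H s (\<epsilon> p) x)) \<le> K * \<bar>?g p\<bar>
      \<and> norm (Sx p - x) \<le> L * \<bar>\<tau> p\<bar>"
    unfolding F_def nhds_prod by eventually_elim simp
  then obtain P Q where P: "eventually P (nhds 0)" and Q: "eventually Q (nhds 0)"
    and PQ: "\<And>t c. P t \<Longrightarrow> Q c \<Longrightarrow> norm (?q (t, c) *\<^sub>R (H s c (Sx (t, c)) + H s c x)) \<le> K * \<bar>?g (t, c)\<bar>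
      \<and> norm (Sx (t, c) - x) \<le> L * \<bar>t\<bar>"
    unfolding eventually_prod_filter by (auto simp: \<tau>_def \<epsilon>_def)
  from Q show ?thesis
  proof eventually_elim
    case (elim c)
    show ?case
    proof
      assume c: "c \<noteq> 0"
      have P': "\<forall>\<^sub>F t in at 0. P t" using P by (simp add: eventually_nhds_conv_at)
      have t0: "((\<lambda>t. A * \<bar>t\<bar>) \<longlongrightarrow> 0) (at (0::real))" for A
        using tendsto_mult_right_zero[OF tendsto_rabs_zero[OF tendsto_ident_at]] .
      have "\<forall>\<^sub>F t in at 0. norm (Sx (t, c) - x) \<le> L * \<bar>t\<bar>" using P' by eventually_elim (use PQ elim in blast)
      then have "((\<lambda>t. Sx (t, c) - x) \<longlongrightarrow> 0) (at 0)" by (rule Lim_null_comparison[OF _ t0])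
      then have "((\<lambda>t. Sx (t, c)) \<longlongrightarrow> x) (at 0)" by (simp add: LIM_zero_iff)
      from tendsto_add[OF coeff_tendsto[OF tendsto_const this] tendsto_const]
      have "((\<lambda>t. H s c (Sx (t, c)) + H s c x) \<longlongrightarrow> H s c x + H s c x) (at 0)" .
      moreover have "\<forall>\<^sub>F t in at 0. norm (H s c (Sx (t, c)) + H s c x) \<le> K * \<bar>t\<bar>"
        using P' eventually_neq_at_within[of 0 0 UNIV]
      proof eventually_elim
        case (elim t)
        have "\<bar>c ^ 3 * t ^ 4\<bar> * norm (H s c (Sx (t, c)) + H s c x) \<le> \<bar>c ^ 3 * t ^ 4\<bar> * (K * \<bar>t\<bar>)"
        proof -
          have "?q (t, c) = c ^ 3 * t ^ 4" "?g (t, c) = (c ^ 3 * t ^ 4) * t"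
            using q[of "(t, c)"] by (simp_all add: \<tau>_def \<epsilon>_def eval_nat_numeral)
          then have "norm ((c ^ 3 * t ^ 4) *\<^sub>R (H s c (Sx (t, c)) + H s c x)) \<le> K * \<bar>(c ^ 3 * t ^ 4) * t\<bar>"
            using PQ[OF elim(1) \<open>Q c\<close>, THEN conjunct1] by (simp only:)
          then show ?thesis
            unfolding norm_scaleR abs_mult[of "c ^ 3 * t ^ 4"] by (simp only: mult.left_commute[of K])
        qed
        then show ?case by (rule mult_left_le_imp_le) (use c elim(2) in simp)
      qed
      then have "((\<lambda>t. H s c (Sx (t, c)) + H s c x) \<longlongrightarrow> 0) (at 0)" by (rule Lim_null_comparison[OF _ t0])
      ultimately have "H s c x + H s c x = 0" using tendsto_unique[OF at_neq_bot] by blast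
      then show "H s c x = 0" by (simp flip: scaleR_2)
    qed
  qed
qed

lemma splitting_error_fifth_order:
  assumes sym: "symmetric_integrator \<Phi>"
    and pal: "\<forall>i\<in>{1..s + 1}. a (s + 2 - i) = a i" "\<forall>i\<in>{1..s}. b (s + 1 - i) = b i"
    and cubes: "(\<Sum>i = 1..s. b i ^ 3) = 0" and \<tau>: "(\<tau> \<longlongrightarrow> 0) F" and \<epsilon>: "(\<epsilon> \<longlongrightarrow> 0) F"
  shows "dominated F (\<lambda>p. S s (\<epsilon> p) (\<tau> p) x - R s (\<epsilon> p) (\<tau> p) x) (\<lambda>p. \<epsilon> p ^ 3 * \<tau> p ^ 5)"
proof (rule dominated_eventually_eq)
  show "dominated F (\<lambda>p. S s (\<epsilon> p) (\<tau> p) x - R s (\<epsilon> p) (\<tau> p) x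
      - (\<epsilon> p * \<tau> p) ^ 3 *\<^sub>R ((\<Sum>i = 1..s. b i ^ 3) *\<^sub>R d x + \<tau> p *\<^sub>R H s (\<epsilon> p) x)) (\<lambda>p. \<epsilon> p ^ 3 * \<tau> p ^ 5)"
    using splitting_expansion[OF \<tau> \<epsilon> tendsto_const] by blast
  \<comment> \<open>For \<open>\<epsilon> p = 0\<close> the factor
    \<open>(\<epsilon> p * \<tau> p)^3\<close> is already 0, so knowing that \<open>H\<close>
    vanishes for nonzero \<epsilon> suffices.\<close>
  show "\<forall>\<^sub>F p in F. S s (\<epsilon> p) (\<tau> p) x - R s (\<epsilon> p) (\<tau> p) x
      - (\<epsilon> p * \<tau> p) ^ 3 *\<^sub>R ((\<Sum>i = 1..s. b i ^ 3) *\<^sub>R d x + \<tau> p *\<^sub>R H s (\<epsilon> p) x)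
      = S s (\<epsilon> p) (\<tau> p) x - R s (\<epsilon> p) (\<tau> p) x"
    using eventually_compose_filterlim[OF fourth_order_coeff_zero[OF sym pal cubes] \<epsilon>]
    by eventually_elim (use cubes in auto)
qed

end

section \<open>Transfer of generalized orders\<close>

lemma dominated_generalized_order_sum:
  fixes \<tau> \<epsilon> :: "'p \<Rightarrow> real"
  assumes "i < length rs" "(\<epsilon> \<longlongrightarrow> 0) F" "(\<tau> \<longlongrightarrow> 0) F" "i + 1 \<le> k" "rs ! i + 1 \<le> l"
  shows "dominated F (\<lambda>p. \<epsilon> p ^ k * \<tau> p ^ l) (\<lambda>p. \<Sum>i<length rs. \<bar>\<epsilon> p\<bar> ^ (i + 1) * \<bar>\<tau> p\<bar> ^ (rs ! i + 1))"
proof (rule dominated_trans[OF dominated_power_mono[OF assms(2,3,4,5)]], rule dominatedI[where C = 1], rule always_eventually, rule allI)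
  fix p
  have "\<bar>\<epsilon> p\<bar> ^ (i + 1) * \<bar>\<tau> p\<bar> ^ (rs ! i + 1) \<le> (\<Sum>i<length rs. \<bar>\<epsilon> p\<bar> ^ (i + 1) * \<bar>\<tau> p\<bar> ^ (rs ! i + 1))"
    using assms(1) by (intro member_le_sum) auto
  then show "norm (\<epsilon> p ^ (i + 1) * \<tau> p ^ (rs ! i + 1))
      \<le> 1 * \<bar>\<Sum>i<length rs. \<bar>\<epsilon> p\<bar> ^ (i + 1) * \<bar>\<tau> p\<bar> ^ (rs ! i + 1)\<bar>"
    by (simp add: abs_mult power_abs del: power_Suc)
qed

lemma generalized_order_iff_dominated:
  "generalized_order M rs \<longleftrightarrow> sorted_wrt (\<ge>) rs \<and>
    (\<forall>fa fb x. smooth_on UNIV fa \<longrightarrow> smooth_on UNIV fb \<longrightarrow>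
      dominated (at (0, 0)) (\<lambda>p. M fa fb (snd p) (fst p) x - flow (\<lambda>y. fa y + snd p *\<^sub>R fb y) (fst p) x)
        (\<lambda>p. \<Sum>i<length rs. \<bar>snd p\<bar> ^ (i + 1) * \<bar>fst p\<bar> ^ (rs ! i + 1)))"
  by (auto simp: generalized_order_def dominated_iff_bigo case_prod_unfold)

text \<open>The error of \<open>M'\<close> is the difference \<open>M' - M\<close> plus the error of
  \<open>M\<close>. The latter is bounded term by term, because lowering an exponent or appending
  entries weakens the bound near (0, 0) up to a constant; the former is absorbed by the single term
  with index \<open>i\<close> of the new bound.\<close>

lemma generalized_order_transfer:
  assumes M: "generalized_order M rs" and rs': "sorted_wrt (\<ge>) rs'" "length rs \<le> length rs'"
      "\<And>i. i < length rs \<Longrightarrow> rs' ! i \<le> rs ! i"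
    and i: "i < length rs'" "i + 1 \<le> k" "rs' ! i + 1 \<le> l"
    and diff: "\<And>fa fb x. smooth_on UNIV fa \<Longrightarrow> smooth_on UNIV fb \<Longrightarrow>
      dominated (at (0, 0)) (\<lambda>p. M' fa fb (snd p) (fst p) x - M fa fb (snd p) (fst p) x) (\<lambda>p. snd p ^ k * fst p ^ l)"
  shows "generalized_order M' rs'"
  unfolding generalized_order_iff_dominated
proof (intro conjI rs'(1) allI impI)
  fix fa fb :: "'a \<Rightarrow> 'a" and x :: 'a assume f: "smooth_on UNIV fa" "smooth_on UNIV fb"
  let ?B = "\<lambda>rs p. \<Sum>i<length rs. \<bar>snd p\<bar> ^ (i + 1) * \<bar>fst p\<bar> ^ (rs ! i + 1) :: real"
  let ?F = "at (0, 0) :: (real \<times> real) filter"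
  have t: "(fst \<longlongrightarrow> 0) ?F" "(snd \<longlongrightarrow> 0) ?F"
    using tendsto_fst[OF tendsto_ident_at, of "(0::real, 0::real)" UNIV] tendsto_snd[OF tendsto_ident_at, of "(0::real, 0::real)" UNIV]
    by simp_all
  have "dominated ?F (\<lambda>p. \<Sum>i\<in>I. \<bar>snd p\<bar> ^ (i + 1) * \<bar>fst p\<bar> ^ (rs ! i + 1)) (?B rs')" if "I \<subseteq> {..<length rs}" for I
    using finite_subset[OF that finite_lessThan] that
  proof (induction I rule: finite_induct)
    case empty
    show ?case by (simp add: dominated_0)
  next
    case (insert j I)
    have "dominated ?F (\<lambda>p. snd p ^ (j + 1) * fst p ^ (rs ! j + 1)) (?B rs')"
      using insert.prems rs'(2,3) by (intro dominated_generalized_order_sum[OF _ t(2,1), of j]) auto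
    then have "dominated ?F (\<lambda>p. \<bar>snd p\<bar> ^ (j + 1) * \<bar>fst p\<bar> ^ (rs ! j + 1)) (?B rs')"
      by (simp add: dominated_def abs_mult power_abs del: power_Suc)
    then show ?case using insert by (simp add: dominated_add del: power_Suc)
  qed
  then have B: "dominated ?F (?B rs) (?B rs')" by simp
  have 1: "dominated ?F (\<lambda>p. M fa fb (snd p) (fst p) x - flow (\<lambda>y. fa y + snd p *\<^sub>R fb y) (fst p) x) (?B rs)"
    using M f unfolding generalized_order_iff_dominated by blast
  have "dominated ?F (\<lambda>p. M' fa fb (snd p) (fst p) x - M fa fb (snd p) (fst p) x) (?B rs')"
    by (rule dominated_trans[OF diff[OF f] dominated_generalized_order_sum[OF i(1) t(2,1) i(2,3)]])
  from dominated_add[OF this dominated_trans[OF 1 B]]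
  show "dominated ?F (\<lambda>p. M' fa fb (snd p) (fst p) x - flow (\<lambda>y. fa y + snd p *\<^sub>R fb y) (fst p) x) (?B rs')"
    by simp
qed

theorem mainTheorem2:
  fixes a b :: "nat \<Rightarrow> real" and r s :: nat
    and \<Phi> :: "(real ^ 'n) integrator"
  assumes "r \<ge> 4"
    and "\<forall>i\<in>{1..s + 1}. a (s + 2 - i) = a i"
    and "\<forall>i\<in>{1..s}. b (s + 1 - i) = b i"
    and "generalized_order (splitting_method a b s :: (real ^ 'n) one_step_method) [r, 4]"
    and "smooth_integrator \<Phi>"
    and "scaling_integrator \<Phi>"
    and "symmetric_integrator \<Phi>"
    and "second_order_integrator \<Phi>"
  shows "generalized_order (approx_splitting_method \<Phi> a b s) [r, 4, 2] \<and>
    ((\<Sum>i = 1..s. b i ^ 3) = 0 \<longrightarrow> generalized_order (approx_splitting_method \<Phi> a b s) [r, 4])"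
proof -
  let ?F = "at (0, 0) :: (real \<times> real) filter"
  have t: "(fst \<longlongrightarrow> 0) ?F" "(snd \<longlongrightarrow> 0) ?F"
    using tendsto_fst[OF tendsto_ident_at, of "(0::real, 0::real)" UNIV] tendsto_snd[OF tendsto_ident_at, of "(0::real, 0::real)" UNIV]
    by simp_all
  have split: "\<exists>V d e \<delta> C. perturbed_splitting \<Phi> fa fb x V d e \<delta> C"
    if f: "smooth_on UNIV fa" "smooth_on UNIV fb" for fa fb :: "real ^ 'n \<Rightarrow> real ^ 'n" and x
  proof -
    obtain V d e where V: "x \<in> V" "smooth_on V d" "smooth_on V e"
      and ex: "\<exists>\<delta>>0. \<exists>C. \<forall>h. \<forall>y\<in>cball x \<delta>. \<bar>h\<bar> \<le> \<delta> \<longrightarrow>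
        norm (\<Phi> fb h y - flow fb h y - h ^ 3 *\<^sub>R d y - h ^ 4 *\<^sub>R e y) \<le> C * \<bar>h\<bar> ^ 5"
      using integrator_expansion[OF assms(5,8) f(2), of x] by blast
    then obtain \<delta> C where "\<delta> > 0" "\<forall>h. \<forall>y\<in>cball x \<delta>. \<bar>h\<bar> \<le> \<delta> \<longrightarrow>
        norm (\<Phi> fb h y - flow fb h y - h ^ 3 *\<^sub>R d y - h ^ 4 *\<^sub>R e y) \<le> C * \<bar>h\<bar> ^ 5" by blast
    then have "perturbed_splitting \<Phi> fa fb x V d e \<delta> C"
      using V f assms(6) by unfold_locales (auto simp del: mem_cball)
    then show ?thesis by blast
  qed
  show ?thesis
  proof (intro conjI impI)
    show "generalized_order (approx_splitting_method \<Phi> a b s) [r, 4, 2]"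
    \<comment> \<open>Index 2 is the last entry of \<open>[r, 4, 2]\<close>, whose term
      \<open>\<bar>\<epsilon>\<bar>^3 \<bar>\<tau>\<bar>^3\<close> matches the discrepancy
      exactly.\<close>
    proof (rule generalized_order_transfer[OF assms(4), of _ 2 3 3])
      fix fa fb :: "real ^ 'n \<Rightarrow> real ^ 'n" and x assume "smooth_on UNIV fa" "smooth_on UNIV fb"
      then obtain V d e \<delta> C where "perturbed_splitting \<Phi> fa fb x V d e \<delta> C" using split by blast
      from perturbed_splitting.splitting_bounds(1)[OF this t tendsto_const]
      show "dominated ?F (\<lambda>p. approx_splitting_method \<Phi> a b s fa fb (snd p) (fst p) x - splitting_method a b s fa fb (snd p) (fst p) x)
        (\<lambda>p. snd p ^ 3 * fst p ^ 3)" .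
    qed (use assms(1) in \<open>auto simp: less_Suc_eq nth_Cons'\<close>)
    assume cubes: "(\<Sum>i = 1..s. b i ^ 3) = 0"
    show "generalized_order (approx_splitting_method \<Phi> a b s) [r, 4]"
    \<comment> \<open>Index 1 is the entry 4, whose term
      \<open>\<epsilon>^2 \<bar>\<tau>\<bar>^5\<close> absorbs \<open>\<epsilon>^3 \<tau>^5\<close>
      with one factor \<epsilon> to spare; this is how the third entry disappears.\<close>
    proof (rule generalized_order_transfer[OF assms(4), of _ 1 3 5])
      fix fa fb :: "real ^ 'n \<Rightarrow> real ^ 'n" and x assume "smooth_on UNIV fa" "smooth_on UNIV fb"
      then obtain V d e \<delta> C where "perturbed_splitting \<Phi> fa fb x V d e \<delta> C" using split by blast
      from perturbed_splitting.splitting_error_fifth_order[OF this assms(7,2,3) cubes t]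
      show "dominated ?F (\<lambda>p. approx_splitting_method \<Phi> a b s fa fb (snd p) (fst p) x - splitting_method a b s fa fb (snd p) (fst p) x)
        (\<lambda>p. snd p ^ 3 * fst p ^ 5)" .
    qed (use assms(1) in \<open>auto simp: less_Suc_eq nth_Cons'\<close>)
  qed
qed

end
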